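(* Let $0<\alpha<\tfrac12$, let $L:\mathbb R\to(0,\infty)$ be slowly varying, and let $\mu$ be a probability measure on $\mathbb N$ with $\mu(\{n,n+1,\ldots\})\sim n^{-\alpha}L(n)$ as $n\to\infty$ and $\gcd\{n\in\mathbb N:\mu(\{n\})>0\}=1$. Let $Y$ be a real-valued random variable, and assume that one of the following conditions (A) or (B) holds: (A) $Y=\xi-(2p-1)$, where $\mathbf P(\xi=+1)=p$ and $\mathbf P(\xi=-1)=1-p$ for some $p\in(0,1)$. (B) The renewal weights $q_n$ of $\mu$ satisfy $q_n\sim\frac{1}{\Gamma(\alpha)\Gamma(1-\alpha)}\frac{n^{\alpha-1}}{L(n)}$ as $n\to\infty$, and $\mathbf E[Y]=0$, $0<\mathbf E[Y^4]<\infty$. Then for all $T>0$ the sequence (in $n\in\mathbb N$) of random variables $\left(S^{(n)}(t)\right)_{0\le t\le T}$, taking values in $C([0,T];\mathbb R)$ equipped with the sup-norm, is tight.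
   Context: Here $\mathbb N=\{1,2,\ldots\}$, and $f(n)\sim g(n)$ for real sequences means $f(n)/g(n)\to1$. Random graph: let $(R_i)_{i\in\mathbb Z}$ be i.i.d. with distribution $\mu$. $\mathcal G_\mu$ is the random directed graph with vertex set $\mathbb Z$ and edge set $\{(i,i-R_i):i\in\mathbb Z\}$; connected components are taken ignoring edge directions. Renewal weights: $q_n:=\mathbf P(\tilde R_1+\cdots+\tilde R_j=n\text{ for some }j\ge0)$, with $\tilde R_1,\tilde R_2,\ldots$ independent with distribution $\mu$. Colouring: each connected component of $\mathcal G_\mu$ is coloured by an independent copy of $Y$ (colours independent of each other and of $\mathcal G_\mu$); $Y_i$ is the colour of the component containing $i\in\mathbb Z$. Put $S_n:=\sum_{i=1}^nY_i$ ($S_0=0$) and $\sigma_n^2:=\mathbf{Var}[S_n]$. Rescaled process: for $n\in\mathbb N$, $S^{(n)}=(S^{(n)}(t))_{t\ge0}$ is the continuous process with $S^{(n)}(i/n)=S_i/\sigma_n$ for $i\in\mathbb N_0$, and linear on each interval $[\frac{i-1}n,\frac in]$, $i\in\mathbb N$. *)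

theory Defs
  imports "HOL-Probability.Probability" "HOL-Library.Landau_Symbols"
begin

(* Positivity and the limit relation as in Feller; measurability of L is not required. *)
definition slowly_varying :: "(real \<Rightarrow> real) \<Rightarrow> bool" where
  "slowly_varying L \<longleftrightarrow>
     (\<forall>x. L x > 0) \<and> (\<forall>c>0. ((\<lambda>x. L (c * x) / L x) \<longlongrightarrow> 1) at_top)"

(* The j-th partial sum has the j summands r 0, ..., r (j - 1); hence j = 0 contributes at n = 0. *)
definition renewal_weight :: "nat pmf \<Rightarrow> nat \<Rightarrow> real" where
  "renewal_weight \<mu> n =
     (let P = Pi\<^sub>M (UNIV :: nat set) (\<lambda>_. measure_pmf \<mu>)
      in measure P {r \<in> space P. \<exists>j. (\<Sum>i<j. r i) = n})"

definition graph_edges :: "(int \<Rightarrow> nat) \<Rightarrow> (int \<times> int) set" where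
  "graph_edges r = {(i, i - int (r i)) | i. True}"

definition graph_connected :: "(int \<Rightarrow> nat) \<Rightarrow> int \<Rightarrow> int \<Rightarrow> bool" where
  "graph_connected r i j \<longleftrightarrow> (i, j) \<in> (graph_edges r \<union> (graph_edges r)\<inverse>)\<^sup>*"

(* A measurable rule that selects one representative vertex in every component of the graph. *)
definition component_representative :: "((int \<Rightarrow> nat) \<Rightarrow> int \<Rightarrow> int) \<Rightarrow> bool" where
  "component_representative rep \<longleftrightarrow>
     (\<forall>r i. graph_connected r i (rep r i)) \<and>
     (\<forall>r i j. graph_connected r i j \<longrightarrow> rep r i = rep r j) \<and>
     (\<forall>i. (\<lambda>r. rep r i) \<in> Pi\<^sub>M UNIV (\<lambda>_. count_space UNIV) \<rightarrow>\<^sub>M count_space UNIV)"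

(*
  C j is the colour of the component represented by the vertex j. As rep is a function of the
  graph alone, independence of the C j among each other and of the R i says that, given the
  graph, distinct components carry independent copies of the colour law. The R i are made
  real-valued only in order to state the joint independence as that of a single family.
*)
locale coloured_graph = prob_space M
  for M :: "'a measure" and \<mu> :: "nat pmf" and colour_law :: "real measure"
    and R :: "int \<Rightarrow> 'a \<Rightarrow> nat" and rep :: "(int \<Rightarrow> nat) \<Rightarrow> int \<Rightarrow> int"
    and C :: "int \<Rightarrow> 'a \<Rightarrow> real" +
  assumes R_measurable: "\<And>i. R i \<in> M \<rightarrow>\<^sub>M count_space UNIV"
    and R_law: "\<And>i. distr M (count_space UNIV) (R i) = measure_pmf \<mu>"
    and C_law: "\<And>j. distr M borel (C j) = colour_law"
    and independent: "indep_vars (\<lambda>_. borel) (case_sum (\<lambda>i \<omega>. real (R i \<omega>)) C) UNIV"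
    and representative: "component_representative rep"

definition vertex_colour ::
  "(int \<Rightarrow> 'a \<Rightarrow> nat) \<Rightarrow> ((int \<Rightarrow> nat) \<Rightarrow> int \<Rightarrow> int) \<Rightarrow> (int \<Rightarrow> 'a \<Rightarrow> real) \<Rightarrow> int \<Rightarrow> 'a \<Rightarrow> real" where
  "vertex_colour R rep C i \<omega> = C (rep (\<lambda>k. R k \<omega>) i) \<omega>"

definition partial_sum :: "(int \<Rightarrow> 'a \<Rightarrow> real) \<Rightarrow> nat \<Rightarrow> 'a \<Rightarrow> real" where
  "partial_sum Y n \<omega> = (\<Sum>i=1..n. Y (int i) \<omega>)"

definition std_deviation :: "'a measure \<Rightarrow> ('a \<Rightarrow> real) \<Rightarrow> real" where
  "std_deviation M X = sqrt (prob_space.variance M X)"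

(* Linear interpolation of the values S i / sigma_n at the points i / n. *)
definition rescaled_path ::
  "'a measure \<Rightarrow> (nat \<Rightarrow> 'a \<Rightarrow> real) \<Rightarrow> nat \<Rightarrow> 'a \<Rightarrow> real \<Rightarrow> real" where
  "rescaled_path M S n \<omega> t =
     (let k = nat \<lfloor>real n * t\<rfloor>
      in (S k \<omega> + (real n * t - real k) * (S (Suc k) \<omega> - S k \<omega>)) / std_deviation M (S n))"

(* Functions are extensional outside {0..T}; the metric of cfunspace is the sup-metric. *)
definition C_space :: "real \<Rightarrow> (real \<Rightarrow> real) topology" where
  "C_space T = mtopology_of (cfunspace (top_of_set {0..T}) euclidean_metric)"

definition borel_of :: "'b topology \<Rightarrow> 'b measure" where
  "borel_of X = sigma (topspace X) {U. openin X U}"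

definition tight_random_variables ::
  "'a measure \<Rightarrow> 'b topology \<Rightarrow> 'i set \<Rightarrow> ('i \<Rightarrow> 'a \<Rightarrow> 'b) \<Rightarrow> bool" where
  "tight_random_variables M X I Z \<longleftrightarrow>
     (\<forall>n\<in>I. Z n \<in> M \<rightarrow>\<^sub>M borel_of X) \<and>
     (\<forall>\<epsilon>>0. \<exists>K. compactin X K \<and>
        (\<forall>n\<in>I. measure M {\<omega> \<in> space M. Z n \<omega> \<in> K} \<ge> 1 - \<epsilon>))"

end

theory Submission
  imports Defs "HOL-Complex_Analysis.Great_Picard"
begin

text \<open>
  Write $T(n) = \mu\{n, n + 1, \ldots\}$ and let $q$ be the renewal sequence of $\mu$. The rescaled
  paths are tight because of the Kolmogorov criterion with second moments,
  $E |S^{(n)}(t) - S^{(n)}(s)|^2 \le D |t - s|^{1 + \alpha}$. The exponent exceeds one since vertices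
  of one component share their colour: the variance of $S_n$ has the superlinear order $n / T(n)^2$,
  and $T$ is regularly varying with index $-\alpha$.

  Under (A) and under (B) the colours are centred with a finite positive variance $v$. As the graph is
  stationary, $E (S_{k+m} - S_k)^2 = \sigma_m^2 = v \sum_{i,j<m} P(i \leftrightarrow j)$, so the
  criterion reduces to a comparison of $\sigma_m^2$ with $\sigma_n^2$ (\<open>pair_sum_growth\<close>).

  Follow the ancestral lines of two vertices and always move the higher of the two current vertices.
  Each step then uses a fresh jump, and the distance $k$ becomes $|k - r|$ with probability $\mu\{r\}$.
  The function $G(k) = \sum_m q_m q_{m+k}$ is harmonic for this chain off $0$ and vanishes at infinity,
  hence $P(i \leftrightarrow j) = G(|i - j|) / G(0)$ (\<open>meet_within_tendsto_green\<close>,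
  \<open>prob_same_representative\<close>). Summing, $\sigma_n^2$ is a constant times the squared $\ell^2$ norm of
  the convolution of $q$ with the indicator of $\{0, \ldots, n - 1\}$.

  The norm is at least of order $n / T(n)^2$ because $q_0 + \cdots + q_n \ge c / T(n + 1)$, as the
  decomposition of a renewal process at its last point up to $n$ shows (\<open>pair_sum_lower_bound\<close>). For the
  converse (\<open>window_l2_bound\<close>) Parseval's identity turns the norm into an integral of
  $|D_n|^2 / |1 - \phi|^2$, with $D_n$ a geometric sum and $\phi$ the characteristic function of $\mu$.
  Here $|1 - \phi(\theta)| \ge c\, T(\lceil 1 / \theta \rceil)$: near $0$ by regular variation, elsewhere
  by aperiodicity. The singularity $\theta^{-2 \alpha}$ at $0$ is integrable exactly because
  $\alpha < 1/2$.

  On the path side, geometric decay of the increments over dyadic intervals describes a compact set of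
  paths (\<open>compactin_dyadic_compact\<close>), and Markov's inequality shows that each rescaled path lies in
  one fixed such set with probability close to one (\<open>dyadic_increment_tail\<close>).
\<close>

section \<open>Potter bounds from the doubling ratio\<close>

lemma dyadic_scale_exists:
  fixes m n :: nat
  assumes "1 \<le> m" "m \<le> n"
  obtains j where "2 ^ j * m \<le> n" "n < 2 ^ Suc j * m"
proof -
  have "1 \<le> n div m" using assms by (simp add: less_eq_div_iff_mult_less_eq)
  then obtain j where "2 ^ j \<le> n div m" "n div m < 2 ^ (j + 1)"
    using ex_power_ivl1[of 2 "n div m"] by auto
  with assms(1) show ?thesis
    using that[of j] by (simp add: less_eq_div_iff_mult_less_eq div_less_iff_less_mult)
qed

lemma power_two_powr_log:
  fixes \<kappa> :: real assumes "0 < \<kappa>"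
  shows "\<kappa> ^ j = real (2 ^ j) powr log 2 \<kappa>"
proof -
  have "real (2 ^ j) powr log 2 \<kappa> = (2 powr real j) powr log 2 \<kappa>" by (simp add: powr_realpow)
  also have "\<dots> = (2 powr log 2 \<kappa>) powr real j" by (simp add: powr_powr mult.commute)
  also have "\<dots> = \<kappa> ^ j" using assms by (simp add: powr_realpow)
  finally show ?thesis by simp
qed

text \<open>Iterate the doubling estimate from \<open>m\<close> along \<open>2 ^ j * m\<close>. It may fail for the first \<open>n0\<close> steps only, and
  each of these costs a constant factor by the estimate on octaves, which also fills the gap between
  the last power of two and \<open>n\<close>. For a monotone sequence the octaves are harmless, so they take the place
  of the uniform convergence theorem for slowly varying functions.\<close>
lemma potter_bound:
  fixes f :: "nat \<Rightarrow> real"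
  assumes pos: "\<And>n. 0 < f n" and \<kappa>: "0 < \<kappa>" and D: "1 \<le> D"
    and octave: "\<And>m n. 1 \<le> m \<Longrightarrow> m \<le> n \<Longrightarrow> n \<le> 2 * m \<Longrightarrow> f n \<le> D * f m"
    and ev: "eventually (\<lambda>n. f (2 * n) \<le> \<kappa> * f n) sequentially"
  shows "\<exists>K>0. \<forall>m n. 1 \<le> m \<longrightarrow> m \<le> n \<longrightarrow> f n \<le> K * (real n / real m) powr log 2 \<kappa> * f m"
proof -
  define b where "b = log 2 \<kappa>"
  obtain n0 where n0: "\<And>n. n \<ge> n0 \<Longrightarrow> f (2 * n) \<le> \<kappa> * f n"
    using ev by (auto simp: eventually_sequentially)
  define c where "c = max 1 (D / \<kappa>)"
  have c: "1 \<le> c" "D \<le> c * \<kappa>" using \<kappa> by (auto simp: c_def max_def field_simps)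
  have iter: "f (2 ^ j * m) \<le> c ^ n0 * \<kappa> ^ j * f m" if m: "1 \<le> m" for m j
  proof -
    have "f (2 ^ j * m) \<le> c ^ min j n0 * \<kappa> ^ j * f m"
    proof (induction j)
      case (Suc j)
      have "j < 2 ^ j" by (rule less_exp)
      also have "2 ^ j \<le> 2 ^ j * m" using m by simp
      finally have pw: "j < 2 ^ j * m" .
      have "f (2 ^ Suc j * m) \<le> (if j < n0 then c else 1) * \<kappa> * f (2 ^ j * m)"
      proof (cases "j < n0")
        case True
        have "f (2 ^ Suc j * m) \<le> D * f (2 ^ j * m)" by (rule octave) (use m in auto)
        also have "\<dots> \<le> c * \<kappa> * f (2 ^ j * m)" using c(2) pos by (intro mult_right_mono) (auto intro: less_imp_le)
        finally show ?thesis using True by simp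
      next
        case False
        hence "n0 \<le> 2 ^ j * m" using pw by linarith
        then show ?thesis using n0[of "2 ^ j * m"] False by (simp add: mult.assoc)
      qed
      also have "\<dots> \<le> (if j < n0 then c else 1) * \<kappa> * (c ^ min j n0 * \<kappa> ^ j * f m)"
        using Suc c \<kappa> by (intro mult_left_mono) auto
      also have "\<dots> = c ^ min (Suc j) n0 * \<kappa> ^ Suc j * f m"
        by (auto simp: min_def Suc_le_eq)
      finally show ?case .
    qed simp
    also have "\<dots> \<le> c ^ n0 * \<kappa> ^ j * f m"
      using c \<kappa> pos[of m] by (intro mult_right_mono power_increasing) auto
    finally show ?thesis .
  qed
  have "f n \<le> (D * c ^ n0 * max 1 (1 / \<kappa>)) * (real n / real m) powr b * f m" if mn: "1 \<le> m" "m \<le> n" for m n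
  proof -
    obtain j where j: "2 ^ j * m \<le> n" "n < 2 ^ Suc j * m"
      using dyadic_scale_exists[OF mn] .
    define x where "x = real n / real m"
    have x: "2 ^ j \<le> x" "x \<le> 2 * 2 ^ j"
    proof -
      have "real (2 ^ j * m) \<le> real n" "real n \<le> real (2 ^ Suc j * m)"
        using j by (simp_all only: of_nat_le_iff less_imp_le)
      thus "2 ^ j \<le> x" "x \<le> 2 * 2 ^ j" using mn by (simp_all add: x_def field_simps)
    qed
    have x0: "0 < x" using x(1) by (rule less_le_trans[rotated]) simp
    define y where "y = 2 ^ j / x"
    have y: "0 < y" "y \<le> 1" "1 / 2 \<le> y" using x x0 by (auto simp: y_def field_simps)
    have yb: "y powr b \<le> max 1 (1 / \<kappa>)"
    proof (cases "0 \<le> b")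
      case True
      have "y powr b \<le> 1 powr b" using y True by (intro powr_mono2) auto
      thus ?thesis by simp
    next
      case False
      have "y powr b \<le> (1 / 2) powr b" using y False by (intro powr_mono2') auto
      also have "\<dots> = 1 / \<kappa>" using \<kappa> by (simp add: b_def powr_divide)
      finally show ?thesis by simp
    qed
    have "f n \<le> D * f (2 ^ j * m)" by (rule octave) (use j mn in auto)
    also have "\<dots> \<le> D * (c ^ n0 * \<kappa> ^ j * f m)" using iter[OF mn(1), of j] D by (intro mult_left_mono) auto
    also have "\<kappa> ^ j = (y * x) powr b"
      using power_two_powr_log[OF \<kappa>, of j] x0 by (simp add: b_def y_def)
    also have "\<dots> = y powr b * x powr b" by (rule powr_mult)
    also have "D * (c ^ n0 * (y powr b * x powr b) * f m) = D * c ^ n0 * f m * x powr b * y powr b" by simp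
    also have "\<dots> \<le> D * c ^ n0 * f m * x powr b * max 1 (1 / \<kappa>)"
      using D c pos[of m] by (intro mult_left_mono yb) auto
    finally have "f n \<le> D * c ^ n0 * f m * x powr b * max 1 (1 / \<kappa>)" .
    thus ?thesis unfolding x_def by (simp add: mult_ac)
  qed
  thus ?thesis unfolding b_def using D c by (intro exI[of _ "D * c ^ n0 * max 1 (1 / \<kappa>)"]) auto
qed

section \<open>Regularly varying jump tails\<close>

definition tail :: "nat pmf \<Rightarrow> nat \<Rightarrow> real" where
  "tail \<mu> n = measure_pmf.prob \<mu> {n..}"

lemma tail_antimono: "decseq (tail \<mu>)"
  unfolding tail_def decseq_def by (auto intro!: measure_pmf.finite_measure_mono)

lemma tail_le_1: "tail \<mu> n \<le> 1"
  by (simp add: tail_def)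

lemma tail_step: "tail \<mu> n = pmf \<mu> n + tail \<mu> (Suc n)"
proof -
  have "{n..} = {n} \<union> {Suc n..}" by auto
  hence "tail \<mu> n = measure_pmf.prob \<mu> {n} + measure_pmf.prob \<mu> {Suc n..}"
    unfolding tail_def by (simp only: measure_pmf.finite_measure_Union) (subst measure_pmf.finite_measure_Union, auto)
  thus ?thesis by (simp add: tail_def measure_pmf_single)
qed

lemma tail_Suc_0:
  assumes "set_pmf \<mu> \<subseteq> {1..}" shows "tail \<mu> (Suc 0) = 1"
  using assms unfolding tail_def 
  by (subst measure_pmf.prob_eq_1) (auto simp: AE_measure_pmf_iff)

lemma tail_pos:
  assumes L: "slowly_varying L"
    and tail: "(\<lambda>n. measure_pmf.prob \<mu> {n..}) \<sim>[at_top] (\<lambda>n. real n powr (-\<alpha>) * L (real n))"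
  shows "0 < tail \<mu> n"
proof -
  have "eventually (\<lambda>n. (tail \<mu> n = 0) = (real n powr (-\<alpha>) * L (real n) = 0)) sequentially"
    using asymp_equiv_eventually_zeros[OF tail] by (simp add: tail_def)
  hence "eventually (\<lambda>n. tail \<mu> n \<noteq> 0) sequentially"
    using eventually_gt_at_top[of 0]
  proof eventually_elim
    case (elim n)
    moreover have "L (real n) > 0" using L by (simp add: slowly_varying_def)
    ultimately show ?case by auto
  qed
  then obtain m where m: "\<And>k. k \<ge> m \<Longrightarrow> tail \<mu> k \<noteq> 0" by (auto simp: eventually_sequentially)
  have "tail \<mu> (max n m) \<noteq> 0" using m by simp
  moreover have "tail \<mu> (max n m) \<ge> 0" by (simp add: tail_def)
  moreover have "tail \<mu> (max n m) \<le> tail \<mu> n" using tail_antimono[of \<mu>] by (simp add: decseq_def)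
  ultimately show ?thesis by linarith
qed

text \<open>Slow variation makes the limit of the quotients at the ratio two that of the power; in this form regular
  variation enters the later estimates.\<close>
lemma tail_doubling_limit:
  assumes L: "slowly_varying L"
    and tail: "(\<lambda>n. measure_pmf.prob \<mu> {n..}) \<sim>[at_top] (\<lambda>n. real n powr (-\<alpha>) * L (real n))"
  shows "(\<lambda>n. tail \<mu> (2 * n) / tail \<mu> n) \<longlonglongrightarrow> 2 powr (-\<alpha>)"
proof -
  define g where "g = (\<lambda>n. real n powr (-\<alpha>) * L (real n))"
  have eq: "tail \<mu> \<sim>[sequentially] g" using tail unfolding tail_def g_def .
  have "filterlim (\<lambda>n::nat. 2 * n) sequentially sequentially"
    by (rule filterlim_subseq) (auto simp: strict_mono_def)
  hence eq2: "(\<lambda>n. tail \<mu> (2 * n)) \<sim>[sequentially] (\<lambda>n. g (2 * n))"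
    by (rule asymp_equiv_compose'[OF eq])
  have "(\<lambda>n. tail \<mu> (2 * n) / tail \<mu> n) \<sim>[sequentially] (\<lambda>n. g (2 * n) / g n)"
    by (rule asymp_equiv_divide[OF eq2 eq])
  moreover have "(\<lambda>n. g (2 * n) / g n) \<longlonglongrightarrow> 2 powr (-\<alpha>)"
  proof -
    have "((\<lambda>x. L (2 * x) / L x) \<longlongrightarrow> 1) at_top" using L by (simp add: slowly_varying_def)
    hence "(\<lambda>n. L (2 * real n) / L (real n)) \<longlonglongrightarrow> 1"
      by (rule filterlim_compose) (rule filterlim_real_sequentially)
    hence "(\<lambda>n. 2 powr (-\<alpha>) * (L (2 * real n) / L (real n))) \<longlonglongrightarrow> 2 powr (-\<alpha>) * 1"
      by (intro tendsto_intros)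
    moreover have "eventually (\<lambda>n. 2 powr (-\<alpha>) * (L (2 * real n) / L (real n)) = g (2 * n) / g n) sequentially"
      using eventually_gt_at_top[of 0]
      by eventually_elim (simp add: g_def powr_mult)
    ultimately show ?thesis by (simp add: tendsto_cong)
  qed
  ultimately show ?thesis using tendsto_asymp_equiv_cong by blast
qed

lemma tail_potter_lower:
  assumes L: "slowly_varying L"
    and tail: "(\<lambda>n. measure_pmf.prob \<mu> {n..}) \<sim>[at_top] (\<lambda>n. real n powr (-\<alpha>) * L (real n))"
    and "\<alpha> < \<beta>"
  shows "\<exists>K>0. \<forall>m n. 1 \<le> m \<longrightarrow> m \<le> n \<longrightarrow> tail \<mu> m \<le> K * (real n / real m) powr \<beta> * tail \<mu> n"
proof -
  note pos = tail_pos[OF L tail]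
  have lim: "(\<lambda>n. inverse (tail \<mu> (2 * n) / tail \<mu> n)) \<longlonglongrightarrow> inverse (2 powr (-\<alpha>))"
    by (intro tendsto_inverse tail_doubling_limit[OF L tail]) simp
  obtain D where D: "\<And>n. norm (inverse (tail \<mu> (2 * n) / tail \<mu> n)) \<le> D"
    using convergent_imp_Bseq[OF convergentI[OF lim]] unfolding Bseq_def by blast
  have octave: "inverse (tail \<mu> n) \<le> max 1 D * inverse (tail \<mu> m)" if "n \<le> 2 * m" for m n
  proof -
    have "inverse (tail \<mu> n) \<le> inverse (tail \<mu> (2 * m))"
      using that tail_antimono[of \<mu>] pos by (intro le_imp_inverse_le) (auto simp: decseq_def)
    also have "\<dots> = inverse (tail \<mu> (2 * m) / tail \<mu> m) * inverse (tail \<mu> m)"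
      using pos[of m] by (simp add: inverse_eq_divide)
    also have "\<dots> \<le> max 1 D * inverse (tail \<mu> m)"
      using D[of m] pos[of m] pos[of "2 * m"] by (intro mult_right_mono) auto
    finally show ?thesis .
  qed
  have "inverse (2 powr (-\<alpha>)) < 2 powr \<beta>" using \<open>\<alpha> < \<beta>\<close> by (simp add: powr_minus)
  from order_tendstoD(2)[OF lim this]
  have ev: "eventually (\<lambda>n. inverse (tail \<mu> (2 * n)) \<le> 2 powr \<beta> * inverse (tail \<mu> n)) sequentially"
    by eventually_elim (use pos in \<open>simp add: field_simps less_imp_le\<close>)
  have "\<exists>K>0. \<forall>m n. 1 \<le> m \<longrightarrow> m \<le> n \<longrightarrow>
      inverse (tail \<mu> n) \<le> K * (real n / real m) powr log 2 (2 powr \<beta>) * inverse (tail \<mu> m)"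
  proof (rule potter_bound)
    show "0 < inverse (tail \<mu> n)" for n using pos by simp
    show "inverse (tail \<mu> n) \<le> max 1 D * inverse (tail \<mu> m)" if "n \<le> 2 * m" for m n
      using that by (rule octave)
  qed (use ev in auto)
  then obtain K where K: "K > 0" "\<And>m n. 1 \<le> m \<Longrightarrow> m \<le> n \<Longrightarrow>
      inverse (tail \<mu> n) \<le> K * (real n / real m) powr \<beta> * inverse (tail \<mu> m)" by auto
  have "tail \<mu> m \<le> K * (real n / real m) powr \<beta> * tail \<mu> n" if "1 \<le> m" "m \<le> n" for m n
    using K(2)[OF that] pos[of m] pos[of n] by (simp add: field_simps)
  with K(1) show ?thesis by blast
qed

lemma tail_potter_upper:
  assumes L: "slowly_varying L"
    and tail: "(\<lambda>n. measure_pmf.prob \<mu> {n..}) \<sim>[at_top] (\<lambda>n. real n powr (-\<alpha>) * L (real n))"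
    and "\<beta> < \<alpha>"
  shows "\<exists>K>0. \<forall>m n. 1 \<le> m \<longrightarrow> m \<le> n \<longrightarrow> tail \<mu> n \<le> K * (real n / real m) powr (-\<beta>) * tail \<mu> m"
proof -
  note pos = tail_pos[OF L tail]
  have "2 powr (-\<alpha>) < 2 powr (-\<beta>)" using assms by simp
  from order_tendstoD(2)[OF tail_doubling_limit[OF L tail] this]
  have "eventually (\<lambda>n. tail \<mu> (2 * n) \<le> 2 powr (-\<beta>) * tail \<mu> n) sequentially"
    by eventually_elim (use pos in \<open>simp add: field_simps less_imp_le\<close>)
  moreover have "tail \<mu> n \<le> 1 * tail \<mu> m" if "m \<le> n" for m n
    using that tail_antimono[of \<mu>] by (simp add: decseq_def)
  ultimately have "\<exists>K>0. \<forall>m n. 1 \<le> m \<longrightarrow> m \<le> n \<longrightarrow>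
      tail \<mu> n \<le> K * (real n / real m) powr log 2 (2 powr (-\<beta>)) * tail \<mu> m"
    by (intro potter_bound[where D = 1] pos) auto
  thus ?thesis by simp
qed

section \<open>The renewal sequence\<close>

function renewal_seq :: "nat pmf \<Rightarrow> nat \<Rightarrow> real" where
  "renewal_seq \<mu> n = (if n = 0 then 1 else \<Sum>r\<in>{1..n}. pmf \<mu> r * renewal_seq \<mu> (n - r))"
  by auto
termination by (relation "Wellfounded.measure snd") auto

declare renewal_seq.simps [simp del]

lemma renewal_seq_0 [simp]: "renewal_seq \<mu> 0 = 1"
  by (simp add: renewal_seq.simps)

lemma renewal_seq_rec: "0 < n \<Longrightarrow> renewal_seq \<mu> n = (\<Sum>r\<in>{1..n}. pmf \<mu> r * renewal_seq \<mu> (n - r))"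
  by (subst renewal_seq.simps) simp

lemma renewal_seq_nonneg: "0 \<le> renewal_seq \<mu> n"
proof (induction n rule: less_induct)
  case (less n)
  then show ?case
    by (cases "n = 0") (auto simp: renewal_seq_rec intro!: sum_nonneg mult_nonneg_nonneg)
qed

text \<open>A renewal process that starts at \<open>0\<close> has exactly one last point \<open>j\<close> in \<open>{..n}\<close>; the summand is
  the probability that this point is \<open>j\<close> and that the next jump leaves \<open>{..n}\<close>.\<close>
lemma last_renewal_identity:
  assumes supp: "set_pmf \<mu> \<subseteq> {1..}"
  shows "(\<Sum>j\<le>n. renewal_seq \<mu> j * tail \<mu> (Suc (n - j))) = 1"
proof (induction n)
  case 0
  then show ?case using tail_Suc_0[OF supp] by simp
next
  case (Suc n)
  have "(\<Sum>j\<le>n. renewal_seq \<mu> j * tail \<mu> (Suc (n - j)))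
      = (\<Sum>j\<le>n. renewal_seq \<mu> j * pmf \<mu> (Suc n - j)) + (\<Sum>j\<le>n. renewal_seq \<mu> j * tail \<mu> (Suc (Suc n - j)))"
    unfolding sum.distrib[symmetric]
  proof (intro sum.cong refl)
    fix j assume "j \<in> {..n}"
    thus "renewal_seq \<mu> j * tail \<mu> (Suc (n - j)) = renewal_seq \<mu> j * pmf \<mu> (Suc n - j) + renewal_seq \<mu> j * tail \<mu> (Suc (Suc n - j))"
      using tail_step[of \<mu> "Suc n - j"] by (simp add: Suc_diff_le distrib_left)
  qed
  also have "(\<Sum>j\<le>n. renewal_seq \<mu> j * pmf \<mu> (Suc n - j)) = renewal_seq \<mu> (Suc n)"
    unfolding renewal_seq_rec[OF zero_less_Suc]
    by (rule sum.reindex_bij_witness[of _ "\<lambda>r. Suc n - r" "\<lambda>j. Suc n - j"]) auto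
  finally show ?case using Suc tail_Suc_0[OF supp] by simp
qed

lemma renewal_seq_le_1:
  assumes supp: "set_pmf \<mu> \<subseteq> {1..}"
  shows "renewal_seq \<mu> n \<le> 1"
proof -
  have "renewal_seq \<mu> n * tail \<mu> (Suc (n - n)) \<le> (\<Sum>j\<le>n. renewal_seq \<mu> j * tail \<mu> (Suc (n - j)))"
    by (rule member_le_sum) (auto simp: renewal_seq_nonneg tail_def)
  thus ?thesis using last_renewal_identity[OF supp, of n] tail_Suc_0[OF supp] by simp
qed

text \<open>The last-renewal identity, summed over the first \<open>n + 1\<close> horizons.\<close>
lemma renewal_sum_times_tail_sum:
  assumes supp: "set_pmf \<mu> \<subseteq> {1..}"
  shows "real (Suc n) \<le> (\<Sum>j\<le>n. renewal_seq \<mu> j) * (\<Sum>k=1..Suc n. tail \<mu> k)"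
proof -
  have "real (Suc n) = (\<Sum>m\<le>n. \<Sum>j\<le>m. renewal_seq \<mu> j * tail \<mu> (Suc (m - j)))"
    using last_renewal_identity[OF supp] by simp
  also have "\<dots> = (\<Sum>j\<le>n. \<Sum>m=j..n. renewal_seq \<mu> j * tail \<mu> (Suc (m - j)))"
    by (subst sum.Sigma, simp, simp, subst sum.Sigma, simp, simp)
       (rule sum.reindex_bij_witness[of _ "\<lambda>(a,b). (b,a)" "\<lambda>(a,b). (b,a)"], auto)
  also have "\<dots> \<le> (\<Sum>j\<le>n. renewal_seq \<mu> j * (\<Sum>k=1..Suc n. tail \<mu> k))"
  proof (intro sum_mono)
    fix j assume "j \<in> {..n}"
    have "(\<Sum>m=j..n. tail \<mu> (Suc (m - j))) = (\<Sum>k\<in>(\<lambda>m. Suc (m - j)) ` {j..n}. tail \<mu> k)"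
      by (subst sum.reindex) (auto simp: inj_on_def)
    also have "\<dots> \<le> (\<Sum>k=1..Suc n. tail \<mu> k)"
      by (rule sum_mono2) (auto simp: tail_def)
    finally show "(\<Sum>m=j..n. renewal_seq \<mu> j * tail \<mu> (Suc (m - j)))
        \<le> renewal_seq \<mu> j * (\<Sum>k=1..Suc n. tail \<mu> k)"
      by (simp add: sum_distrib_left[symmetric] mult_left_mono renewal_seq_nonneg)
  qed
  finally show ?thesis by (simp add: sum_distrib_right)
qed

lemma sum_inverse_sqrt_le: "(\<Sum>k=1..n. 1 / sqrt (real k)) \<le> 2 * sqrt (real n)"
proof (induction n)
  case (Suc n)
  have "1 / sqrt (real (Suc n)) \<le> 2 * (sqrt (real (Suc n)) - sqrt (real n))"
  proof -
    define a b where "a = sqrt (real (Suc n))" and "b = sqrt (real n)"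
    have "a > 0" "b \<ge> 0" "b \<le> a" "a\<^sup>2 - b\<^sup>2 = 1" by (auto simp: a_def b_def)
    hence "1 = (a - b) * (a + b)" by (simp add: power2_eq_square algebra_simps)
    also have "\<dots> \<le> (a - b) * (2 * a)" using \<open>b \<le> a\<close> by (intro mult_left_mono) auto
    finally show ?thesis using \<open>a > 0\<close> unfolding a_def[symmetric] b_def[symmetric] by (simp add: field_simps)
  qed
  then show ?case using Suc by simp
qed simp

text \<open>A regularly varying tail of index below one half satisfies these bounds for every exponent
  between its index and one half; in this form the index enters the upper and the lower estimate of the variance.\<close>
locale potter_tail =
  fixes \<mu> :: "nat pmf" and K \<beta> :: real
  assumes supp: "set_pmf \<mu> \<subseteq> {1..}" and pos: "\<And>n. 0 < tail \<mu> n" and K: "0 < K"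
    and pot: "\<And>m n. 1 \<le> m \<Longrightarrow> m \<le> n \<Longrightarrow> tail \<mu> m \<le> K * (real n / real m) powr \<beta> * tail \<mu> n"
    and beta: "0 < \<beta>" "\<beta> < 1 / 2"

text \<open>Since the Potter exponent is below one, the sum of the tails up to \<open>n\<close> is at most of the order of
  \<open>n\<close> times the last tail. As the exponent is even below one half, comparison with inverse
  square roots gives this.\<close>
lemma (in potter_tail) renewal_sum_lower_bound:
  shows "1 / (2 * K * tail \<mu> (Suc n)) \<le> (\<Sum>j\<le>n. renewal_seq \<mu> j)"
proof -
  let ?N = "Suc n" and ?U = "\<Sum>j\<le>n. renewal_seq \<mu> j"
  have "(\<Sum>k=1..?N. tail \<mu> k) \<le> (\<Sum>k=1..?N. K * tail \<mu> ?N * sqrt (real ?N) * (1 / sqrt (real k)))"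
  proof (intro sum_mono)
    fix k assume k: "k \<in> {1..?N}"
    \<comment> \<open>the ratio is at least one, so the larger exponent gives the larger power\<close>
    have "(real ?N / real k) powr \<beta> \<le> (real ?N / real k) powr (1/2)"
      using k beta by (intro powr_mono) (auto simp: field_simps)
    also have "\<dots> = sqrt (real ?N) * (1 / sqrt (real k))"
      by (simp add: powr_half_sqrt real_sqrt_divide)
    finally have "K * (real ?N / real k) powr \<beta> * tail \<mu> ?N \<le> K * (sqrt (real ?N) * (1 / sqrt (real k))) * tail \<mu> ?N"
      using K pos[of ?N] by (intro mult_right_mono mult_left_mono) auto
    with pot[of k ?N] k show "tail \<mu> k \<le> K * tail \<mu> ?N * sqrt (real ?N) * (1 / sqrt (real k))"
      by (simp add: mult_ac)
  qed
  also have "\<dots> = K * tail \<mu> ?N * sqrt (real ?N) * (\<Sum>k=1..?N. 1 / sqrt (real k))"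
    by (simp only: sum_distrib_left)
  also have "\<dots> \<le> K * tail \<mu> ?N * sqrt (real ?N) * (2 * sqrt (real ?N))"
    using sum_inverse_sqrt_le[of ?N] K pos[of ?N] by (intro mult_left_mono) auto
  also have "\<dots> = 2 * K * tail \<mu> ?N * (sqrt (real ?N) * sqrt (real ?N))" by (simp only: mult_ac)
  also have "\<dots> = 2 * K * tail \<mu> ?N * real ?N" by (simp only: real_sqrt_mult_self abs_of_nat)
  finally have H: "(\<Sum>k=1..?N. tail \<mu> k) \<le> 2 * K * tail \<mu> ?N * real ?N" .
  have "0 \<le> ?U" by (simp add: sum_nonneg renewal_seq_nonneg)
  hence "real ?N \<le> ?U * (2 * K * tail \<mu> ?N * real ?N)"
    using renewal_sum_times_tail_sum[OF supp, of n] mult_left_mono[OF H] by (meson order_trans)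
  also have "\<dots> = (?U * (2 * K * tail \<mu> ?N)) * real ?N" by simp
  finally have "1 \<le> ?U * (2 * K * tail \<mu> ?N)" by (simp del: of_nat_Suc)
  thus ?thesis using K pos[of ?N] by (simp add: divide_le_eq mult_ac)
qed

section \<open>Square sums of trigonometric series\<close>

lemma has_integral_cos_multiple:
  "((\<lambda>\<theta>. cos (of_int k * \<theta>)) has_integral (if k = 0 then pi else 0)) {0..pi}"
proof (cases "k = 0")
  case True
  have "((\<lambda>\<theta>::real. 1::real) has_integral pi) {0..pi}"
    using has_integral_const_real[of "1::real" 0 pi] by simp
  then show ?thesis using True by simp
next
  case False
  have "((\<lambda>\<theta>. cos (of_int k * \<theta>)) has_integral (sin (of_int k * pi) / of_int k - sin (of_int k * 0) / of_int k)) {0..pi}"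
    by (rule fundamental_theorem_of_calculus)
       (use False in \<open>auto intro!: derivative_eq_intros simp flip: has_real_derivative_iff_has_vector_derivative\<close>)
  moreover have "sin (of_int k * pi) = 0" by (simp add: sin_zero_iff_int2)
  ultimately show ?thesis using False by simp
qed

lemma has_integral_norm_trig_poly_squared:
  fixes a :: "nat \<Rightarrow> real"
  shows "((\<lambda>\<theta>. (cmod (\<Sum>l<N. of_real (a l) * cis (real l * \<theta>)))\<^sup>2) has_integral (pi * (\<Sum>l<N. (a l)\<^sup>2))) {0..pi}"
proof -
  have eq: "(cmod (\<Sum>l<N. of_real (a l) * cis (real l * \<theta>)))\<^sup>2
      = (\<Sum>l<N. \<Sum>m<N. a l * a m * cos (of_int (int l - int m) * \<theta>))" for \<theta>
    unfolding cmod_power2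
    by (simp add: power2_eq_square sum_product sum.distrib[symmetric] cos_diff algebra_simps)
  have "((\<lambda>\<theta>. \<Sum>l<N. \<Sum>m<N. a l * a m * cos (of_int (int l - int m) * \<theta>)) has_integral
      (\<Sum>l<N. \<Sum>m<N. a l * a m * (if int l - int m = 0 then pi else 0))) {0..pi}"
    by (intro has_integral_sum has_integral_mult_right has_integral_cos_multiple) auto
  also have "(\<Sum>l<N. \<Sum>m<N. a l * a m * (if int l - int m = 0 then pi else 0)) = pi * (\<Sum>l<N. (a l)\<^sup>2)"
    by (simp add: if_distrib sum.delta power2_eq_square sum_distrib_left mult_ac cong: if_cong)
  finally show ?thesis by (simp only: eq)
qed

text \<open>Parseval's identity for absolutely summable coefficients, in the form of an upper bound. The domain
  is half a period: for real coefficients the squared modulus is an even function, so that only cosines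
  occur in its expansion. The point \<open>0\<close> is left out of the comparison because
  the majorant will be singular there.\<close>
lemma trig_series_l2_bound:
  fixes a :: "nat \<Rightarrow> real"
  assumes abs: "summable (\<lambda>l. \<bar>a l\<bar>)"
    and A: "\<And>\<theta>. (\<lambda>l. of_real (a l) * cis (real l * \<theta>)) sums A \<theta>"
    and bound: "\<And>\<theta>. 0 < \<theta> \<Longrightarrow> \<theta> \<le> pi \<Longrightarrow> (cmod (A \<theta>))\<^sup>2 \<le> h \<theta>"
    and h: "(h has_integral B) {0..pi}"
  shows "pi * (\<Sum>l<N. (a l)\<^sup>2) \<le> B"
proof -
  define P where "P M \<theta> = (\<Sum>l<M. of_real (a l) * cis (real l * \<theta>))" for M \<theta>
  have P: "((\<lambda>\<theta>. (cmod (P M \<theta>))\<^sup>2) has_integral (pi * (\<Sum>l<M. (a l)\<^sup>2))) {0..pi}" for M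
    unfolding P_def by (rule has_integral_norm_trig_poly_squared)
  have lim: "(\<lambda>M. P M \<theta>) \<longlonglongrightarrow> A \<theta>" for \<theta>
    using A unfolding sums_def P_def .
  have dom: "(cmod (P M \<theta>))\<^sup>2 \<le> (\<Sum>l. \<bar>a l\<bar>)\<^sup>2" for M \<theta>
  proof -
    have "cmod (P M \<theta>) \<le> (\<Sum>l<M. \<bar>a l\<bar>)"
      unfolding P_def by (rule order_trans[OF norm_sum]) (simp add: norm_mult)
    also have "\<dots> \<le> (\<Sum>l. \<bar>a l\<bar>)" by (rule sum_le_suminf[OF abs]) auto
    finally show ?thesis by (intro power_mono) auto
  qed
  have conv: "(\<lambda>\<theta>. (cmod (A \<theta>))\<^sup>2) integrable_on {0..pi}"
    "(\<lambda>M. integral {0..pi} (\<lambda>\<theta>. (cmod (P M \<theta>))\<^sup>2)) \<longlonglongrightarrow> integral {0..pi} (\<lambda>\<theta>. (cmod (A \<theta>))\<^sup>2)"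
  proof -
    have int: "(\<lambda>\<theta>. (cmod (P M \<theta>))\<^sup>2) integrable_on {0..pi}" for M
      using P unfolding integrable_on_def by blast
    have const: "(\<lambda>_. (\<Sum>l. \<bar>a l\<bar>)\<^sup>2) integrable_on {0..pi}" by (rule integrable_const_ivl)
    have le: "norm ((cmod (P M \<theta>))\<^sup>2) \<le> (\<Sum>l. \<bar>a l\<bar>)\<^sup>2" for M \<theta> using dom by simp
    have lim2: "(\<lambda>M. (cmod (P M \<theta>))\<^sup>2) \<longlonglongrightarrow> (cmod (A \<theta>))\<^sup>2" for \<theta>
      by (intro tendsto_power tendsto_norm lim)
    show "(\<lambda>\<theta>. (cmod (A \<theta>))\<^sup>2) integrable_on {0..pi}"
      by (rule dominated_convergence(1)[OF int const le lim2])
    show "(\<lambda>M. integral {0..pi} (\<lambda>\<theta>. (cmod (P M \<theta>))\<^sup>2)) \<longlonglongrightarrow> integral {0..pi} (\<lambda>\<theta>. (cmod (A \<theta>))\<^sup>2)"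
      by (rule dominated_convergence(2)[OF int const le lim2])
  qed
  have "pi * (\<Sum>l<N. (a l)\<^sup>2) \<le> integral {0..pi} (\<lambda>\<theta>. (cmod (A \<theta>))\<^sup>2)"
  proof (rule tendsto_lowerbound[OF conv(2)])
    show "\<forall>\<^sub>F M in sequentially. pi * (\<Sum>l<N. (a l)\<^sup>2) \<le> integral {0..pi} (\<lambda>\<theta>. (cmod (P M \<theta>))\<^sup>2)"
      using eventually_ge_at_top[of N]
    proof eventually_elim
      case (elim M)
      have "(\<Sum>l<N. (a l)\<^sup>2) \<le> (\<Sum>l<M. (a l)\<^sup>2)" using elim by (intro sum_mono2) auto
      thus ?case using integral_unique[OF P[of M]] by simp
    qed
  qed simp
  also have "\<dots> = integral {0..pi} (\<lambda>\<theta>. if \<theta> = 0 then h 0 else (cmod (A \<theta>))\<^sup>2)"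
    by (rule integral_spike[of "{0}"]) auto
  also have "\<dots> \<le> integral {0..pi} h"
  proof (rule integral_le)
    show "(\<lambda>\<theta>. if \<theta> = 0 then h 0 else (cmod (A \<theta>))\<^sup>2) integrable_on {0..pi}"
      by (rule integrable_spike[OF conv(1), of "{0}"]) auto
    show "h integrable_on {0..pi}" using h by (auto simp: integrable_on_def)
  qed (use bound in auto)
  also have "\<dots> = B" using h by (rule integral_unique)
  finally show ?thesis .
qed

section \<open>The characteristic function of the jumps\<close>

lemma pmf_nat_sums_1: "pmf \<mu> sums (1::real)" for \<mu> :: "nat pmf"
proof -
  have "(\<lambda>i. measure_pmf.prob \<mu> {i}) sums measure_pmf.prob \<mu> (\<Union>i. {i})"
    by (rule measure_pmf.finite_measure_UNION) (auto simp: disjoint_family_on_def)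
  moreover have "(\<Union>i. {i}) = (UNIV :: nat set)" by auto
  ultimately show ?thesis by (simp add: measure_pmf_single)
qed

text \<open>The real part of one minus the characteristic function of \<open>\<mu>\<close>.\<close>
definition char_gap :: "nat pmf \<Rightarrow> real \<Rightarrow> real" where
  "char_gap \<mu> \<theta> = (\<Sum>k. pmf \<mu> k * (1 - cos (real k * \<theta>)))"

lemma char_gap_summable: "summable (\<lambda>k. pmf \<mu> k * (1 - cos (real k * \<theta>)))"
proof (rule summable_comparison_test')
  show "summable (\<lambda>k. pmf \<mu> k * 2)" using pmf_nat_sums_1[of \<mu>] by (intro summable_mult2) (auto simp: sums_iff)
  fix n :: nat
  have "1 - cos (real n * \<theta>) \<le> 2" using cos_ge_minus_one[of "real n * \<theta>"] by simp
  moreover have "0 \<le> 1 - cos (real n * \<theta>)" by simp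
  ultimately show "norm (pmf \<mu> n * (1 - cos (real n * \<theta>))) \<le> pmf \<mu> n * 2"
    by (simp add: abs_mult mult_left_mono)
qed

lemma continuous_on_char_gap: "continuous_on A (char_gap \<mu>)"
proof -
  have "uniform_limit A (\<lambda>n \<theta>. \<Sum>k<n. pmf \<mu> k * (1 - cos (real k * \<theta>))) (char_gap \<mu>) sequentially"
    unfolding char_gap_def
  proof (rule Weierstrass_m_test)
    show "summable (\<lambda>k. pmf \<mu> k * 2)" using pmf_nat_sums_1[of \<mu>] by (intro summable_mult2) (auto simp: sums_iff)
    fix n :: nat and \<theta> :: real
    have "1 - cos (real n * \<theta>) \<le> 2" using cos_ge_minus_one[of "real n * \<theta>"] by simp
    moreover have "0 \<le> 1 - cos (real n * \<theta>)" by simp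
    ultimately show "norm (pmf \<mu> n * (1 - cos (real n * \<theta>))) \<le> pmf \<mu> n * 2"
      by (simp add: abs_mult mult_left_mono)
  qed
  thus ?thesis
    by (rule uniform_limit_theorem[rotated]) (auto intro!: always_eventually continuous_intros)
qed

lemma char_gap_ge_partial:
  assumes "finite F"
  shows "(\<Sum>k\<in>F. pmf \<mu> k * (1 - cos (real k * \<theta>))) \<le> char_gap \<mu> \<theta>"
  unfolding char_gap_def using assms
  by (intro sum_le_suminf[OF char_gap_summable]) auto

text \<open>If the gap vanishes then \<open>\<theta> / (2 * pi)\<close> times every possible jump is an integer. So \<open>\<theta> / (2 * pi)\<close>
  is rational, and its reduced denominator divides all possible jumps, hence is one.\<close>
lemma char_gap_pos:
  assumes gcd: "Gcd {n. n \<ge> 1 \<and> pmf \<mu> n > 0} = 1" and \<theta>: "0 < \<theta>" "\<theta> \<le> pi"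
  shows "0 < char_gap \<mu> \<theta>"
proof (rule ccontr)
  assume "\<not> 0 < char_gap \<mu> \<theta>"
  let ?S = "{n. n \<ge> 1 \<and> pmf \<mu> n > 0}"
  have mult: "\<exists>j::int. real k * \<theta> = of_int j * (2 * pi)" if "k \<in> ?S" for k
  proof -
    have "pmf \<mu> k * (1 - cos (real k * \<theta>)) \<le> 0"
      using char_gap_ge_partial[of "{k}" \<mu> \<theta>] \<open>\<not> 0 < char_gap \<mu> \<theta>\<close> by simp
    hence "1 - cos (real k * \<theta>) \<le> 0" using that by (simp add: mult_le_0_iff)
    hence "cos (real k * \<theta>) = 1" by (intro antisym) auto
    then obtain j :: int where "real k * \<theta> = of_int j * (2 * pi)" unfolding cos_one_2pi_int by (auto simp: mult.assoc)
    thus ?thesis by blast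
  qed
  have "?S \<noteq> {}" using gcd by (metis Gcd_empty zero_neq_one)
  then obtain k0 where k0: "k0 \<in> ?S" by blast
  then obtain j0 where j0: "real k0 * \<theta> = of_int j0 * (2 * pi)" using mult by blast
  have "\<theta> / (2 * pi) = of_int j0 / real k0" using j0 k0 by (simp add: field_simps)
  hence "\<theta> / (2 * pi) \<in> \<rat>" by simp
  then obtain m n where mn: "n \<noteq> 0" "\<bar>\<theta> / (2 * pi)\<bar> = real m / real n" "coprime m n"
    by (rule Rats_abs_nat_div_natE)
  hence th: "\<theta> / (2 * pi) = real m / real n" using \<theta> by simp
  have "n dvd k" if k: "k \<in> ?S" for k
  proof -
    obtain j where j: "real k * \<theta> = of_int j * (2 * pi)" using mult[OF k] by blast
    hence "real k * (real m / real n) = of_int j" unfolding th[symmetric] by simp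
    hence "real k * real m = of_int j * real n" using mn(1) by (simp add: field_simps)
    hence "int k * int m = j * int n" by (metis of_int_eq_iff of_int_mult of_int_of_nat_eq)
    hence "int n dvd int k * int m" by simp
    hence "n dvd k * m" by (metis int_dvd_int_iff of_nat_mult)
    thus ?thesis using mn(3) by (simp add: coprime_commute coprime_dvd_mult_left_iff)
  qed
  hence "n dvd Gcd ?S" by (rule Gcd_greatest)
  hence "n = 1" using gcd by simp
  hence eq: "\<theta> = 2 * pi * real m" using th by (simp add: field_simps)
  show False
  proof (cases "m = 0")
    case True
    with eq \<theta> show False by simp
  next
    case False
    hence "2 * pi * 1 \<le> 2 * pi * real m" by (intro mult_left_mono) auto
    with eq \<theta> pi_gt_zero show False by linarith
  qed
qed

text \<open>The interval is long enough to contain \<open>k * \<theta>\<close> for all \<open>k\<close> between \<open>1 / \<theta>\<close> and about \<open>2 / \<theta>\<close>.\<close>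
lemma one_minus_cos_ge:
  assumes "1 \<le> x" "x \<le> 4"
  shows "1 - cos 1 \<le> 1 - cos (x::real)"
proof (cases "x \<le> pi")
  case True
  then show ?thesis using cos_monotone_0_pi_le[of 1 x] assms by simp
next
  case False
  have "cos x = cos (2 * pi - x)" by (simp add: cos_diff)
  moreover have "cos (2 * pi - x) \<le> cos 1"
    using False assms pi_gt3 by (intro cos_monotone_0_pi_le) auto
  ultimately show ?thesis by simp
qed

text \<open>For small \<open>\<theta>\<close> the jumps \<open>k\<close> with \<open>M \<le> k < 2 * M\<close>, where \<open>M = \<lceil>1 / \<theta>\<rceil>\<close>, have a phase that stays away
  from the multiples of \<open>2 * pi\<close>, and they carry a fixed share of the tail at \<open>M\<close>, as doubling the
  argument divides the tail asymptotically by \<open>2 powr \<alpha>\<close>. Away from \<open>0\<close> the gap is continuous and positive on a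
  compact interval.\<close>
lemma char_gap_ge_tail:
  assumes L: "slowly_varying L" and "0 < \<alpha>"
    and tail: "(\<lambda>n. measure_pmf.prob \<mu> {n..}) \<sim>[at_top] (\<lambda>n. real n powr (-\<alpha>) * L (real n))"
    and gcd: "Gcd {n. n \<ge> 1 \<and> pmf \<mu> n > 0} = 1"
  shows "\<exists>c>0. \<forall>\<theta>. 0 < \<theta> \<longrightarrow> \<theta> \<le> pi \<longrightarrow> c * tail \<mu> (nat \<lceil>1 / \<theta>\<rceil>) \<le> char_gap \<mu> \<theta>"
proof -
  \<comment> \<open>any number strictly between the limiting ratio and one\<close>
  define \<rho> where "\<rho> = (2 powr (-\<alpha>) + 1) / 2"
  have "2 powr (-\<alpha>) < 2 powr 0" using \<open>0 < \<alpha>\<close> by (subst powr_less_cancel_iff) auto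
  hence \<rho>: "2 powr (-\<alpha>) < \<rho>" "\<rho> < 1" by (auto simp: \<rho>_def)
  have "eventually (\<lambda>n. tail \<mu> (2 * n) / tail \<mu> n < \<rho>) sequentially"
    using \<rho>(1) by (rule order_tendstoD[OF tail_doubling_limit[OF L tail]])
  then obtain n1 where n1: "\<And>n. n \<ge> n1 \<Longrightarrow> tail \<mu> (2 * n) / tail \<mu> n < \<rho>"
    by (auto simp: eventually_sequentially)
  define n0 where "n0 = max 1 n1"
  have n0: "tail \<mu> (2 * n) \<le> \<rho> * tail \<mu> n" if "n \<ge> n0" for n
    using n1[of n] that tail_pos[OF L tail, of n] by (simp add: n0_def field_simps)
  have "1 \<le> n0" by (simp add: n0_def)
  have cos1: "1 - cos (1::real) > 0"
    using cos_monotone_0_pi[of 0 "1::real"] pi_gt3 by simp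
  define c1 where "c1 = (1 - cos 1) * (1 - \<rho>)"
  have "c1 > 0" using cos1 \<rho> by (simp add: c1_def)
  have small: "c1 * tail \<mu> (nat \<lceil>1 / \<theta>\<rceil>) \<le> char_gap \<mu> \<theta>" if \<theta>: "0 < \<theta>" "\<theta> \<le> 1 / real n0" for \<theta>
  proof -
    define M where "M = nat \<lceil>1 / \<theta>\<rceil>"
    have Mge: "1 / \<theta> \<le> real M" unfolding M_def by linarith
    have Mle: "real M \<le> 1 / \<theta> + 1" 
    proof -
      have "0 \<le> \<lceil>1 / \<theta>\<rceil>" using \<theta> by (simp add: less_le_trans[of "-1" 0])
      thus ?thesis unfolding M_def using of_int_ceiling_le_add_one[of "1 / \<theta>"] by simp
    qed
    have "real n0 \<le> 1 / \<theta>" using \<theta> \<open>1 \<le> n0\<close> by (simp add: field_simps)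
    hence "n0 \<le> M" using Mge by linarith
    \<comment> \<open>the bound on the angle keeps \<open>2 * M * \<theta>\<close> below four\<close>
    have "1 / real n0 \<le> 1" using \<open>1 \<le> n0\<close> by simp
    hence th1: "\<theta> \<le> 1" using \<theta>(2) by linarith
    have ge: "1 - cos 1 \<le> 1 - cos (real k * \<theta>)" if k: "k \<in> {M..<2 * M}" for k
    proof (rule one_minus_cos_ge)
      have "1 \<le> real M * \<theta>" using Mge \<theta> by (simp add: field_simps)
      also have "\<dots> \<le> real k * \<theta>" using k \<theta> by (intro mult_right_mono) auto
      finally show "1 \<le> real k * \<theta>" .
      have "real k * \<theta> \<le> (2 * real M) * \<theta>" using k \<theta> by (intro mult_right_mono) auto
      also have "\<dots> \<le> 2 * (1 / \<theta> + 1) * \<theta>" using Mle \<theta> by (intro mult_right_mono) auto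
      also have "\<dots> \<le> 4" using th1 \<theta> by (simp add: field_simps)
      finally show "real k * \<theta> \<le> 4" .
    qed
    have split: "tail \<mu> M - tail \<mu> (M + j) = (\<Sum>k\<in>{M..<M + j}. pmf \<mu> k)" for j
      by (induction j) (simp_all add: tail_step[of \<mu> "M + _"])
    have "c1 * tail \<mu> M \<le> (1 - cos 1) * (tail \<mu> M - tail \<mu> (M + M))"
      using n0[OF \<open>n0 \<le> M\<close>] cos1 unfolding c1_def mult.assoc
      by (intro mult_left_mono) (auto simp: algebra_simps mult_2 mult_2_right)
    also have "\<dots> = (\<Sum>k\<in>{M..<2 * M}. pmf \<mu> k * (1 - cos 1))"
      unfolding split mult_2 by (simp add: sum_distrib_left mult.commute)
    also have "\<dots> \<le> (\<Sum>k\<in>{M..<2 * M}. pmf \<mu> k * (1 - cos (real k * \<theta>)))"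
      using ge by (intro sum_mono mult_left_mono) auto
    also have "\<dots> \<le> char_gap \<mu> \<theta>" by (rule char_gap_ge_partial) simp
    finally show ?thesis by (simp add: M_def)
  qed
  have "\<exists>x\<in>{1 / real n0..pi}. \<forall>y\<in>{1 / real n0..pi}. char_gap \<mu> x \<le> char_gap \<mu> y"
  proof (rule continuous_attains_inf)
    have "1 / real n0 \<le> 1" using \<open>1 \<le> n0\<close> by simp
    thus "{1 / real n0..pi} \<noteq> {}" using pi_gt3 by simp
  qed (auto intro: continuous_on_char_gap)
  then obtain x where x: "1 / real n0 \<le> x" "x \<le> pi"
    "\<And>y. 1 / real n0 \<le> y \<Longrightarrow> y \<le> pi \<Longrightarrow> char_gap \<mu> x \<le> char_gap \<mu> y" by auto
  define c2 where "c2 = char_gap \<mu> x"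
  have "0 < 1 / real n0" using \<open>1 \<le> n0\<close> by simp
  hence "0 < x" using x(1) by linarith
  hence "c2 > 0" unfolding c2_def using char_gap_pos[OF gcd] x by simp
  have "min c1 c2 * tail \<mu> (nat \<lceil>1 / \<theta>\<rceil>) \<le> char_gap \<mu> \<theta>" if "0 < \<theta>" "\<theta> \<le> pi" for \<theta>
  proof (cases "\<theta> \<le> 1 / real n0")
    case True
    have "min c1 c2 * tail \<mu> (nat \<lceil>1 / \<theta>\<rceil>) \<le> c1 * tail \<mu> (nat \<lceil>1 / \<theta>\<rceil>)"
      by (intro mult_right_mono) (auto simp: tail_def)
    also have "\<dots> \<le> char_gap \<mu> \<theta>" using small that True by simp
    finally show ?thesis .
  next
    case False
    have "min c1 c2 * tail \<mu> (nat \<lceil>1 / \<theta>\<rceil>) \<le> c2 * 1"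
      using \<open>c2 > 0\<close> \<open>c1 > 0\<close> by (intro mult_mono tail_le_1) (auto simp: tail_def)
    also have "\<dots> \<le> char_gap \<mu> \<theta>" using x(3)[of \<theta>] that False by (simp add: c2_def)
    finally show ?thesis .
  qed
  moreover have "min c1 c2 > 0" using \<open>c1 > 0\<close> \<open>c2 > 0\<close> by simp
  ultimately show ?thesis by blast
qed

section \<open>Square sums of smoothed renewal sequences\<close>

text \<open>The convolution of the renewal sequence with the indicator of \<open>{..<n}\<close>. Its squares sum to the
  variance of the partial sum of length \<open>n\<close>, up to a constant, and its generating function
  factorises.\<close>
definition window :: "nat pmf \<Rightarrow> nat \<Rightarrow> nat \<Rightarrow> real" where
  "window \<mu> n l = (\<Sum>i\<le>l. if i < n then renewal_seq \<mu> (l - i) else 0)"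

lemma window_nonneg: "0 \<le> window \<mu> n l"
  unfolding window_def by (intro sum_nonneg) (auto simp: renewal_seq_nonneg)

lemma window_le:
  assumes supp: "set_pmf \<mu> \<subseteq> {1..}"
  shows "window \<mu> n l \<le> real n"
proof -
  have "window \<mu> n l \<le> (\<Sum>i\<le>l. if i < n then 1 else 0)"
    unfolding window_def by (intro sum_mono) (auto simp: renewal_seq_le_1[OF supp])
  also have "\<dots> = real (card ({..l} \<inter> {i. i < n}))" by (simp add: sum.If_cases)
  also have "card ({..l} \<inter> {i. i < n}) \<le> card {..<n}" by (intro card_mono) auto
  finally show ?thesis by simp
qed

text \<open>The renewal recursion as an identity of power series: the Cauchy product of the two series differs
  from the second one only in the constant term.\<close>
lemma renewal_generating_function:
  fixes z :: complex
  assumes supp: "set_pmf \<mu> \<subseteq> {1..}" and z: "norm z < 1"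
  shows "(\<Sum>k. of_real (renewal_seq \<mu> k) * z ^ k) * (1 - (\<Sum>k. of_real (pmf \<mu> k) * z ^ k)) = 1"
    and "summable (\<lambda>k. norm (of_real (renewal_seq \<mu> k) * z ^ k))"
    and "summable (\<lambda>k. norm (of_real (pmf \<mu> k) * z ^ k))"
proof -
  have geo: "summable (\<lambda>k. norm z ^ k)" using z by (simp add: summable_geometric)
  show sq: "summable (\<lambda>k. norm (of_real (renewal_seq \<mu> k) * z ^ k))"
    by (rule summable_comparison_test'[OF geo])
       (auto simp: norm_mult norm_power renewal_seq_nonneg renewal_seq_le_1[OF supp] intro!: mult_left_le_one_le)
  show sp: "summable (\<lambda>k. norm (of_real (pmf \<mu> k) * z ^ k))"
    by (rule summable_comparison_test'[OF geo])
       (auto simp: norm_mult norm_power pmf_le_1 intro!: mult_left_le_one_le)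
  have p0: "pmf \<mu> 0 = 0" using supp by (auto simp: set_pmf_iff)
  have conv: "(\<Sum>i\<le>k. of_real (pmf \<mu> i) * z ^ i * (of_real (renewal_seq \<mu> (k - i)) * z ^ (k - i)))
      = of_real (renewal_seq \<mu> k) * z ^ k - (if k = 0 then 1 else 0)" for k
  proof (cases "k = 0")
    case False
    have "(\<Sum>i\<le>k. of_real (pmf \<mu> i) * z ^ i * (of_real (renewal_seq \<mu> (k - i)) * z ^ (k - i)))
        = (\<Sum>i\<le>k. of_real (pmf \<mu> i * renewal_seq \<mu> (k - i)) * z ^ k)"
    proof (intro sum.cong refl)
      fix i assume "i \<in> {..k}"
      hence "z ^ k = z ^ i * z ^ (k - i)" by (simp add: power_add[symmetric])
      thus "of_real (pmf \<mu> i) * z ^ i * (of_real (renewal_seq \<mu> (k - i)) * z ^ (k - i))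
        = of_real (pmf \<mu> i * renewal_seq \<mu> (k - i)) * z ^ k" by simp
    qed
    also have "\<dots> = of_real (\<Sum>i\<le>k. pmf \<mu> i * renewal_seq \<mu> (k - i)) * z ^ k"
      by (simp add: sum_distrib_right)
    also have "(\<Sum>i\<le>k. pmf \<mu> i * renewal_seq \<mu> (k - i)) = renewal_seq \<mu> k"
    proof -
      have "{..k} = insert 0 {1..k}" by auto
      thus ?thesis using False by (simp add: renewal_seq_rec p0)
    qed
    finally show ?thesis using False by simp
  qed (simp add: p0)
  have "(\<lambda>k. of_real (renewal_seq \<mu> k) * z ^ k - (if k = 0 then 1 else 0)) sums
      ((\<Sum>k. of_real (pmf \<mu> k) * z ^ k) * (\<Sum>k. of_real (renewal_seq \<mu> k) * z ^ k))"
    using Cauchy_product_sums[OF sp sq] unfolding conv .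
  moreover have "(\<lambda>k. of_real (renewal_seq \<mu> k) * z ^ k - (if k = 0 then 1 else 0)) sums
      ((\<Sum>k. of_real (renewal_seq \<mu> k) * z ^ k) - 1)"
    by (intro sums_diff summable_sums summable_norm_cancel[OF sq] sums_single)
  ultimately have "(\<Sum>k. of_real (pmf \<mu> k) * z ^ k) * (\<Sum>k. of_real (renewal_seq \<mu> k) * z ^ k)
      = (\<Sum>k. of_real (renewal_seq \<mu> k) * z ^ k) - 1" by (rule sums_unique2)
  thus "(\<Sum>k. of_real (renewal_seq \<mu> k) * z ^ k) * (1 - (\<Sum>k. of_real (pmf \<mu> k) * z ^ k)) = 1"
    by (simp add: algebra_simps)
qed

lemma window_generating_function:
  fixes z :: complex
  assumes supp: "set_pmf \<mu> \<subseteq> {1..}" and z: "norm z < 1"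
  shows "(\<lambda>l. of_real (window \<mu> n l) * z ^ l) sums
     ((\<Sum>i<n. z ^ i) * (\<Sum>k. of_real (renewal_seq \<mu> k) * z ^ k))"
proof -
  have fin: "summable (\<lambda>i. norm (if i < n then z ^ i else 0))"
    by (rule summable_finite[of "{..<n}"]) auto
  have sum1: "(\<Sum>i. if i < n then z ^ i else 0) = (\<Sum>i<n. z ^ i)"
    by (subst suminf_finite[of "{..<n}"]) auto
  have conv: "(\<Sum>i\<le>l. (if i < n then z ^ i else 0) * (of_real (renewal_seq \<mu> (l - i)) * z ^ (l - i)))
      = of_real (window \<mu> n l) * z ^ l" for l
    unfolding window_def of_real_sum sum_distrib_right
  proof (intro sum.cong refl)
    fix i assume "i \<in> {..l}"
    hence "z ^ l = z ^ i * z ^ (l - i)" by (simp add: power_add[symmetric])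
    thus "(if i < n then z ^ i else 0) * (of_real (renewal_seq \<mu> (l - i)) * z ^ (l - i)) =
         of_real (if i < n then renewal_seq \<mu> (l - i) else 0) * z ^ l" by simp
  qed
  show ?thesis
    using Cauchy_product_sums[OF fin renewal_generating_function(2)[OF supp z]] unfolding conv sum1 .
qed

text \<open>Passing to the interior of the unit disc loses at most a factor two: where the cosine is
  nonnegative the discounting increases the summand, and where it is negative both summands lie
  between one and two.\<close>
lemma norm_one_minus_char_ge:
  assumes supp: "set_pmf \<mu> \<subseteq> {1..}" and s: "0 < s" "s < 1"
  shows "char_gap \<mu> \<theta> / 2 \<le> cmod (1 - (\<Sum>k. of_real (pmf \<mu> k) * (of_real s * cis \<theta>) ^ k))"
proof -
  let ?z = "of_real s * cis \<theta>"
  have z: "norm ?z < 1" using s by (simp add: norm_mult)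
  have "(\<lambda>k. of_real (pmf \<mu> k) * ?z ^ k) sums (\<Sum>k. of_real (pmf \<mu> k) * ?z ^ k)"
    by (intro summable_sums summable_norm_cancel[OF renewal_generating_function(3)[OF supp z]])
  hence "(\<lambda>k. Re (of_real (pmf \<mu> k) * ?z ^ k)) sums Re (\<Sum>k. of_real (pmf \<mu> k) * ?z ^ k)"
    by (rule bounded_linear.sums[OF bounded_linear_Re])
  hence "(\<lambda>k. pmf \<mu> k - Re (of_real (pmf \<mu> k) * ?z ^ k)) sums (1 - Re (\<Sum>k. of_real (pmf \<mu> k) * ?z ^ k))"
    by (rule sums_diff[OF pmf_nat_sums_1])
  note sums_Re = this
  have sums_gap: "(\<lambda>k. pmf \<mu> k * (1 - cos (real k * \<theta>)) / 2) sums (char_gap \<mu> \<theta> / 2)"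
    unfolding char_gap_def by (intro sums_divide summable_sums char_gap_summable)
  have termwise: "pmf \<mu> k * (1 - cos (real k * \<theta>)) / 2 \<le> pmf \<mu> k - Re (of_real (pmf \<mu> k) * ?z ^ k)" for k
  proof -
    let ?c = "cos (real k * \<theta>)"
    have Re: "Re (of_real (pmf \<mu> k) * ?z ^ k) = pmf \<mu> k * (s ^ k * ?c)"
    proof -
      have "?z ^ k = of_real (s ^ k) * cis (real k * \<theta>)"
        by (simp only: power_mult_distrib of_real_power Complex.DeMoivre)
      thus ?thesis by (simp only: Re_complex_of_real Im_complex_of_real times_complex.sel cis.sel) simp
    qed
    have sk: "0 \<le> s ^ k" "s ^ k \<le> 1" using s by (auto simp: power_le_one)
    have "(1 - ?c) / 2 \<le> 1 - s ^ k * ?c"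
    proof (cases "?c \<ge> 0")
      case True
      hence "s ^ k * ?c \<le> ?c" using sk by (simp add: mult_left_le_one_le)
      moreover have "?c \<le> 1" by simp
      ultimately show ?thesis by argo
    next
      case False
      hence "s ^ k * ?c \<le> 0" using sk by (simp add: mult_le_0_iff)
      moreover have "-1 \<le> ?c" by simp
      ultimately show ?thesis by argo
    qed
    hence "pmf \<mu> k * ((1 - ?c) / 2) \<le> pmf \<mu> k * (1 - s ^ k * ?c)" by (intro mult_left_mono) auto
    thus ?thesis unfolding Re by (simp add: algebra_simps)
  qed
  have "char_gap \<mu> \<theta> / 2 \<le> 1 - Re (\<Sum>k. of_real (pmf \<mu> k) * ?z ^ k)"
    by (rule sums_le[OF termwise sums_gap sums_Re])
  also have "\<dots> = Re (1 - (\<Sum>k. of_real (pmf \<mu> k) * ?z ^ k))" by simp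
  also have "\<dots> \<le> cmod (1 - (\<Sum>k. of_real (pmf \<mu> k) * ?z ^ k))" by (rule complex_Re_le_cmod)
  finally show ?thesis .
qed

text \<open>Jordan's inequality: the graph of the sine lies above its chord.\<close>
lemma sin_ge_two_over_pi:
  assumes "0 \<le> x" "x \<le> pi / 2"
  shows "2 / pi * x \<le> sin x"
proof -
  have "concave_on {0..pi} sin"
    by (rule f''_le0_imp_concave[where f' = cos and f'' = "\<lambda>x. - sin x"])
       (auto intro!: derivative_eq_intros simp: sin_ge_zero)
  hence "sin ((1 - 2 / pi * x) *\<^sub>R 0 + (2 / pi * x) *\<^sub>R (pi / 2)) \<ge> (1 - 2 / pi * x) * sin 0 + (2 / pi * x) * sin (pi / 2)"
    by (rule concave_onD) (use assms in \<open>auto simp: field_simps\<close>)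
  thus ?thesis by simp
qed

text \<open>The bounds are uniform in the radius \<open>s\<close>: the distance of \<open>s * cis \<theta>\<close> from \<open>1\<close> is at least half
  of the distance of \<open>cis \<theta>\<close> from \<open>1\<close>, because \<open>1 - s\<close> is at most the former.\<close>
lemma norm_geometric_sum_le:
  assumes s: "0 < s" "s < 1" and \<theta>: "0 < \<theta>" "\<theta> \<le> pi"
  shows "cmod (\<Sum>i<n. (of_real s * cis \<theta>) ^ i) \<le> 2 * pi / \<theta>"
    and "cmod (\<Sum>i<n. (of_real s * cis \<theta>) ^ i) \<le> real n"
proof -
  let ?z = "of_real s * cis \<theta>"
  have z: "norm ?z = s" using s by (simp add: norm_mult)
  have zi: "norm (?z ^ i) \<le> 1" for i unfolding norm_power z using s by (intro power_le_one) auto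
  show "cmod (\<Sum>i<n. ?z ^ i) \<le> real n"
    using sum_norm_le[of "{..<n}" "\<lambda>i. ?z ^ i" "\<lambda>_. 1"] zi by simp
  have "2 * \<theta> / pi \<le> cmod (1 - cis \<theta>)"
  proof -
    have "(cmod (1 - cis \<theta>))\<^sup>2 = 2 - 2 * cos \<theta>"
    proof -
      have "(cmod (1 - cis \<theta>))\<^sup>2 = 1 - 2 * cos \<theta> + ((sin \<theta>)\<^sup>2 + (cos \<theta>)\<^sup>2)"
        unfolding cmod_power2 by (simp add: power2_diff del: sin_cos_squared_add sin_cos_squared_add2)
      thus ?thesis by simp
    qed
    also have "\<dots> = (2 * sin (\<theta> / 2))\<^sup>2"
      using cos_double_sin[of "\<theta> / 2"] by (simp add: power_mult_distrib)
    finally have "cmod (1 - cis \<theta>) = 2 * sin (\<theta> / 2)"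
      by (rule power2_eq_imp_eq) (use \<theta> sin_ge_zero[of "\<theta> / 2"] in simp_all)
    thus ?thesis using sin_ge_two_over_pi[of "\<theta> / 2"] \<theta> by (simp add: field_simps)
  qed
  also have "cmod (1 - cis \<theta>) \<le> 2 * cmod (1 - ?z)"
  proof -
    have "cmod (1 - cis \<theta>) = cmod ((1 - ?z) + (?z - cis \<theta>))" by simp
    also have "\<dots> \<le> cmod (1 - ?z) + cmod (?z - cis \<theta>)" by (rule norm_triangle_ineq)
    also have "?z - cis \<theta> = of_real (s - 1) * cis \<theta>" by (simp add: algebra_simps)
    also have "cmod \<dots> = 1 - s" using s unfolding norm_mult norm_of_real by simp
    also have "1 - s \<le> cmod (1 - ?z)"
      using norm_triangle_ineq2[of 1 ?z] z by simp
    finally show ?thesis by simp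
  qed
  finally have ge: "\<theta> / pi \<le> cmod (1 - ?z)" by simp
  have "cmod (\<Sum>i<n. ?z ^ i) * cmod (1 - ?z) = cmod (1 - ?z ^ n)"
    unfolding norm_mult[symmetric] using one_diff_power_eq[of ?z n] by (simp add: mult.commute)
  also have "\<dots> \<le> 2" using norm_triangle_ineq4[of 1 "?z ^ n"] zi[of n] by simp
  finally have "cmod (\<Sum>i<n. ?z ^ i) * cmod (1 - ?z) \<le> 2" .
  moreover have "cmod (\<Sum>i<n. ?z ^ i) * (\<theta> / pi) \<le> cmod (\<Sum>i<n. ?z ^ i) * cmod (1 - ?z)"
    using ge by (intro mult_left_mono) auto
  ultimately have "cmod (\<Sum>i<n. ?z ^ i) * (\<theta> / pi) \<le> 2" by linarith
  thus "cmod (\<Sum>i<n. ?z ^ i) \<le> 2 * pi / \<theta>" using \<theta> by (simp add: field_simps)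
qed

text \<open>The majorant of the squared transform of the window, up to constants: on the scale \<open>1 / n\<close> it has
  the integrable singularity of order \<open>2 * \<beta> < 1\<close>, beyond that scale the decay of the geometric sum.\<close>
lemma has_integral_kernel:
  fixes \<beta> :: real
  assumes "0 < \<beta>" "\<beta> < 1 / 2" "1 \<le> n"
  shows "\<exists>B \<le> real n / (1 - 2 * \<beta>) + real n.
    ((\<lambda>\<theta>. if \<theta> \<le> 1 / real n then (real n)\<^sup>2 * (real n * \<theta>) powr (- 2 * \<beta>) else 1 / \<theta>\<^sup>2)
      has_integral B) {0..pi}"
proof -
  let ?h = "\<lambda>\<theta>. if \<theta> \<le> 1 / real n then (real n)\<^sup>2 * (real n * \<theta>) powr (- 2 * \<beta>) else 1 / \<theta>\<^sup>2"
  have "1 / real n \<le> 1" using assms by simp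
  hence n: "0 < real n" "1 / real n \<le> pi" using assms pi_gt3 by (simp, linarith)
  have 1: "((\<lambda>\<theta>. (real n)\<^sup>2 * real n powr (- 2 * \<beta>) * \<theta> powr (- 2 * \<beta>)) has_integral
      (real n)\<^sup>2 * real n powr (- 2 * \<beta>) * ((1 / real n) powr (- 2 * \<beta> + 1) / (- 2 * \<beta> + 1))) {0..1 / real n}"
    using assms by (intro has_integral_mult_right has_integral_powr_from_0) auto
  have "(?h has_integral (real n)\<^sup>2 * real n powr (- 2 * \<beta>) * ((1 / real n) powr (- 2 * \<beta> + 1) / (- 2 * \<beta> + 1))) {0..1 / real n}"
    by (rule has_integral_eq[OF _ 1]) (use n in \<open>auto simp: powr_mult\<close>)
  moreover have "(real n)\<^sup>2 * real n powr (- 2 * \<beta>) * ((1 / real n) powr (- 2 * \<beta> + 1) / (- 2 * \<beta> + 1)) = real n / (1 - 2 * \<beta>)"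
  proof -
    have "(1 / real n) powr (- 2 * \<beta> + 1) = real n powr (2 * \<beta> - 1)"
      using n by (simp add: powr_divide powr_minus_divide[symmetric])
    moreover have "(real n)\<^sup>2 = real n powr 2" using n by simp
    ultimately have "(real n)\<^sup>2 * real n powr (- 2 * \<beta>) * (1 / real n) powr (- 2 * \<beta> + 1)
        = real n powr (2 + (- 2 * \<beta>) + (2 * \<beta> - 1))" by (simp only: powr_add)
    also have "\<dots> = real n" using n by simp
    finally show ?thesis by (simp add: field_simps)
  qed
  ultimately have i1: "(?h has_integral (real n / (1 - 2 * \<beta>))) {0..1 / real n}" by (simp only:)
  have 2: "((\<lambda>\<theta>. 1 / \<theta>\<^sup>2) has_integral (- (1 / pi) - (- (1 / (1 / real n))))) {1 / real n..pi}"
  proof (rule fundamental_theorem_of_calculus)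
    fix x assume x: "x \<in> {1 / real n..pi}"
    have "0 < 1 / real n" using n by simp
    hence "x \<noteq> 0" using x by auto
    thus "((\<lambda>\<theta>. - (1 / \<theta>)) has_vector_derivative 1 / x\<^sup>2) (at x within {1 / real n..pi})"
      by (auto intro!: derivative_eq_intros simp: power2_eq_square simp flip: has_real_derivative_iff_has_vector_derivative)
  qed (use n in auto)
  have i2: "(?h has_integral (real n - 1 / pi)) {1 / real n..pi}"
    
  proof (rule has_integral_spike_finite)
    show "finite {1 / real n}" by simp
    show "((\<lambda>\<theta>. 1 / \<theta>\<^sup>2) has_integral (real n - 1 / pi)) {1 / real n..pi}" using 2 by simp
  qed auto
  have "(?h has_integral (real n / (1 - 2 * \<beta>) + (real n - 1 / pi))) {0..pi}"
    by (rule has_integral_combine[OF _ _ i1 i2]) (use n in auto)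
  moreover have "real n / (1 - 2 * \<beta>) + (real n - 1 / pi) \<le> real n / (1 - 2 * \<beta>) + real n" by simp
  ultimately show ?thesis by blast
qed

context potter_tail
begin

text \<open>With \<open>N = \<lceil>1 / \<theta>\<rceil>\<close> we have \<open>n \<le> N \<le> 2 / \<theta>\<close>, and the Potter bound compares the tails at \<open>n\<close> and
  at \<open>N\<close>.\<close>
lemma inverse_tail_near_zero:
  assumes n: "1 \<le> n" and \<theta>: "0 < \<theta>" "\<theta> \<le> 1 / real n"
  shows "1 / tail \<mu> (nat \<lceil>1 / \<theta>\<rceil>) \<le> K * 2 powr \<beta> * (real n * \<theta>) powr (- \<beta>) / tail \<mu> n"
proof -
  define N where "N = nat \<lceil>1 / \<theta>\<rceil>"
  have "1 / real n \<le> 1" using n by simp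
  hence th1: "\<theta> \<le> 1" using \<theta>(2) by linarith
  have Nge: "1 / \<theta> \<le> real N" unfolding N_def by linarith
  have Nle: "real N \<le> 1 / \<theta> + 1"
  proof -
    have "0 \<le> \<lceil>1 / \<theta>\<rceil>" using \<theta> by (simp add: less_le_trans[of "-1" 0])
    thus ?thesis unfolding N_def using of_int_ceiling_le_add_one[of "1 / \<theta>"] by simp
  qed
  have "real n \<le> 1 / \<theta>" using \<theta> n by (simp add: field_simps)
  hence nN: "n \<le> N" using Nge by linarith
  have "real N \<le> 2 / \<theta>"
  proof -
    have "1 \<le> 1 / \<theta>" using th1 \<theta> by (simp add: field_simps)
    thus ?thesis using Nle by simp
  qed
  hence "real N / real n \<le> 2 / (real n * \<theta>)" using n \<theta> by (simp add: field_simps)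
  hence "(real N / real n) powr \<beta> \<le> (2 / (real n * \<theta>)) powr \<beta>" using beta(1) by (intro powr_mono2) auto
  also have "\<dots> = 2 powr \<beta> * (real n * \<theta>) powr (- \<beta>)"
    using n \<theta> by (simp add: powr_divide powr_minus_divide)
  finally have le: "(real N / real n) powr \<beta> \<le> 2 powr \<beta> * (real n * \<theta>) powr (- \<beta>)" .
  have "tail \<mu> n \<le> K * (real N / real n) powr \<beta> * tail \<mu> N" by (rule pot[OF n nN])
  also have "\<dots> \<le> K * (2 powr \<beta> * (real n * \<theta>) powr (- \<beta>)) * tail \<mu> N"
    using le K pos[of N] by (intro mult_right_mono mult_left_mono) auto
  finally have "tail \<mu> n \<le> (K * 2 powr \<beta> * (real n * \<theta>) powr (- \<beta>)) * tail \<mu> N"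
    by (simp only: mult.assoc)
  hence "1 / tail \<mu> N \<le> (K * 2 powr \<beta> * (real n * \<theta>) powr (- \<beta>)) / tail \<mu> n"
    using pos[of N] pos[of n] by (simp add: divide_le_eq le_divide_eq mult.commute)
  thus ?thesis unfolding N_def .
qed

text \<open>The transform is the geometric sum divided by one minus the discounted characteristic function. For
  \<open>\<theta> \<le> 1 / n\<close> the geometric sum is bounded by \<open>n\<close> and the tail at \<open>\<lceil>1 / \<theta>\<rceil>\<close> by the Potter bound; for
  larger \<open>\<theta>\<close> the geometric sum is of order \<open>1 / \<theta>\<close> and the tail is at least the one at \<open>n\<close>.\<close>
lemma window_transform_bound:
  assumes "0 < c"
    and gap: "\<And>\<theta>. 0 < \<theta> \<Longrightarrow> \<theta> \<le> pi \<Longrightarrow> c * tail \<mu> (nat \<lceil>1 / \<theta>\<rceil>) \<le> char_gap \<mu> \<theta>"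
    and n: "1 \<le> n" and s: "0 < s" "s < 1" and \<theta>: "0 < \<theta>" "\<theta> \<le> pi"
  shows "(cmod ((\<Sum>i<n. (of_real s * cis \<theta>) ^ i) * (\<Sum>k. of_real (renewal_seq \<mu> k) * (of_real s * cis \<theta>) ^ k)))\<^sup>2
    \<le> (2 / (c * tail \<mu> n))\<^sup>2 * ((K * 2 powr \<beta>)\<^sup>2 + (2 * pi)\<^sup>2) *
       (if \<theta> \<le> 1 / real n then (real n)\<^sup>2 * (real n * \<theta>) powr (- 2 * \<beta>) else 1 / \<theta>\<^sup>2)"
proof -
  let ?z = "of_real s * cis \<theta>" and ?N = "nat \<lceil>1 / \<theta>\<rceil>"
  let ?D = "\<Sum>i<n. ?z ^ i" and ?Q = "\<Sum>k. of_real (renewal_seq \<mu> k) * ?z ^ k"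
  have z: "norm ?z < 1" using s by (simp add: norm_mult)
  have Q: "cmod ?Q \<le> 2 / c * (1 / tail \<mu> ?N)"
  proof -
    have "cmod ?Q * cmod (1 - (\<Sum>k. of_real (pmf \<mu> k) * ?z ^ k)) = 1"
      unfolding norm_mult[symmetric] renewal_generating_function(1)[OF supp z] by simp
    moreover have "c * tail \<mu> ?N / 2 \<le> cmod (1 - (\<Sum>k. of_real (pmf \<mu> k) * ?z ^ k))"
      using norm_one_minus_char_ge[OF supp s, of \<theta>] gap[OF \<theta>] by linarith
    hence "cmod ?Q * (c * tail \<mu> ?N / 2) \<le> cmod ?Q * cmod (1 - (\<Sum>k. of_real (pmf \<mu> k) * ?z ^ k))"
      by (rule mult_left_mono) simp
    ultimately have le: "cmod ?Q * (c * tail \<mu> ?N / 2) \<le> 1" by (simp only:)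
    have "0 < c * tail \<mu> ?N / 2" using \<open>0 < c\<close> pos[of ?N] by simp
    with le have "cmod ?Q \<le> 1 / (c * tail \<mu> ?N / 2)" by (simp only: pos_le_divide_eq)
    also have "\<dots> = 2 / c * (1 / tail \<mu> ?N)" by simp
    finally show ?thesis .
  qed
  show ?thesis
  proof (cases "\<theta> \<le> 1 / real n")
    case True
    have "cmod (?D * ?Q) \<le> real n * (2 / c * (K * 2 powr \<beta> * (real n * \<theta>) powr (- \<beta>) / tail \<mu> n))"
      unfolding norm_mult
    proof (intro mult_mono norm_geometric_sum_le(2)[OF s \<theta>])
      have "2 / c * (1 / tail \<mu> ?N) \<le> 2 / c * (K * 2 powr \<beta> * (real n * \<theta>) powr (- \<beta>) / tail \<mu> n)"
        by (intro mult_left_mono inverse_tail_near_zero[OF n \<theta>(1) True])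
           (use \<open>0 < c\<close> in auto)
      with Q show "cmod ?Q \<le> 2 / c * (K * 2 powr \<beta> * (real n * \<theta>) powr (- \<beta>) / tail \<mu> n)"
        by (rule order_trans)
    qed auto
    also have "\<dots> = 2 / (c * tail \<mu> n) * (K * 2 powr \<beta>) * (real n * (real n * \<theta>) powr (- \<beta>))"
      by simp
    finally have "(cmod (?D * ?Q))\<^sup>2 \<le> (2 / (c * tail \<mu> n) * (K * 2 powr \<beta>) * (real n * (real n * \<theta>) powr (- \<beta>)))\<^sup>2"
      by (intro power_mono) auto
    also have "\<dots> = (2 / (c * tail \<mu> n))\<^sup>2 * (K * 2 powr \<beta>)\<^sup>2 * ((real n)\<^sup>2 * (real n * \<theta>) powr (- 2 * \<beta>))"
    proof -
      have "((real n * \<theta>) powr (- \<beta>))\<^sup>2 = (real n * \<theta>) powr (- 2 * \<beta>)"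
        unfolding power2_eq_square by (simp add: powr_add[symmetric])
      thus ?thesis by (simp only: power_mult_distrib)
    qed
    also have "\<dots> \<le> (2 / (c * tail \<mu> n))\<^sup>2 * ((K * 2 powr \<beta>)\<^sup>2 + (2 * pi)\<^sup>2) * ((real n)\<^sup>2 * (real n * \<theta>) powr (- 2 * \<beta>))"
      by (intro mult_right_mono mult_left_mono) auto
    finally show ?thesis using True by simp
  next
    case False
    have "?N \<le> n"
    proof -
      have "1 / \<theta> \<le> real n" using False n \<theta> by (simp add: field_simps)
      thus ?thesis by linarith
    qed
    hence "tail \<mu> n \<le> tail \<mu> ?N" using tail_antimono[of \<mu>] by (simp add: decseq_def)
    hence "1 / tail \<mu> ?N \<le> 1 / tail \<mu> n" using pos by (intro divide_left_mono) (auto intro: mult_pos_pos)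
    hence "2 / c * (1 / tail \<mu> ?N) \<le> 2 / c * (1 / tail \<mu> n)"
      using \<open>0 < c\<close> by (intro mult_left_mono) auto
    with Q have Q': "cmod ?Q \<le> 2 / c * (1 / tail \<mu> n)" by (rule order_trans)
    have "cmod (?D * ?Q) \<le> (2 * pi / \<theta>) * (2 / c * (1 / tail \<mu> n))"
      unfolding norm_mult by (intro mult_mono norm_geometric_sum_le(1)[OF s \<theta>] Q') (use \<theta> in auto)
    also have "\<dots> = 2 / (c * tail \<mu> n) * (2 * pi) * (1 / \<theta>)" by simp
    finally have "(cmod (?D * ?Q))\<^sup>2 \<le> (2 / (c * tail \<mu> n) * (2 * pi) * (1 / \<theta>))\<^sup>2"
      by (intro power_mono) auto
    also have "\<dots> = (2 / (c * tail \<mu> n))\<^sup>2 * (2 * pi)\<^sup>2 * (1 / \<theta>\<^sup>2)"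
      by (simp only: power_mult_distrib power_one_over)
    also have "\<dots> \<le> (2 / (c * tail \<mu> n))\<^sup>2 * ((K * 2 powr \<beta>)\<^sup>2 + (2 * pi)\<^sup>2) * (1 / \<theta>\<^sup>2)"
      by (intro mult_right_mono mult_left_mono) auto
    finally show ?thesis using False by simp
  qed
qed

text \<open>A priori the window is only bounded, so Parseval applies to its discounted version; the bounds do
  not depend on the discount, which then tends to one.\<close>
lemma window_l2_bound:
  assumes "0 < c"
    and gap: "\<And>\<theta>. 0 < \<theta> \<Longrightarrow> \<theta> \<le> pi \<Longrightarrow> c * tail \<mu> (nat \<lceil>1 / \<theta>\<rceil>) \<le> char_gap \<mu> \<theta>"
  shows "\<exists>B>0. \<forall>n\<ge>1. \<forall>N. (\<Sum>l<N. (window \<mu> n l)\<^sup>2) \<le> B * (real n / (tail \<mu> n)\<^sup>2)"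
proof -
  define E where "E = (K * 2 powr \<beta>)\<^sup>2 + (2 * pi)\<^sup>2"
  define B where "B = (4 / c\<^sup>2) * E * (1 / (1 - 2 * \<beta>) + 1)"
  have "E > 0" unfolding E_def by (intro add_nonneg_pos) auto
  have "B > 0" unfolding B_def using \<open>E > 0\<close> \<open>0 < c\<close> beta by (intro mult_pos_pos) (auto intro!: add_pos_pos)
  have "(\<Sum>l<N. (window \<mu> n l)\<^sup>2) \<le> B * (real n / (tail \<mu> n)\<^sup>2)" if n: "1 \<le> n" for n N
  proof -
    \<comment> \<open>multiplying the window by \<open>s ^ l\<close> moves the transform to the circle of radius \<open>s\<close>\<close>
    have disc: "pi * (\<Sum>l<N. (window \<mu> n l * s ^ l)\<^sup>2) \<le> B * (real n / (tail \<mu> n)\<^sup>2)"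
      if s: "0 < s" "s < 1" for s
    proof -
      let ?h = "\<lambda>\<theta>. if \<theta> \<le> 1 / real n then (real n)\<^sup>2 * (real n * \<theta>) powr (- 2 * \<beta>) else 1 / \<theta>\<^sup>2"
      let ?z = "\<lambda>\<theta>. of_real s * cis \<theta>"
      obtain I where I: "I \<le> real n / (1 - 2 * \<beta>) + real n" "(?h has_integral I) {0..pi}"
        using has_integral_kernel[OF beta n] by blast
      have z: "norm (?z \<theta>) < 1" for \<theta> using s by (simp add: norm_mult)
      have h: "((\<lambda>\<theta>. (2 / (c * tail \<mu> n))\<^sup>2 * E * ?h \<theta>) has_integral ((2 / (c * tail \<mu> n))\<^sup>2 * E * I)) {0..pi}"
        by (rule has_integral_mult_right[OF I(2)])
      have "pi * (\<Sum>l<N. (window \<mu> n l * s ^ l)\<^sup>2) \<le> (2 / (c * tail \<mu> n))\<^sup>2 * E * I"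
      proof (rule trig_series_l2_bound[OF _ _ _ h])
        show "summable (\<lambda>l. \<bar>window \<mu> n l * s ^ l\<bar>)"
        proof (rule summable_comparison_test')
          show "summable (\<lambda>l. real n * s ^ l)" using s by (intro summable_mult summable_geometric) auto
          show "norm \<bar>window \<mu> n l * s ^ l\<bar> \<le> real n * s ^ l" for l
            using s window_nonneg[of \<mu> n l] window_le[OF supp, of n l] by (simp add: abs_mult mult_right_mono)
        qed
        show "(\<lambda>l. complex_of_real (window \<mu> n l * s ^ l) * cis (real l * \<theta>)) sums
            ((\<Sum>i<n. ?z \<theta> ^ i) * (\<Sum>k. of_real (renewal_seq \<mu> k) * ?z \<theta> ^ k))" for \<theta>
        proof -
          have "of_real (window \<mu> n l * s ^ l) * cis (real l * \<theta>) = of_real (window \<mu> n l) * ?z \<theta> ^ l" for l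
            by (simp only: power_mult_distrib of_real_mult of_real_power Complex.DeMoivre mult.assoc)
          thus ?thesis using window_generating_function[OF supp z, of n \<theta>] by (simp only:)
        qed
        show "(cmod ((\<Sum>i<n. ?z \<theta> ^ i) * (\<Sum>k. of_real (renewal_seq \<mu> k) * ?z \<theta> ^ k)))\<^sup>2
            \<le> (2 / (c * tail \<mu> n))\<^sup>2 * E * ?h \<theta>" if "0 < \<theta>" "\<theta> \<le> pi" for \<theta>
          unfolding E_def
          by (rule window_transform_bound[OF \<open>0 < c\<close> gap n s that])
      qed
      also have "\<dots> \<le> (2 / (c * tail \<mu> n))\<^sup>2 * E * (real n / (1 - 2 * \<beta>) + real n)"
        using I(1) \<open>E > 0\<close> by (intro mult_left_mono) auto
      also have "\<dots> = B * (real n / (tail \<mu> n)\<^sup>2)"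
      proof -
        have "real n / (1 - 2 * \<beta>) + real n = (1 / (1 - 2 * \<beta>) + 1) * real n"
          by (simp add: distrib_right)
        moreover have "(2 / (c * tail \<mu> n))\<^sup>2 = 4 / c\<^sup>2 / (tail \<mu> n)\<^sup>2"
          by (simp add: power_divide power_mult_distrib)
        ultimately show ?thesis unfolding B_def by simp
      qed
      finally show ?thesis .
    qed
    have "((\<lambda>s. pi * (\<Sum>l<N. (window \<mu> n l * s ^ l)\<^sup>2)) \<longlongrightarrow> pi * (\<Sum>l<N. (window \<mu> n l * 1 ^ l)\<^sup>2)) (at_left 1)"
      by (intro tendsto_intros)
    moreover have "\<forall>\<^sub>F s in at_left (1::real). pi * (\<Sum>l<N. (window \<mu> n l * s ^ l)\<^sup>2) \<le> B * (real n / (tail \<mu> n)\<^sup>2)"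
      using disc by (subst eventually_at_left[of 0]) (auto intro!: exI[of _ "0::real"])
    ultimately have "pi * (\<Sum>l<N. (window \<mu> n l * 1 ^ l)\<^sup>2) \<le> B * (real n / (tail \<mu> n)\<^sup>2)"
      by (rule tendsto_upperbound) simp
    moreover have "1 * (\<Sum>l<N. (window \<mu> n l)\<^sup>2) \<le> pi * (\<Sum>l<N. (window \<mu> n l)\<^sup>2)"
      using pi_gt3 by (intro mult_right_mono sum_nonneg) auto
    ultimately show ?thesis by simp
  qed
  with \<open>B > 0\<close> show ?thesis by blast
qed

end

section \<open>The Green function and meeting probabilities\<close>

text \<open>The expected number of common points of two independent renewal processes that start at distance
  \<open>k\<close>.\<close>
definition green :: "nat pmf \<Rightarrow> nat \<Rightarrow> real" where
  "green \<mu> k = (\<Sum>m. renewal_seq \<mu> m * renewal_seq \<mu> (m + k))"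

lemma summable_renewal_product:
  assumes sq: "summable (\<lambda>m. (renewal_seq \<mu> m)\<^sup>2)"
  shows "summable (\<lambda>m. renewal_seq \<mu> m * renewal_seq \<mu> (m + k))"
proof (rule summable_comparison_test')
  show "summable (\<lambda>m. (renewal_seq \<mu> m)\<^sup>2 + (renewal_seq \<mu> (m + k))\<^sup>2)"
    using sq by (intro summable_add) (auto simp: summable_iff_shift[of "\<lambda>m. (renewal_seq \<mu> m)\<^sup>2"])
  fix m
  let ?a = "renewal_seq \<mu> m" and ?b = "renewal_seq \<mu> (m + k)"
  have "0 \<le> ?a * ?b" by (simp add: renewal_seq_nonneg)
  moreover have "2 * ?a * ?b \<le> ?a\<^sup>2 + ?b\<^sup>2" by (rule sum_squares_bound)
  ultimately show "norm (?a * ?b) \<le> ?a\<^sup>2 + ?b\<^sup>2" by simp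
qed

lemma green_nonneg:
  assumes sq: "summable (\<lambda>m. (renewal_seq \<mu> m)\<^sup>2)"
  shows "0 \<le> green \<mu> k"
  unfolding green_def by (intro suminf_nonneg summable_renewal_product[OF sq]) (auto simp: renewal_seq_nonneg)

lemma green_0_ge_1:
  assumes sq: "summable (\<lambda>m. (renewal_seq \<mu> m)\<^sup>2)"
  shows "1 \<le> green \<mu> 0"
proof -
  have "(\<Sum>m\<in>{0}. renewal_seq \<mu> m * renewal_seq \<mu> (m + 0)) \<le> green \<mu> 0"
    unfolding green_def using summable_renewal_product[OF sq, of 0]
    by (intro sum_le_suminf) (auto simp: renewal_seq_nonneg)
  thus ?thesis by simp
qed

text \<open>By the Cauchy-Schwarz inequality \<open>green \<mu> k\<close> is at most the norm of \<open>q\<close> times the norm of the part of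
  \<open>q\<close> beyond \<open>k\<close>.\<close>
lemma green_tendsto_0:
  assumes sq: "summable (\<lambda>m. (renewal_seq \<mu> m)\<^sup>2)"
  shows "green \<mu> \<longlonglongrightarrow> 0"
proof -
  let ?q = "renewal_seq \<mu>"
  define S where "S = (\<Sum>m. (?q m)\<^sup>2)"
  have shift: "summable (\<lambda>m. (?q (m + k))\<^sup>2)" "(\<Sum>m. (?q (m + k))\<^sup>2) = S - (\<Sum>m<k. (?q m)\<^sup>2)" for k
    using sq suminf_minus_initial_segment[OF sq, of k]
    by (auto simp: summable_iff_shift[of "\<lambda>m. (?q m)\<^sup>2"] S_def)
  have le: "green \<mu> k \<le> sqrt S * sqrt (S - (\<Sum>m<k. (?q m)\<^sup>2))" for k
    unfolding green_def
  proof (rule suminf_le_const[OF summable_renewal_product[OF sq]])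
    fix M
    have "(\<Sum>m<M. ?q m * ?q (m + k))\<^sup>2 \<le> (\<Sum>m<M. (?q m)\<^sup>2) * (\<Sum>m<M. (?q (m + k))\<^sup>2)"
      by (rule Cauchy_Schwarz_ineq_sum)
    also have "\<dots> \<le> S * (S - (\<Sum>m<k. (?q m)\<^sup>2))"
      unfolding shift(2)[symmetric] unfolding S_def
      by (intro mult_mono sum_le_suminf sq shift(1) suminf_nonneg sum_nonneg) auto
    finally show "(\<Sum>m<M. ?q m * ?q (m + k)) \<le> sqrt S * sqrt (S - (\<Sum>m<k. (?q m)\<^sup>2))"
      unfolding real_sqrt_mult[symmetric] by (rule real_le_rsqrt)
  qed
  have "(\<lambda>k. \<Sum>m<k. (?q m)\<^sup>2) \<longlonglongrightarrow> S" unfolding S_def using sq by (rule summable_LIMSEQ)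
  hence "(\<lambda>k. sqrt S * sqrt (S - (\<Sum>m<k. (?q m)\<^sup>2))) \<longlonglongrightarrow> sqrt S * sqrt (S - S)"
    by (intro tendsto_intros)
  hence lim: "(\<lambda>k. sqrt S * sqrt (S - (\<Sum>m<k. (?q m)\<^sup>2))) \<longlonglongrightarrow> 0" by simp
  show ?thesis
    by (rule tendsto_sandwich[OF _ _ tendsto_const lim]) (auto simp: green_nonneg[OF sq] le)
qed

lemma green_pair_sums:
  assumes sq: "summable (\<lambda>m. (renewal_seq \<mu> m)\<^sup>2)"
  shows "(\<lambda>l. (if i \<le> l then renewal_seq \<mu> (l - i) else 0) * (if j \<le> l then renewal_seq \<mu> (l - j) else 0))
    sums green \<mu> (nat \<bar>int i - int j\<bar>)"
proof -
  have le: "(\<lambda>l. (if i \<le> l then renewal_seq \<mu> (l - i) else 0) * (if j \<le> l then renewal_seq \<mu> (l - j) else 0))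
    sums green \<mu> (j - i)" (is "?f sums _") if "i \<le> j" for i j
  proof -
    have "(\<lambda>l. ?f (l + j)) sums green \<mu> (j - i)"
    proof -
      have eq: "?f (l + j) = renewal_seq \<mu> l * renewal_seq \<mu> (l + (j - i))" for l
        using that by (simp add: mult.commute)
      show ?thesis unfolding green_def eq
        by (rule summable_sums[OF summable_renewal_product[OF sq]])
    qed
    moreover have "(\<Sum>l<j. ?f l) = 0" by (intro sum.neutral) auto
    ultimately show ?thesis using sums_iff_shift[of ?f j "green \<mu> (j - i)"] by simp
  qed
  show ?thesis
  proof (cases "i \<le> j")
    case True
    have "nat \<bar>int i - int j\<bar> = j - i" using True by simp
    then show ?thesis using le[OF True] by (simp only:)
  next
    case False
    have "nat \<bar>int i - int j\<bar> = i - j" using False by simp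
    then show ?thesis using le[of j i] False by (simp add: mult.commute)
  qed
qed

text \<open>The process that starts \<open>k > 0\<close> below is behind, so condition on its next jump; formally, insert the
  renewal recursion for \<open>q (m + k)\<close> and exchange the sums.\<close>
lemma green_recursion:
  assumes supp: "set_pmf \<mu> \<subseteq> {1..}"
    and sq: "summable (\<lambda>m. (renewal_seq \<mu> m)\<^sup>2)" and "0 < k"
  shows "(\<integral>\<^sup>+ r. ennreal (green \<mu> (nat \<bar>int k - int r\<bar>)) \<partial>measure_pmf \<mu>) = ennreal (green \<mu> k)"
proof -
  let ?q = "renewal_seq \<mu>"
  let ?e = "\<lambda>m r. if r \<le> m + k then ?q (m + k - r) else 0"
  have p0: "pmf \<mu> 0 = 0" using supp by (auto simp: set_pmf_iff)
  have sums: "(\<lambda>m. ?q m * ?e m r) sums green \<mu> (nat \<bar>int k - int r\<bar>)" for r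
  proof (cases "r \<le> k")
    case True
    have eq: "?q m * ?e m r = ?q m * ?q (m + (k - r))" for m using True by simp
    have "nat \<bar>int k - int r\<bar> = k - r" using True by simp
    then show ?thesis unfolding green_def eq
      by (simp only: summable_sums[OF summable_renewal_product[OF sq]])
  next
    case False
    have "?q m * ?e m r = (if 0 \<le> m then ?q (m - 0) else 0) * (if r - k \<le> m then ?q (m - (r - k)) else 0)" for m
      using False by auto
    moreover have "nat \<bar>int k - int r\<bar> = nat \<bar>int 0 - int (r - k)\<bar>" using False by simp
    ultimately show ?thesis using green_pair_sums[OF sq, of 0 "r - k"] by (simp only:)
  qed
  have "ennreal (green \<mu> (nat \<bar>int k - int r\<bar>)) = (\<Sum>m. ennreal (?q m * ?e m r))" for r
    using sums[of r] by (subst suminf_ennreal2) (auto simp: sums_iff renewal_seq_nonneg)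
  hence "(\<integral>\<^sup>+ r. ennreal (green \<mu> (nat \<bar>int k - int r\<bar>)) \<partial>measure_pmf \<mu>)
      = (\<Sum>m. \<integral>\<^sup>+ r. ennreal (?q m * ?e m r) \<partial>measure_pmf \<mu>)"
    by (simp add: nn_integral_suminf)
  also have "\<dots> = (\<Sum>m. ennreal (?q m * ?q (m + k)))"
  proof (intro suminf_cong)
    fix m
    have "(\<integral>\<^sup>+ r. ennreal (?q m * ?e m r) \<partial>measure_pmf \<mu>)
        = (\<Sum>r\<in>{..m + k}. ennreal (?q m * ?e m r) * ennreal (pmf \<mu> r))"
      by (rule nn_integral_measure_pmf_support) auto
    also have "\<dots> = (\<Sum>r\<in>{..m + k}. ennreal (?q m * ?q (m + k - r) * pmf \<mu> r))"
      by (intro sum.cong refl) (auto simp: ennreal_mult renewal_seq_nonneg)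
    also have "\<dots> = ennreal (\<Sum>r\<in>{..m + k}. ?q m * ?q (m + k - r) * pmf \<mu> r)"
      by (rule sum_ennreal) (auto simp: renewal_seq_nonneg)
    also have "(\<Sum>r\<in>{..m + k}. ?q m * ?q (m + k - r) * pmf \<mu> r) = ?q m * ?q (m + k)"
    proof -
      have "{..m + k} = insert 0 {1..m + k}" by auto
      thus ?thesis using \<open>0 < k\<close> by (simp add: renewal_seq_rec[of "m + k"] p0 sum_distrib_left mult_ac)
    qed
    finally show "(\<integral>\<^sup>+ r. ennreal (?q m * ?e m r) \<partial>measure_pmf \<mu>) = ennreal (?q m * ?q (m + k))" .
  qed
  also have "\<dots> = ennreal (green \<mu> k)"
    unfolding green_def using summable_renewal_product[OF sq, of k]
    by (intro suminf_ennreal2) (auto simp: renewal_seq_nonneg)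
  finally show ?thesis .
qed

text \<open>The probability that two ancestral lines at distance \<open>k\<close> meet within \<open>N\<close> steps, when in each step
  the line whose current vertex is higher makes its jump \<open>r\<close>, so that the distance becomes \<open>|k - r|\<close>.\<close>
fun meet_within :: "nat pmf \<Rightarrow> nat \<Rightarrow> nat \<Rightarrow> real" where
  "meet_within \<mu> 0 k = (if k = 0 then 1 else 0)"
| "meet_within \<mu> (Suc N) k =
     (if k = 0 then 1 else measure_pmf.expectation \<mu> (\<lambda>r. meet_within \<mu> N (nat \<bar>int k - int r\<bar>)))"

lemma integrable_pmf_bounded:
  fixes f :: "nat \<Rightarrow> real" assumes "\<And>k. \<bar>f k\<bar> \<le> B"
  shows "integrable (measure_pmf \<mu>) f"
  by (rule measure_pmf.integrable_const_bound[where B = B]) (use assms in auto)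

lemma meet_within_bounds: "0 \<le> meet_within \<mu> N k" "meet_within \<mu> N k \<le> 1"
proof -
  have "0 \<le> meet_within \<mu> N k \<and> meet_within \<mu> N k \<le> 1"
  proof (induction N arbitrary: k)
    case (Suc N)
    have "measure_pmf.expectation \<mu> (\<lambda>r. meet_within \<mu> N (nat \<bar>int k - int r\<bar>)) \<le> measure_pmf.expectation \<mu> (\<lambda>_. 1)"
      using Suc by (intro integral_mono integrable_pmf_bounded[of _ 1]) (auto simp: abs_le_iff intro: order_trans[of _ 0])
    moreover have "0 \<le> measure_pmf.expectation \<mu> (\<lambda>r. meet_within \<mu> N (nat \<bar>int k - int r\<bar>))"
      using Suc by (intro Bochner_Integration.integral_nonneg) auto
    ultimately show ?case by simp
  qed simp
  thus "0 \<le> meet_within \<mu> N k" "meet_within \<mu> N k \<le> 1" by auto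
qed

lemma meet_within_integrable: "integrable (measure_pmf \<mu>) (\<lambda>r. meet_within \<mu> N (f r))"
  by (rule integrable_pmf_bounded[of _ 1]) (simp add: meet_within_bounds)

lemma meet_within_mono: "meet_within \<mu> N k \<le> meet_within \<mu> (Suc N) k"
proof (induction N arbitrary: k)
  case 0
  show ?case using meet_within_bounds(1)[of \<mu> "Suc 0" k] by (cases "k = 0") auto
next
  case (Suc N)
  show ?case
    unfolding meet_within.simps(2)[of \<mu> N k] meet_within.simps(2)[of \<mu> "Suc N" k]
    by (cases "k = 0") (auto intro!: integral_mono meet_within_integrable Suc simp del: meet_within.simps)
qed

lemma green_expectation:
  assumes supp: "set_pmf \<mu> \<subseteq> {1..}"
    and sq: "summable (\<lambda>m. (renewal_seq \<mu> m)\<^sup>2)" and "0 < k"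
  shows "integrable (measure_pmf \<mu>) (\<lambda>r. green \<mu> (nat \<bar>int k - int r\<bar>))"
    and "measure_pmf.expectation \<mu> (\<lambda>r. green \<mu> (nat \<bar>int k - int r\<bar>)) = green \<mu> k"
proof -
  have hb: "has_bochner_integral (measure_pmf \<mu>) (\<lambda>r. green \<mu> (nat \<bar>int k - int r\<bar>)) (green \<mu> k)"
    by (rule has_bochner_integral_nn_integral) (auto simp: green_nonneg[OF sq] green_recursion[OF assms])
  show "integrable (measure_pmf \<mu>) (\<lambda>r. green \<mu> (nat \<bar>int k - int r\<bar>))"
    using hb by (rule integrable.intros)
  show "measure_pmf.expectation \<mu> (\<lambda>r. green \<mu> (nat \<bar>int k - int r\<bar>)) = green \<mu> k"
    using hb by (rule has_bochner_integral_integral_eq)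
qed

text \<open>The right-hand side is harmonic off \<open>0\<close>, equals one at \<open>0\<close> and is nonnegative; the meeting probability
  is the least such function.\<close>
lemma meet_within_le_green:
  assumes supp: "set_pmf \<mu> \<subseteq> {1..}"
    and sq: "summable (\<lambda>m. (renewal_seq \<mu> m)\<^sup>2)"
  shows "meet_within \<mu> N k \<le> green \<mu> k / green \<mu> 0"
proof (induction N arbitrary: k)
  case 0
  show ?case using green_0_ge_1[OF sq] green_nonneg[OF sq, of k] by auto
next
  case (Suc N)
  show ?case
  proof (cases "k = 0")
    case False
    have "meet_within \<mu> (Suc N) k \<le> measure_pmf.expectation \<mu> (\<lambda>r. green \<mu> (nat \<bar>int k - int r\<bar>) / green \<mu> 0)"
      unfolding meet_within.simps(2) if_not_P[OF False]
      using False green_expectation(1)[OF supp sq, of k]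
      by (intro integral_mono meet_within_integrable Suc integrable_divide) auto
    also have "\<dots> = green \<mu> k / green \<mu> 0" using green_expectation(2)[OF supp sq, of k] False by simp
    finally show ?thesis .
  qed (use green_0_ge_1[OF sq] in auto)
qed

text \<open>The difference \<open>f\<close> between the normalised Green function and the limit of the meeting probabilities
  is nonnegative, harmonic off \<open>0\<close>, and tends to \<open>0\<close>. If it is positive somewhere, it attains a positive
  maximum at some \<open>j > 0\<close>, and then it takes this value at \<open>|j - r|\<close> for every possible jump \<open>r\<close>. These
  points are unbounded because the jumps are, in contradiction to the limit.\<close>
lemma meet_within_tendsto_green:
  assumes supp: "set_pmf \<mu> \<subseteq> {1..}" and pos: "\<And>n. 0 < tail \<mu> n"
    and sq: "summable (\<lambda>m. (renewal_seq \<mu> m)\<^sup>2)"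
  shows "(\<lambda>N. meet_within \<mu> N k) \<longlonglongrightarrow> green \<mu> k / green \<mu> 0"
proof -
  define h where "h k = lim (\<lambda>N. meet_within \<mu> N k)" for k
  define g where "g k = green \<mu> k / green \<mu> 0" for k
  have h: "(\<lambda>N. meet_within \<mu> N k) \<longlonglongrightarrow> h k" for k
  proof -
    have "incseq (\<lambda>N. meet_within \<mu> N k)" by (intro incseq_SucI meet_within_mono)
    hence "convergent (\<lambda>N. meet_within \<mu> N k)"
      using meet_within_bounds by (metis incseq_convergent convergentI)
    thus ?thesis unfolding h_def by (simp add: convergent_LIMSEQ_iff)
  qed
  have hb: "0 \<le> h k" "h k \<le> 1" "h k \<le> g k" for k
    using meet_within_bounds meet_within_le_green[OF supp sq] unfolding g_def
    by (auto intro!: LIMSEQ_le_const[OF h] LIMSEQ_le_const2[OF h])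
  have h0: "h 0 = 1"
  proof -
    have "meet_within \<mu> N 0 = 1" for N by (cases N) auto
    thus ?thesis unfolding h_def by simp
  qed
  have hrec: "h k = measure_pmf.expectation \<mu> (\<lambda>r. h (nat \<bar>int k - int r\<bar>))" if "0 < k" for k
  proof -
    have "(\<lambda>N. measure_pmf.expectation \<mu> (\<lambda>r. meet_within \<mu> N (nat \<bar>int k - int r\<bar>)))
        \<longlonglongrightarrow> measure_pmf.expectation \<mu> (\<lambda>r. h (nat \<bar>int k - int r\<bar>))"
      by (rule integral_dominated_convergence[where w = "\<lambda>_. 1"])
         (auto intro!: always_eventually h simp: meet_within_bounds)
    moreover have "(\<lambda>N. meet_within \<mu> (Suc N) k) \<longlonglongrightarrow> h k" using h by (rule LIMSEQ_Suc)
    ultimately show ?thesis using that by (simp add: LIMSEQ_unique)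
  qed
  define f where "f k = g k - h k" for k
  have f0: "f 0 = 0" using h0 green_0_ge_1[OF sq] by (simp add: f_def g_def)
  have fnn: "0 \<le> f k" for k using hb(3) by (simp add: f_def)
  have inth: "integrable (measure_pmf \<mu>) (\<lambda>r. h (u r))" for u
    by (rule integrable_pmf_bounded[of _ 1]) (simp add: hb)
  have frec: "integrable (measure_pmf \<mu>) (\<lambda>r. f (nat \<bar>int k - int r\<bar>))"
     "measure_pmf.expectation \<mu> (\<lambda>r. f (nat \<bar>int k - int r\<bar>)) = f k" if "0 < k" for k
    using green_expectation[OF supp sq that] inth hrec[OF that]
    by (auto simp: f_def g_def)
  have flim: "f \<longlonglongrightarrow> 0"
  proof (rule tendsto_sandwich[OF _ _ tendsto_const])
    show "(\<lambda>k. green \<mu> k / green \<mu> 0) \<longlonglongrightarrow> 0"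
      using tendsto_divide_zero[OF green_tendsto_0[OF sq]] .
    show "\<forall>\<^sub>F k in sequentially. f k \<le> green \<mu> k / green \<mu> 0"
      using hb(1) by (simp add: f_def g_def)
  qed (use fnn in simp)
  have "f k = 0" for k
  proof (rule ccontr)
    assume "f k \<noteq> 0"
    hence fk: "0 < f k" using fnn[of k] by simp
    define F where "F = {j. f k \<le> f j}"
    have "finite F"
    proof -
      obtain j0 where j0: "\<And>j. j \<ge> j0 \<Longrightarrow> f j < f k"
        using order_tendstoD(2)[OF flim fk] by (auto simp: eventually_sequentially)
      have "F \<subseteq> {..<j0}" unfolding F_def using j0 by (auto simp: not_le[symmetric])
      thus ?thesis by (rule finite_subset) simp
    qed
    moreover have "k \<in> F" by (simp add: F_def)
    ultimately obtain j where j: "j \<in> F" "\<And>i. i \<in> F \<Longrightarrow> f i \<le> f j"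
      using Max_in[of "f ` F"] Max_ge[of "f ` F"] by (metis empty_iff finite_imageI image_iff image_eqI)
    have jmax: "f i \<le> f j" for i
    proof (cases "i \<in> F")
      case False
      then show ?thesis using j(1) by (simp add: F_def)
    qed (rule j(2))
    have "0 < j" using j(1) fk f0 by (cases "j = 0") (auto simp: F_def)
    have int: "integrable (measure_pmf \<mu>) (\<lambda>r. f j - f (nat \<bar>int j - int r\<bar>))"
      using frec(1)[OF \<open>0 < j\<close>] by simp
    have "measure_pmf.expectation \<mu> (\<lambda>r. f j - f (nat \<bar>int j - int r\<bar>)) = 0"
      using frec[OF \<open>0 < j\<close>] by simp
    hence "AE r in measure_pmf \<mu>. f j - f (nat \<bar>int j - int r\<bar>) = 0"
      using integral_nonneg_eq_0_iff_AE[OF int] jmax by simp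
    hence eq: "f (nat \<bar>int j - int r\<bar>) = f j" if "r \<in> set_pmf \<mu>" for r
      using that by (auto simp: AE_measure_pmf_iff)
    obtain b where b: "F \<subseteq> {..b}" using \<open>finite F\<close> by (auto simp: finite_nat_set_iff_bounded_le)
    have "measure_pmf.prob \<mu> {b + j + 1..} \<noteq> 0" using pos[of "b + j + 1"] by (simp add: tail_def)
    hence "set_pmf \<mu> \<inter> {b + j + 1..} \<noteq> {}" by (simp add: measure_pmf_zero_iff)
    then obtain r where r: "r \<in> set_pmf \<mu>" "b + j + 1 \<le> r" by auto
    have "nat \<bar>int j - int r\<bar> \<in> F" using eq[OF r(1)] j(1) by (simp add: F_def)
    hence "nat \<bar>int j - int r\<bar> \<le> b" using b by auto
    thus False using r(2) by linarith
  qed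
  hence "h k = g k" by (simp add: f_def)
  thus ?thesis using h[of k] by (simp add: g_def)
qed

section \<open>Growth of the variance\<close>

text \<open>If \<open>g\<close> gives the covariance at each distance, this is the variance of \<open>n\<close> consecutive summands.\<close>
definition pair_sum :: "(nat \<Rightarrow> real) \<Rightarrow> nat \<Rightarrow> real" where
  "pair_sum g n = (\<Sum>i<n. \<Sum>j<n. g (nat \<bar>int i - int j\<bar>))"

lemma window_altdef: "window \<mu> n l = (\<Sum>i<n. if i \<le> l then renewal_seq \<mu> (l - i) else 0)"
proof -
  have "window \<mu> n l = (\<Sum>i\<in>{..l} \<inter> {..<n}. renewal_seq \<mu> (l - i))"
    unfolding window_def by (simp add: sum.inter_restrict)
  also have "\<dots> = (\<Sum>i\<in>{..<n} \<inter> {..l}. renewal_seq \<mu> (l - i))" by (simp only: Int_commute)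
  also have "\<dots> = (\<Sum>i<n. if i \<le> l then renewal_seq \<mu> (l - i) else 0)" by (simp add: sum.inter_restrict)
  finally show ?thesis .
qed

lemma window_squared_sums:
  assumes sq: "summable (\<lambda>m. (renewal_seq \<mu> m)\<^sup>2)"
  shows "(\<lambda>l. (window \<mu> n l)\<^sup>2) sums pair_sum (green \<mu>) n"
proof -
  have "(window \<mu> n l)\<^sup>2 = (\<Sum>i<n. \<Sum>j<n. (if i \<le> l then renewal_seq \<mu> (l - i) else 0) * (if j \<le> l then renewal_seq \<mu> (l - j) else 0))" for l
    by (simp only: window_altdef power2_eq_square sum_product)
  thus ?thesis unfolding pair_sum_def by (simp only:) (intro sums_sum green_pair_sums[OF sq])
qed

lemma pair_sum_pos:
  assumes sq: "summable (\<lambda>m. (renewal_seq \<mu> m)\<^sup>2)" and "1 \<le> n"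
  shows "0 < pair_sum (green \<mu>) n"
proof -
  have "green \<mu> (nat \<bar>int 0 - int 0\<bar>) \<le> (\<Sum>j<n. green \<mu> (nat \<bar>int 0 - int j\<bar>))"
    using assms(2) by (intro member_le_sum) (auto simp: green_nonneg[OF sq])
  also have "\<dots> \<le> pair_sum (green \<mu>) n"
    unfolding pair_sum_def using assms(2)
    by (intro member_le_sum[where f = "\<lambda>i. \<Sum>j<n. green \<mu> (nat \<bar>int i - int j\<bar>)"])
       (auto simp: green_nonneg[OF sq] intro!: sum_nonneg)
  finally show ?thesis using green_0_ge_1[OF sq] by simp
qed

text \<open>For \<open>l < n\<close> the window is the full renewal sum up to \<open>l\<close>, and for the upper half of these \<open>l\<close> that
  sum is of the order of the inverse tail at \<open>n\<close>.\<close>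
lemma (in potter_tail) pair_sum_lower_bound:
  assumes sq: "summable (\<lambda>m. (renewal_seq \<mu> m)\<^sup>2)" and n: "1 \<le> n"
  shows "1 / (32 * K ^ 4) * (real n / (tail \<mu> n)\<^sup>2) \<le> pair_sum (green \<mu>) n"
proof -
  have each: "(1 / (4 * K\<^sup>2 * tail \<mu> n))\<^sup>2 \<le> (window \<mu> n l)\<^sup>2" if l: "l \<in> {n div 2..<n}" for l
  proof -
    have "tail \<mu> (Suc l) \<le> K * (real n / real (Suc l)) powr \<beta> * tail \<mu> n"
      using l by (intro pot) auto
    also have "\<dots> \<le> K * 2 * tail \<mu> n"
    proof -
      have "n \<le> 2 * Suc l" using l by auto
      hence "real n \<le> 2 * real (Suc l)" by linarith
      hence "real n / real (Suc l) \<le> 2" by (simp add: divide_le_eq)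
      hence "(real n / real (Suc l)) powr \<beta> \<le> 2 powr \<beta>" using beta by (intro powr_mono2) auto
      also have "\<dots> \<le> 2 powr 1" using beta by (intro powr_mono) auto
      finally show ?thesis using K pos[of n] by (intro mult_right_mono mult_left_mono) auto
    qed
    finally have T: "tail \<mu> (Suc l) \<le> 2 * K * tail \<mu> n" by (simp add: mult_ac)
    have "1 / (4 * K\<^sup>2 * tail \<mu> n) = 1 / (2 * K * (2 * K * tail \<mu> n))" by (simp add: power2_eq_square)
    also have "\<dots> \<le> 1 / (2 * K * tail \<mu> (Suc l))"
      using T pos[of "Suc l"] pos[of n] K by (intro divide_left_mono mult_left_mono) auto
    also have "\<dots> \<le> (\<Sum>j\<le>l. renewal_seq \<mu> j)"
      by (rule renewal_sum_lower_bound)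
    also have "\<dots> = window \<mu> n l"
      unfolding window_def
      by (rule sum.reindex_bij_witness[of _ "\<lambda>i. l - i" "\<lambda>i. l - i"]) (use l in auto)
    finally show ?thesis using K pos[of n] by (intro power_mono) auto
  qed
  have "n - n div 2 \<ge> n div 2" by simp
  hence cnt: "real n / 2 \<le> real (card {n div 2..<n})" by simp
  have "1 / (32 * K ^ 4) * (real n / (tail \<mu> n)\<^sup>2) = real n / 2 * (1 / (4 * K\<^sup>2 * tail \<mu> n))\<^sup>2"
    by (simp add: power_mult_distrib power_divide)
  also have "\<dots> \<le> real (card {n div 2..<n}) * (1 / (4 * K\<^sup>2 * tail \<mu> n))\<^sup>2"
    using cnt by (intro mult_right_mono) auto
  also have "\<dots> \<le> (\<Sum>l\<in>{n div 2..<n}. (window \<mu> n l)\<^sup>2)"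
    using sum_mono[OF each, of "{n div 2..<n}" "\<lambda>x. x"] by simp
  also have "\<dots> \<le> (\<Sum>l. (window \<mu> n l)\<^sup>2)"
    using window_squared_sums[OF sq, of n] by (intro sum_le_suminf) (auto simp: sums_iff)
  also have "\<dots> = pair_sum (green \<mu>) n" using window_squared_sums[OF sq, of n] by (simp add: sums_iff)
  finally show ?thesis .
qed

text \<open>The sum has the exact order \<open>n / (tail \<mu> n)\<^sup>2\<close>, so its growth is that of \<open>n\<close> times a function of index
  \<open>2 * \<alpha>\<close>. For \<open>m \<le> n\<close> the Potter exponent \<open>\<alpha> / 2\<close> leaves \<open>1 + \<alpha>\<close>. For \<open>m > n\<close> the exponent is larger, but
  the bound \<open>H\<close> on the ratio turns the excess into a constant.\<close>
theorem pair_sum_growth: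
  assumes alpha: "0 < \<alpha>" "\<alpha> < 1 / 2"
    and L: "slowly_varying L"
    and supp: "set_pmf \<mu> \<subseteq> {1..}"
    and tail: "(\<lambda>n. measure_pmf.prob \<mu> {n..}) \<sim>[at_top] (\<lambda>n. real n powr (-\<alpha>) * L (real n))"
    and gcd: "Gcd {n. n \<ge> 1 \<and> pmf \<mu> n > 0} = 1"
  shows "summable (\<lambda>m. (renewal_seq \<mu> m)\<^sup>2)"
    and "1 \<le> H \<Longrightarrow> \<exists>A>0. \<forall>m\<ge>1. \<forall>n\<ge>1. real m \<le> H * real n \<longrightarrow>
      pair_sum (green \<mu>) m \<le> A * (real m / real n) powr (1 + \<alpha>) * pair_sum (green \<mu>) n"
proof -
  note pos = tail_pos[OF L tail]
  \<comment> \<open>the Potter exponent must exceed the index and stay in the range where \<open>\<theta> powr (- 2 * \<beta>)\<close> is integrable\<close>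
  define \<beta> where "\<beta> = (\<alpha> + 1 / 2) / 2"
  have \<beta>: "0 < \<beta>" "\<alpha> < \<beta>" "\<beta> < 1 / 2" using alpha by (auto simp: \<beta>_def)
  obtain K where K: "0 < K" and pot:
    "\<And>m n. 1 \<le> m \<Longrightarrow> m \<le> n \<Longrightarrow> tail \<mu> m \<le> K * (real n / real m) powr \<beta> * tail \<mu> n"
    using tail_potter_lower[OF L tail \<beta>(2)] by blast
  obtain K' where K': "0 < K'" and pot':
    "\<And>m n. 1 \<le> m \<Longrightarrow> m \<le> n \<Longrightarrow> tail \<mu> n \<le> K' * (real n / real m) powr (- (\<alpha> / 2)) * tail \<mu> m"
    using tail_potter_upper[OF L tail, of "\<alpha> / 2"] alpha by auto
  obtain c where c: "0 < c"
    and gap: "\<And>\<theta>. 0 < \<theta> \<Longrightarrow> \<theta> \<le> pi \<Longrightarrow> c * tail \<mu> (nat \<lceil>1 / \<theta>\<rceil>) \<le> char_gap \<mu> \<theta>"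
    using char_gap_ge_tail[OF L alpha(1) tail gcd] by blast
  interpret potter_tail \<mu> K \<beta>
    by unfold_locales (use supp pos K pot \<beta> in auto)
  obtain B where B: "0 < B" and win:
    "\<And>n N. 1 \<le> n \<Longrightarrow> (\<Sum>l<N. (window \<mu> n l)\<^sup>2) \<le> B * (real n / (tail \<mu> n)\<^sup>2)"
    using window_l2_bound[OF c gap] by blast
  \<comment> \<open>the window of length one is the renewal sequence itself, so the bound for \<open>n = 1\<close> is its square summability\<close>
  have w1: "window \<mu> 1 l = renewal_seq \<mu> l" for l
    by (simp add: window_altdef)
  show sq: "summable (\<lambda>m. (renewal_seq \<mu> m)\<^sup>2)"
    by (rule summableI_nonneg_bounded[of _ "B * (real 1 / (tail \<mu> 1)\<^sup>2)"])
       (use win[of 1] w1 in auto)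
  have upper: "pair_sum (green \<mu>) n \<le> B * (real n / (tail \<mu> n)\<^sup>2)" if "1 \<le> n" for n
    using window_squared_sums[OF sq, of n] suminf_le_const[of "\<lambda>l. (window \<mu> n l)\<^sup>2"] win[OF that]
    by (auto simp: sums_iff)
  assume H: "1 \<le> H"
  define E where "E = max K' (K * H)"
  have E: "0 < E" "K' \<le> E" "K * H \<le> E" using K' by (auto simp: E_def)
  define A where "A = 32 * B * K ^ 4 * E\<^sup>2"
  have "A > 0" unfolding A_def using B K E by (intro mult_pos_pos) auto
  have "pair_sum (green \<mu>) m \<le> A * (real m / real n) powr (1 + \<alpha>) * pair_sum (green \<mu>) n"
    if mn: "1 \<le> m" "1 \<le> n" "real m \<le> H * real n" for m n
  proof -
    define x where "x = real m / real n"
    have x: "0 < x" "x \<le> H" "real m = x * real n" using mn by (auto simp: x_def field_simps)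
    have ratio: "tail \<mu> n \<le> E * x powr (\<alpha> / 2) * tail \<mu> m"
    proof (cases "m \<le> n")
      case True
      have "tail \<mu> n \<le> K' * (real n / real m) powr (- (\<alpha> / 2)) * tail \<mu> m" by (rule pot'[OF mn(1) True])
      also have "(real n / real m) powr (- (\<alpha> / 2)) = x powr (\<alpha> / 2)"
        using mn by (simp add: x_def powr_minus_divide powr_divide)
      also have "K' * x powr (\<alpha> / 2) * tail \<mu> m \<le> E * x powr (\<alpha> / 2) * tail \<mu> m"
        using E(2) pos[of m] by (intro mult_right_mono) auto
      finally show ?thesis .
    next
      case False
      hence x1: "1 \<le> x" using mn by (simp add: x_def)
      have "x powr \<beta> \<le> x powr (1 + \<alpha> / 2)" using x1 \<beta> alpha by (intro powr_mono) auto
      also have "\<dots> = x * x powr (\<alpha> / 2)" using x by (simp add: powr_add)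
      also have "\<dots> \<le> H * x powr (\<alpha> / 2)" using x by (intro mult_right_mono) auto
      finally have "K * x powr \<beta> * tail \<mu> m \<le> K * (H * x powr (\<alpha> / 2)) * tail \<mu> m"
        using K pos[of m] by (intro mult_right_mono mult_left_mono) auto
      also have "\<dots> \<le> E * x powr (\<alpha> / 2) * tail \<mu> m"
        unfolding mult.assoc[symmetric] using E(3) pos[of m] by (intro mult_right_mono) auto
      finally show ?thesis using pot[OF mn(2), of m] False by (simp add: x_def)
    qed
    have "(tail \<mu> n)\<^sup>2 \<le> (E * x powr (\<alpha> / 2) * tail \<mu> m)\<^sup>2"
      using ratio pos[of n] by (intro power_mono) auto
    also have "\<dots> = E\<^sup>2 * x powr \<alpha> * (tail \<mu> m)\<^sup>2"
      by (simp add: power_mult_distrib power2_eq_square powr_add[symmetric])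
    finally have "1 / (tail \<mu> m)\<^sup>2 \<le> E\<^sup>2 * x powr \<alpha> * (1 / (tail \<mu> n)\<^sup>2)"
      using pos[of m] pos[of n] by (simp add: divide_le_eq le_divide_eq mult_ac)
    hence "B * real m * (1 / (tail \<mu> m)\<^sup>2) \<le> B * real m * (E\<^sup>2 * x powr \<alpha> * (1 / (tail \<mu> n)\<^sup>2))"
      using B by (intro mult_left_mono) auto
    also have "\<dots> = A * x powr (1 + \<alpha>) * (1 / (32 * K ^ 4) * (real n / (tail \<mu> n)\<^sup>2))"
      using K x by (simp add: A_def powr_add)
    also have "\<dots> \<le> A * x powr (1 + \<alpha>) * pair_sum (green \<mu>) n"
      using \<open>A > 0\<close> by (intro mult_left_mono pair_sum_lower_bound[OF sq mn(2)]) auto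
    finally show ?thesis using upper[OF mn(1)] by (simp add: x_def)
  qed
  with \<open>A > 0\<close> show "\<exists>A>0. \<forall>m\<ge>1. \<forall>n\<ge>1. real m \<le> H * real n \<longrightarrow>
      pair_sum (green \<mu>) m \<le> A * (real m / real n) powr (1 + \<alpha>) * pair_sum (green \<mu>) n" by blast
qed

section \<open>Components of the random graph\<close>

text \<open>If the jumps are positive, moving always the higher of the two vertices uses each jump \<open>r i\<close> at most
  once, in decreasing order of \<open>i\<close>. Hence the jump used next is independent of everything that follows.\<close>
fun meets :: "(int \<Rightarrow> nat) \<Rightarrow> nat \<Rightarrow> int \<Rightarrow> int \<Rightarrow> bool" where
  "meets r 0 a b \<longleftrightarrow> a = b"
| "meets r (Suc N) a b \<longleftrightarrow>
     a = b \<or> (b < a \<and> meets r N (a - int (r a)) b) \<or> (a < b \<and> meets r N a (b - int (r b)))"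

lemma meets_Suc: "meets r N a b \<Longrightarrow> meets r (Suc N) a b"
proof (induction N arbitrary: a b)
  case (Suc N)
  then show ?case by (subst meets.simps(2)) (auto simp del: meets.simps(2) simp: meets.simps(2)[of r N])
qed simp

lemma meets_sym: "meets r N a b = meets r N b a"
  by (induction N arbitrary: a b) auto

lemma meets_cong:
  assumes "\<And>k. k \<le> c \<Longrightarrow> r k = r' k" "a \<le> c" "b \<le> c"
  shows "meets r N a b = meets r' N a b"
  using assms(2,3)
proof (induction N arbitrary: a b)
  case (Suc N)
  have "meets r N (a - int (r a)) b = meets r' N (a - int (r' a)) b"
    "meets r N a (b - int (r b)) = meets r' N a (b - int (r' b))"
    using Suc.IH[of "a - int (r a)" b] Suc.IH[of a "b - int (r b)"] Suc.prems assms(1)[of a] assms(1)[of b]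
    by auto
  then show ?case by simp
qed simp

lemma meets_imp_connected: "meets r N a b \<Longrightarrow> graph_connected r a b"
proof (induction N arbitrary: a b)
  case 0
  then show ?case by (simp add: graph_connected_def)
next
  case (Suc N)
  have edge: "(x, x - int (r x)) \<in> graph_edges r \<union> (graph_edges r)\<inverse>"
    "(x - int (r x), x) \<in> graph_edges r \<union> (graph_edges r)\<inverse>" for x
    by (auto simp: graph_edges_def)
  from Suc.prems consider "a = b" | "meets r N (a - int (r a)) b" | "meets r N a (b - int (r b))" by auto
  then show ?case
  proof cases
    case 1
    then show ?thesis by (simp add: graph_connected_def)
  next
    case 2
    then show ?thesis using Suc.IH[OF 2] edge(1)[of a]
      unfolding graph_connected_def by (rule_tac converse_rtrancl_into_rtrancl)
  next
    case 3
    then show ?thesis using Suc.IH[OF 3] edge(2)[of b]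
      unfolding graph_connected_def by (rule_tac rtrancl_into_rtrancl)
  qed
qed

text \<open>Every vertex has exactly one outgoing edge, so neighbours have a common ancestor, and common
  ancestry propagates along paths.\<close>
lemma connected_imp_common_ancestor:
  assumes "graph_connected r a b"
  shows "\<exists>m n. ((\<lambda>i. i - int (r i)) ^^ m) a = ((\<lambda>i. i - int (r i)) ^^ n) b"
  using assms unfolding graph_connected_def
proof (induction rule: rtrancl_induct)
  case (step b c)
  let ?f = "\<lambda>i. i - int (r i)"
  obtain m n where mn: "(?f ^^ m) a = (?f ^^ n) b" using step.IH by blast
  from step.hyps(2) consider "c = ?f b" | "b = ?f c" by (auto simp: graph_edges_def)
  then show ?case
  proof cases
    case 1
    have "(?f ^^ Suc m) a = ?f ((?f ^^ n) b)" using mn by simp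
    also have "\<dots> = (?f ^^ n) (?f b)" by (rule funpow_swap1)
    finally have "(?f ^^ Suc m) a = (?f ^^ n) c" unfolding 1 .
    then show ?thesis by blast
  next
    case 2
    have "(?f ^^ m) a = (?f ^^ Suc n) c" using mn 2 by (simp only: funpow_Suc_right comp_apply)
    then show ?thesis by blast
  qed
qed (auto intro: exI[of _ 0])

text \<open>Positive jumps make the ancestral lines strictly decreasing: a common ancestor of \<open>a < b\<close> is not \<open>b\<close>
  itself, so the line of the higher vertex can be advanced without missing it.\<close>
lemma common_ancestor_imp_meets:
  assumes r: "\<And>i. 1 \<le> r i"
  shows "((\<lambda>i. i - int (r i)) ^^ m) a = ((\<lambda>i. i - int (r i)) ^^ n) b \<Longrightarrow> \<exists>N. meets r N a b"
proof (induction "m + n" arbitrary: m n a b rule: less_induct)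
  case less
  let ?f = "\<lambda>i. i - int (r i)"
  have le: "(?f ^^ k) x \<le> x" for k x
    by (induction k) (auto intro: order_trans)
  show ?case
  proof (cases a b rule: linorder_cases)
    case equal
    then show ?thesis by (intro exI[of _ 0]) simp
  next
    case greater
    have "m \<noteq> 0" using less.prems le[of n b] greater by (intro notI) simp
    then obtain m' where m': "m = Suc m'" using not0_implies_Suc by blast
    have "(?f ^^ m') (?f a) = (?f ^^ n) b" using less.prems m' by (simp only: funpow_Suc_right comp_apply)
    then obtain N where "meets r N (?f a) b" using less.hyps[of m' n "?f a" b] m' by auto
    then show ?thesis using greater by (intro exI[of _ "Suc N"]) simp
  next
    case less': less
    have "n \<noteq> 0" using less.prems le[of m a] less' by (intro notI) simp
    then obtain n' where n': "n = Suc n'" using not0_implies_Suc by blast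
    have "(?f ^^ m) a = (?f ^^ n') (?f b)" using less.prems n' by (simp only: funpow_Suc_right comp_apply)
    then obtain N where "meets r N a (?f b)" using less.hyps[of m n' a "?f b"] n' by auto
    then show ?thesis using less' by (intro exI[of _ "Suc N"]) simp
  qed
qed

lemma connected_iff_meets:
  assumes "\<And>i. 1 \<le> r i"
  shows "graph_connected r a b \<longleftrightarrow> (\<exists>N. meets r N a b)"
  using meets_imp_connected connected_imp_common_ancestor common_ancestor_imp_meets[of r, OF assms] by blast

lemma connected_sym: "graph_connected r a b \<Longrightarrow> graph_connected r b a"
proof -
  have "sym ((graph_edges r \<union> (graph_edges r)\<inverse>)\<^sup>*)" by (intro sym_rtrancl) (auto simp: sym_def)
  thus "graph_connected r a b \<Longrightarrow> graph_connected r b a" by (auto simp: graph_connected_def dest: symD)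
qed

lemma representative_eq_iff:
  assumes "component_representative rep"
  shows "rep r i = rep r j \<longleftrightarrow> graph_connected r i j"
proof
  assume eq: "rep r i = rep r j"
  have "graph_connected r i (rep r i)" "graph_connected r (rep r i) j"
    using assms connected_sym eq unfolding component_representative_def by metis+
  thus "graph_connected r i j" unfolding graph_connected_def by (rule rtrancl_trans)
qed (use assms in \<open>auto simp: component_representative_def\<close>)

lemma meets_measurable:
  assumes X: "\<And>k. k \<le> c \<Longrightarrow> X k \<in> M' \<rightarrow>\<^sub>M count_space UNIV" and "a \<le> c" "b \<le> c"
  shows "Measurable.pred M' (\<lambda>\<omega>. meets (\<lambda>k. X k \<omega>) N a b)"
  using assms(2,3)
proof (induction N arbitrary: a b)
  case (Suc N)
  have "Measurable.pred M' (\<lambda>\<omega>. meets (\<lambda>k. X k \<omega>) N (a - int (X a \<omega>)) b)"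
    by (rule measurable_compose_countable[OF Suc.IH X]) (use Suc.prems in auto)
  moreover have "Measurable.pred M' (\<lambda>\<omega>. meets (\<lambda>k. X k \<omega>) N a (b - int (X b \<omega>)))"
    by (rule measurable_compose_countable[OF Suc.IH X]) (use Suc.prems in auto)
  ultimately show ?case unfolding meets.simps(2) by measurable
qed simp

context coloured_graph
begin

definition joint :: "int + int \<Rightarrow> 'a \<Rightarrow> real" where
  "joint = case_sum (\<lambda>i \<omega>. real (R i \<omega>)) C"

lemma joint_indep: "indep_vars (\<lambda>_. borel) joint UNIV"
  using independent by (simp add: joint_def)

lemma C_measurable [measurable]: "C j \<in> borel_measurable M"
  using indep_vars_def2[THEN iffD1, OF joint_indep] by (auto simp: joint_def split: sum.splits dest!: bspec[of _ _ "Inr j"])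

lemma R_measurable' [measurable]: "R i \<in> M \<rightarrow>\<^sub>M count_space UNIV"
  by (rule R_measurable)

text \<open>One type of values for all blocks lets any two of them be treated as a pair of random variables.\<close>
definition block :: "(int + int) set \<Rightarrow> 'a \<Rightarrow> int + int \<Rightarrow> real" where
  "block A \<omega> = restrict (\<lambda>l. joint l \<omega>) A"

lemma block_measurable: "block A \<in> M \<rightarrow>\<^sub>M PiM A (\<lambda>_. borel)"
  using joint_indep unfolding block_def[abs_def] indep_vars_def by (intro measurable_restrict) auto

text \<open>Blocks over disjoint index sets are independent; this is Tonelli's theorem for their joint law, pulled
  back to the probability space.\<close>
lemma nn_integral_disjoint_blocks:
  assumes AB: "A \<inter> B = {}" and F: "F \<in> borel_measurable (PiM A (\<lambda>_. borel) \<Otimes>\<^sub>M PiM B (\<lambda>_. borel))"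
  shows "(\<integral>\<^sup>+ \<omega>. F (block A \<omega>, block B \<omega>) \<partial>M) = (\<integral>\<^sup>+ \<omega>. \<integral>\<^sup>+ \<omega>'. F (block A \<omega>, block B \<omega>') \<partial>M \<partial>M)"
proof -
  let ?Q = "PiM A (\<lambda>_. borel :: real measure)" and ?P = "PiM B (\<lambda>_. borel :: real measure)"
  note V = block_measurable[of A] and U = block_measurable[of B]
  have indep: "indep_var ?Q (block A) ?P (block B)"
    unfolding block_def[abs_def] by (rule indep_var_restrict[OF joint_indep AB]) auto
  interpret D: prob_space "distr M ?P (block B)" by (rule prob_space_distr[OF U])
  have sets: "sets (distr M ?Q (block A) \<Otimes>\<^sub>M distr M ?P (block B)) = sets (?Q \<Otimes>\<^sub>M ?P)"
    by (rule sets_pair_measure_cong) auto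
  have F': "F \<in> borel_measurable (distr M ?Q (block A) \<Otimes>\<^sub>M distr M ?P (block B))"
    using F by (simp only: measurable_cong_sets[OF sets refl])
  have "(\<integral>\<^sup>+ \<omega>. F (block A \<omega>, block B \<omega>) \<partial>M)
      = (\<integral>\<^sup>+ z. F z \<partial>distr M (?Q \<Otimes>\<^sub>M ?P) (\<lambda>\<omega>. (block A \<omega>, block B \<omega>)))"
    using U V F by (subst nn_integral_distr) auto
  also have "distr M (?Q \<Otimes>\<^sub>M ?P) (\<lambda>\<omega>. (block A \<omega>, block B \<omega>)) = distr M ?Q (block A) \<Otimes>\<^sub>M distr M ?P (block B)"
    using indep_var_distribution_eq[THEN iffD1, OF indep] by simp
  also have "(\<integral>\<^sup>+ z. F z \<partial>\<dots>) = (\<integral>\<^sup>+ y. \<integral>\<^sup>+ x. F (y, x) \<partial>distr M ?P (block B) \<partial>distr M ?Q (block A))"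
    by (rule D.nn_integral_fst[OF F', symmetric])
  also have "\<dots> = (\<integral>\<^sup>+ \<omega>. \<integral>\<^sup>+ x. F (block A \<omega>, x) \<partial>distr M ?P (block B) \<partial>M)"
    by (rule nn_integral_distr[OF V]) (use D.borel_measurable_nn_integral_fst[OF F'] in simp)
  also have "\<dots> = (\<integral>\<^sup>+ \<omega>. \<integral>\<^sup>+ \<omega>'. F (block A \<omega>, block B \<omega>') \<partial>M \<partial>M)"
  proof (rule nn_integral_cong)
    fix \<omega> assume "\<omega> \<in> space M"
    hence "block A \<omega> \<in> space ?Q" using measurable_space[OF V] by blast
    hence "(\<lambda>x. F (block A \<omega>, x)) \<in> borel_measurable ?P"
      by (intro measurable_compose[OF measurable_Pair1' F])
    thus "(\<integral>\<^sup>+ x. F (block A \<omega>, x) \<partial>distr M ?P (block B)) = (\<integral>\<^sup>+ \<omega>'. F (block A \<omega>, block B \<omega>') \<partial>M)"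
      using U by (subst nn_integral_distr) auto
  qed
  finally show ?thesis .
qed

lemma jumps_positive:
  assumes supp: "set_pmf \<mu> \<subseteq> {1..}"
  shows "AE \<omega> in M. \<forall>i. 1 \<le> R i \<omega>"
proof (subst AE_all_countable, intro allI)
  fix i
  have "AE r in distr M (count_space UNIV) (R i). 1 \<le> r"
    unfolding R_law using supp by (auto simp: AE_measure_pmf_iff)
  thus "AE \<omega> in M. 1 \<le> R i \<omega>" by (subst (asm) AE_distr_iff) auto
qed

lemma meets_event [measurable]: "Measurable.pred M (\<lambda>\<omega>. meets (\<lambda>k. R k \<omega>) N a b)"
  by (rule meets_measurable[of "max a b"]) auto

text \<open>For \<open>b < a\<close> the first step uses the jump at \<open>a\<close>, and the remaining steps use jumps at vertices below
  \<open>a\<close> only. These two families are independent, so the probability is an average over the jump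
  at \<open>a\<close>. The result depends on \<open>\<bar>a - b\<bar>\<close> only, which is the stationarity of the graph.\<close>
lemma prob_meets:
  assumes supp: "set_pmf \<mu> \<subseteq> {1..}"
  shows "prob {\<omega> \<in> space M. meets (\<lambda>k. R k \<omega>) N a b} = meet_within \<mu> N (nat \<bar>a - b\<bar>)"
proof (induction N arbitrary: a b)
  case 0
  show ?case by (cases "a = b") (auto simp: prob_space)
next
  case (Suc N)
  have main: "prob {\<omega> \<in> space M. meets (\<lambda>k. R k \<omega>) (Suc N) a b} = meet_within \<mu> (Suc N) (nat \<bar>a - b\<bar>)"
    if ba: "b < a" for a b
  proof -
    let ?A = "{Inl a} :: (int + int) set" and ?B = "Inl ` {..<a} :: (int + int) set"
    let ?Q = "PiM ?A (\<lambda>_. borel :: real measure)" and ?P = "PiM ?B (\<lambda>_. borel :: real measure)"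
    define X where "X k x = nat \<lfloor>x (Inl k :: int + int) :: real\<rfloor>" for k :: int and x
    \<comment> \<open>without a positive jump the next state would again contain the vertex \<open>a\<close>; this is a null event\<close>
    define S where "S = {z \<in> space (?Q \<Otimes>\<^sub>M ?P). 1 \<le> X a (fst z) \<and> meets (\<lambda>k. X k (snd z)) N (a - int (X a (fst z))) b}"
    have X: "X k \<in> ?P \<rightarrow>\<^sub>M count_space UNIV" if "k \<le> a - 1" for k
    proof -
      have "(Inl k :: int + int) \<in> ?B" using that by auto
      thus ?thesis unfolding X_def by measurable
    qed
    have XQ: "X a \<in> ?Q \<rightarrow>\<^sub>M count_space UNIV"
      unfolding X_def by measurable
    have X_block: "X k (block ?B \<omega>) = R k \<omega>" "X a (block ?A \<omega>) = R a \<omega>" if "k \<le> a - 1" for k \<omega>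
      using that by (auto simp: X_def block_def joint_def)
    have meets_block: "meets (\<lambda>k. X k (block ?B \<omega>)) N (a - int r) b = meets (\<lambda>k. R k \<omega>) N (a - int r) b" if "1 \<le> r" for r \<omega>
      by (rule meets_cong[of "a - 1"]) (use that ba X_block in auto)
    have S: "S \<in> sets (?Q \<Otimes>\<^sub>M ?P)"
      unfolding S_def
    proof (rule predE)
      show "Measurable.pred (?Q \<Otimes>\<^sub>M ?P) (\<lambda>z. 1 \<le> X a (fst z) \<and> meets (\<lambda>k. X k (snd z)) N (a - int (X a (fst z))) b)"
      proof (rule measurable_compose_countable[where g = "\<lambda>z. X a (fst z)"
            and f = "\<lambda>r z. 1 \<le> r \<and> meets (\<lambda>k. X k (snd z)) N (a - int r) b"])
        fix r :: nat
        have "Measurable.pred ?P (\<lambda>x. meets (\<lambda>k. X k x) N (a - int r) b)" if "1 \<le> r"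
          by (rule meets_measurable[of "a - 1"]) (use that ba X in auto)
        thus "Measurable.pred (?Q \<Otimes>\<^sub>M ?P) (\<lambda>z. 1 \<le> r \<and> meets (\<lambda>k. X k (snd z)) N (a - int r) b)"
          by (cases "1 \<le> r") (auto intro: measurable_compose[OF measurable_snd])
      qed (rule measurable_compose[OF measurable_fst XQ])
    qed
    have in_S: "(block ?A \<omega>, block ?B \<omega>') \<in> S \<longleftrightarrow> meets (\<lambda>k. R k \<omega>') N (a - int (R a \<omega>)) b"
      if "\<omega> \<in> space M" "\<omega>' \<in> space M" "1 \<le> R a \<omega>" for \<omega> \<omega>'
    proof -
      have "block ?A \<omega> \<in> space ?Q" "block ?B \<omega>' \<in> space ?P"
        using measurable_space[OF block_measurable] that by blast+
      thus ?thesis using that X_block(2)[of "a - 1"] meets_block[of "R a \<omega>" \<omega>'] by (simp add: S_def space_pair_measure)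
    qed
    have "emeasure M {\<omega> \<in> space M. meets (\<lambda>k. R k \<omega>) (Suc N) a b}
        = (\<integral>\<^sup>+ \<omega>. indicator {\<omega> \<in> space M. meets (\<lambda>k. R k \<omega>) (Suc N) a b} \<omega> \<partial>M)"
      by (rule nn_integral_indicator[symmetric]) measurable
    also have "\<dots> = (\<integral>\<^sup>+ \<omega>. indicator S (block ?A \<omega>, block ?B \<omega>) \<partial>M)"
    proof (rule nn_integral_cong_AE)
      show "AE \<omega> in M. indicator {\<omega> \<in> space M. meets (\<lambda>k. R k \<omega>) (Suc N) a b} \<omega>
          = (indicator S (block ?A \<omega>, block ?B \<omega>) :: ennreal)"
        using jumps_positive[OF supp] AE_space
        by eventually_elim (use ba in \<open>simp add: indicator_def in_S\<close>)
    qed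
    also have "\<dots> = (\<integral>\<^sup>+ \<omega>. \<integral>\<^sup>+ \<omega>'. indicator S (block ?A \<omega>, block ?B \<omega>') \<partial>M \<partial>M)"
      by (rule nn_integral_disjoint_blocks) (use S in auto)
    also have "\<dots> = (\<integral>\<^sup>+ \<omega>. ennreal (meet_within \<mu> N (nat \<bar>int (nat \<bar>a - b\<bar>) - int (R a \<omega>)\<bar>)) \<partial>M)"
    proof (rule nn_integral_cong_AE)
      show "AE \<omega> in M. (\<integral>\<^sup>+ \<omega>'. indicator S (block ?A \<omega>, block ?B \<omega>') \<partial>M)
          = ennreal (meet_within \<mu> N (nat \<bar>int (nat \<bar>a - b\<bar>) - int (R a \<omega>)\<bar>))"
        using jumps_positive[OF supp] AE_space
      proof eventually_elim
        case (elim \<omega>)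
        let ?E = "{\<omega>' \<in> space M. meets (\<lambda>k. R k \<omega>') N (a - int (R a \<omega>)) b}"
        have "(\<integral>\<^sup>+ \<omega>'. indicator S (block ?A \<omega>, block ?B \<omega>') \<partial>M) = (\<integral>\<^sup>+ \<omega>'. indicator ?E \<omega>' \<partial>M)"
          by (rule nn_integral_cong) (use elim in \<open>simp add: indicator_def in_S\<close>)
        also have "\<dots> = emeasure M ?E" by (rule nn_integral_indicator) measurable
        also have "\<dots> = ennreal (meet_within \<mu> N (nat \<bar>a - int (R a \<omega>) - b\<bar>))"
          by (simp add: emeasure_eq_measure Suc.IH)
        also have "\<bar>a - int (R a \<omega>) - b\<bar> = \<bar>int (nat \<bar>a - b\<bar>) - int (R a \<omega>)\<bar>" using ba by simp
        finally show ?case .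
      qed
    qed
    also have "\<dots> = (\<integral>\<^sup>+ r. ennreal (meet_within \<mu> N (nat \<bar>int (nat \<bar>a - b\<bar>) - int r\<bar>)) \<partial>measure_pmf \<mu>)"
      unfolding R_law[of a, symmetric] by (subst nn_integral_distr) auto
    also have "\<dots> = ennreal (measure_pmf.expectation \<mu> (\<lambda>r. meet_within \<mu> N (nat \<bar>int (nat \<bar>a - b\<bar>) - int r\<bar>)))"
      by (rule nn_integral_eq_integral[OF meet_within_integrable]) (simp add: meet_within_bounds)
    also have "\<dots> = ennreal (meet_within \<mu> (Suc N) (nat \<bar>a - b\<bar>))" using ba by simp
    finally show ?thesis by (simp add: emeasure_eq_measure meet_within_bounds del: meets.simps meet_within.simps)
  qed
  show ?case
  proof (cases a b rule: linorder_cases)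
    case less
    show ?thesis using main[OF less] by (simp only: meets_sym[of _ _ b a] abs_minus_commute[of b a])
  next
    case equal
    then show ?thesis by (simp add: prob_space)
  next
    case greater
    show ?thesis by (rule main[OF greater])
  qed
qed

lemma prob_same_representative:
  assumes supp: "set_pmf \<mu> \<subseteq> {1..}" and pos: "\<And>n. 0 < tail \<mu> n"
    and sq: "summable (\<lambda>m. (renewal_seq \<mu> m)\<^sup>2)"
    and ev: "{\<omega> \<in> space M. rep (\<lambda>k. R k \<omega>) i = rep (\<lambda>k. R k \<omega>) j} \<in> events"
  shows "prob {\<omega> \<in> space M. rep (\<lambda>k. R k \<omega>) i = rep (\<lambda>k. R k \<omega>) j}
     = green \<mu> (nat \<bar>i - j\<bar>) / green \<mu> 0"
proof -
  let ?E = "\<lambda>N. {\<omega> \<in> space M. meets (\<lambda>k. R k \<omega>) N i j}"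
  have "(\<lambda>N. prob (?E N)) \<longlonglongrightarrow> prob (\<Union>N. ?E N)"
    by (rule finite_Lim_measure_incseq) (auto intro!: incseq_SucI meets_Suc simp del: meets.simps)
  moreover have "(\<lambda>N. prob (?E N)) \<longlonglongrightarrow> green \<mu> (nat \<bar>i - j\<bar>) / green \<mu> 0"
    unfolding prob_meets[OF supp] by (rule meet_within_tendsto_green[OF supp pos sq])
  ultimately have "prob (\<Union>N. ?E N) = green \<mu> (nat \<bar>i - j\<bar>) / green \<mu> 0" by (rule LIMSEQ_unique)
  moreover have "prob (\<Union>N. ?E N) = prob {\<omega> \<in> space M. rep (\<lambda>k. R k \<omega>) i = rep (\<lambda>k. R k \<omega>) j}"
  proof (rule finite_measure_eq_AE)
    show "AE \<omega> in M. (\<omega> \<in> (\<Union>N. ?E N)) = (\<omega> \<in> {\<omega> \<in> space M. rep (\<lambda>k. R k \<omega>) i = rep (\<lambda>k. R k \<omega>) j})"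
      using jumps_positive[OF supp]
      by eventually_elim (auto simp: representative_eq_iff[OF representative] connected_iff_meets)
  qed (use ev in auto)
  ultimately show ?thesis by simp
qed


lemma representatives_measurable [measurable]:
  "(\<lambda>\<omega>. rep (\<lambda>k. R k \<omega>) i) \<in> M \<rightarrow>\<^sub>M count_space UNIV"
proof -
  have "(\<lambda>r. rep r i) \<in> Pi\<^sub>M UNIV (\<lambda>_. count_space UNIV) \<rightarrow>\<^sub>M count_space UNIV"
    using representative by (simp add: component_representative_def)
  moreover have "(\<lambda>\<omega> k. R k \<omega>) \<in> M \<rightarrow>\<^sub>M Pi\<^sub>M UNIV (\<lambda>_. count_space UNIV)"
    by (rule measurable_abs_UNIV) (rule R_measurable)
  ultimately show ?thesis by (rule measurable_compose[rotated])
qed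

lemma vertex_colour_measurable [measurable]: "vertex_colour R rep C i \<in> borel_measurable M"
  unfolding vertex_colour_def
  by (rule measurable_compose_countable[OF C_measurable representatives_measurable])

text \<open>The representatives are functions of the graph, which is independent of the colours; so the colours
  may be replaced by an independent copy. Stating this for nonnegative integrands avoids
  integrability conditions; signed products follow by polarisation.\<close>
lemma graph_colour_fubini:
  assumes f: "\<And>a b. (\<lambda>c. f a b c) \<in> borel_measurable (PiM UNIV (\<lambda>_::int. borel :: real measure))"
  shows "(\<integral>\<^sup>+ \<omega>. f (rep (\<lambda>k. R k \<omega>) i) (rep (\<lambda>k. R k \<omega>) j) (\<lambda>l. C l \<omega>) \<partial>M)
    = (\<integral>\<^sup>+ \<omega>. (\<integral>\<^sup>+ \<omega>'. f (rep (\<lambda>k. R k \<omega>) i) (rep (\<lambda>k. R k \<omega>) j) (\<lambda>l. C l \<omega>') \<partial>M) \<partial>M)"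
proof -
  let ?A = "range Inl :: (int + int) set" and ?B = "range Inr :: (int + int) set"
  let ?Q = "PiM ?A (\<lambda>_. borel :: real measure)" and ?P = "PiM ?B (\<lambda>_. borel :: real measure)"
  define \<rho> where "\<rho> l y = rep (\<lambda>k. nat \<lfloor>y (Inl k :: int + int) :: real\<rfloor>) l" for l y
  define \<gamma> where "\<gamma> x = (\<lambda>k. x (Inr k :: int + int) :: real)" for x
  have block: "\<rho> l (block ?A \<omega>) = rep (\<lambda>k. R k \<omega>) l" "\<gamma> (block ?B \<omega>) = (\<lambda>k. C k \<omega>)" for l \<omega>
    by (simp_all add: \<rho>_def \<gamma>_def block_def joint_def)
  have \<rho>: "\<rho> l \<in> ?Q \<rightarrow>\<^sub>M count_space UNIV" for l
  proof -
    have "(\<lambda>r. rep r l) \<in> Pi\<^sub>M UNIV (\<lambda>_. count_space UNIV) \<rightarrow>\<^sub>M count_space UNIV"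
      using representative by (simp add: component_representative_def)
    moreover have "(\<lambda>y k. nat \<lfloor>y (Inl k :: int + int) :: real\<rfloor>) \<in> ?Q \<rightarrow>\<^sub>M Pi\<^sub>M UNIV (\<lambda>_::int. count_space UNIV)"
    proof (rule measurable_abs_UNIV)
      fix k :: int
      have [measurable]: "(Inl k :: int + int) \<in> ?A" by simp
      show "(\<lambda>y. nat \<lfloor>y (Inl k :: int + int) :: real\<rfloor>) \<in> ?Q \<rightarrow>\<^sub>M count_space UNIV" by measurable
    qed
    ultimately show ?thesis unfolding \<rho>_def by (rule measurable_compose[rotated])
  qed
  have \<gamma>: "\<gamma> \<in> ?P \<rightarrow>\<^sub>M PiM UNIV (\<lambda>_. borel)"
    unfolding \<gamma>_def by (rule measurable_abs_UNIV) (rule measurable_component_singleton, simp)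
  define F where "F z = f (\<rho> i (fst z)) (\<rho> j (fst z)) (\<gamma> (snd z))" for z
  have F: "F \<in> borel_measurable (?Q \<Otimes>\<^sub>M ?P)"
    unfolding F_def
  proof (rule measurable_compose_countable[OF measurable_compose_countable])
    fix a b
    show "(\<lambda>z. f a b (\<gamma> (snd z))) \<in> borel_measurable (?Q \<Otimes>\<^sub>M ?P)"
      by (rule measurable_compose[OF measurable_compose[OF measurable_snd \<gamma>] f])
  qed (rule measurable_compose[OF measurable_fst \<rho>])+
  have "?A \<inter> ?B = {}" by auto
  from nn_integral_disjoint_blocks[OF this F] show ?thesis by (simp add: F_def block)
qed

end

section \<open>Second moments of the coloured sums\<close>

text \<open>The positivity of the tails and the square summability of the renewal sequence are consequences of
  regular variation. Taking them as assumptions separates the second moments from the asymptotics of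
  \<open>\<mu>\<close>.\<close>
locale square_integrable_colours = coloured_graph +
  assumes jumps_pos: "set_pmf \<mu> \<subseteq> {1..}" and tail_gt_0: "\<And>n. 0 < tail \<mu> n"
    and renewal_l2: "summable (\<lambda>m. (renewal_seq \<mu> m)\<^sup>2)"
    and colour_square_integrable: "integrable colour_law (\<lambda>x. x\<^sup>2)"
    and colour_mean_0: "(\<integral>x. x \<partial>colour_law) = 0"
begin

abbreviation colour_variance :: real where
  "colour_variance \<equiv> \<integral>x. x\<^sup>2 \<partial>colour_law"

lemma colour_moments:
  shows "integrable M (C j)" "integrable M (\<lambda>\<omega>. (C j \<omega>)\<^sup>2)"
    and "expectation (C j) = 0" "expectation (\<lambda>\<omega>. (C j \<omega>)\<^sup>2) = colour_variance"
proof -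
  show sq: "integrable M (\<lambda>\<omega>. (C j \<omega>)\<^sup>2)"
    using colour_square_integrable unfolding C_law[of j, symmetric] by (subst (asm) integrable_distr_eq) auto
  show "integrable M (C j)"
    by (rule square_integrable_imp_integrable[OF C_measurable sq])
  show "expectation (\<lambda>\<omega>. (C j \<omega>)\<^sup>2) = colour_variance"
    unfolding C_law[of j, symmetric] by (subst integral_distr) auto
  show "expectation (C j) = 0"
    using colour_mean_0 unfolding C_law[of j, symmetric] by (subst (asm) integral_distr) auto
qed

lemma colour_pair_moments:
  assumes "a \<noteq> b"
  shows "integrable M (\<lambda>\<omega>. C a \<omega> * C b \<omega>)" "expectation (\<lambda>\<omega>. C a \<omega> * C b \<omega>) = 0"
proof -
  let ?I = "{Inr a, Inr b} :: (int + int) set"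
  have ind: "indep_vars (\<lambda>_. borel) joint ?I" by (rule indep_vars_subset[OF joint_indep]) simp
  have int: "integrable M (joint l)" if "l \<in> ?I" for l
    using that colour_moments(1) by (auto simp: joint_def)
  have prod: "(\<Prod>l\<in>?I. joint l \<omega>) = C a \<omega> * C b \<omega>" for \<omega>
    using assms by (simp add: joint_def)
  show "integrable M (\<lambda>\<omega>. C a \<omega> * C b \<omega>)"
    using indep_vars_integrable[OF _ ind int] by (simp add: prod)
  show "expectation (\<lambda>\<omega>. C a \<omega> * C b \<omega>) = 0"
    using indep_vars_lebesgue_integral[OF _ ind int] assms
    by (simp add: prod) (simp add: joint_def colour_moments(3))
qed

text \<open>The two colours are equal when \<open>a = b\<close>, and otherwise uncorrelated.\<close>
lemma colour_sum_second_moment: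
  "(\<integral>\<^sup>+ \<omega>. ennreal ((C a \<omega> + C b \<omega>)\<^sup>2) \<partial>M)
    = ennreal (2 * colour_variance + 2 * colour_variance * (if a = b then 1 else 0))"
proof -
  have expand: "(C a \<omega> + C b \<omega>)\<^sup>2 = (C a \<omega>)\<^sup>2 + (C b \<omega>)\<^sup>2 + 2 * (C a \<omega> * C b \<omega>)" for \<omega>
    by (simp add: power2_sum)
  have prod: "integrable M (\<lambda>\<omega>. C a \<omega> * C b \<omega>)
      \<and> expectation (\<lambda>\<omega>. C a \<omega> * C b \<omega>) = colour_variance * (if a = b then 1 else 0)"
    using colour_pair_moments[of a b] colour_moments(2,4)[of b] by (cases "a = b") (auto simp: power2_eq_square)
  have "(\<integral>\<^sup>+ \<omega>. ennreal ((C a \<omega> + C b \<omega>)\<^sup>2) \<partial>M) = ennreal (expectation (\<lambda>\<omega>. (C a \<omega> + C b \<omega>)\<^sup>2))"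
  proof (rule nn_integral_eq_integral)
    show "integrable M (\<lambda>\<omega>. (C a \<omega> + C b \<omega>)\<^sup>2)"
      unfolding expand using prod colour_moments(2) by simp
  qed simp
  also have "expectation (\<lambda>\<omega>. (C a \<omega> + C b \<omega>)\<^sup>2) = 2 * colour_variance + 2 * colour_variance * (if a = b then 1 else 0)"
    unfolding expand using prod colour_moments(2,4) by simp
  finally show ?thesis .
qed

abbreviation colouring :: "int \<Rightarrow> 'a \<Rightarrow> real" where
  "colouring \<equiv> vertex_colour R rep C"

lemma colour_variance_nonneg: "0 \<le> colour_variance"
  by simp

lemma colouring_second_moment:
  "integrable M (\<lambda>\<omega>. (colouring i \<omega>)\<^sup>2)" "expectation (\<lambda>\<omega>. (colouring i \<omega>)\<^sup>2) = colour_variance"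
proof -
  have "(\<integral>\<^sup>+ \<omega>. ennreal ((colouring i \<omega>)\<^sup>2) \<partial>M)
      = (\<integral>\<^sup>+ \<omega>. \<integral>\<^sup>+ \<omega>'. ennreal ((C (rep (\<lambda>k. R k \<omega>) i) \<omega>')\<^sup>2) \<partial>M \<partial>M)"
    unfolding vertex_colour_def
    by (rule graph_colour_fubini[where f = "\<lambda>a b c. ennreal ((c a)\<^sup>2)"]) measurable
  also have "\<dots> = (\<integral>\<^sup>+ \<omega>. ennreal colour_variance \<partial>M)"
    by (intro nn_integral_cong, subst nn_integral_eq_integral) (auto simp: colour_moments)
  also have "\<dots> = ennreal colour_variance" by (simp add: emeasure_space_1)
  finally have hb: "has_bochner_integral M (\<lambda>\<omega>. (colouring i \<omega>)\<^sup>2) colour_variance"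
    by (intro has_bochner_integral_nn_integral) auto
  show "integrable M (\<lambda>\<omega>. (colouring i \<omega>)\<^sup>2)" using hb by (rule integrable.intros)
  show "expectation (\<lambda>\<omega>. (colouring i \<omega>)\<^sup>2) = colour_variance" using hb by (rule has_bochner_integral_integral_eq)
qed

lemma colouring_integrable: "integrable M (colouring i)"
  by (rule square_integrable_imp_integrable[OF vertex_colour_measurable colouring_second_moment(1)])

text \<open>The mean is read off from the second moment of the shifted colour, so that only nonnegative
  integrands meet Fubini's theorem.\<close>
lemma colouring_mean_0: "expectation (colouring i) = 0"
proof -
  have "(\<integral>\<^sup>+ \<omega>. ennreal ((colouring i \<omega> + 1)\<^sup>2) \<partial>M)
      = (\<integral>\<^sup>+ \<omega>. \<integral>\<^sup>+ \<omega>'. ennreal ((C (rep (\<lambda>k. R k \<omega>) i) \<omega>' + 1)\<^sup>2) \<partial>M \<partial>M)"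
    unfolding vertex_colour_def
    by (rule graph_colour_fubini[where f = "\<lambda>a b c. ennreal ((c a + 1)\<^sup>2)"]) measurable
  also have "\<dots> = (\<integral>\<^sup>+ \<omega>. ennreal (colour_variance + 1) \<partial>M)"
  proof (intro nn_integral_cong)
    fix \<omega>
    have expand: "(C a \<omega>' + 1)\<^sup>2 = (C a \<omega>')\<^sup>2 + 2 * C a \<omega>' + 1" for a \<omega>' by (simp add: power2_sum)
    have "(\<integral>\<^sup>+ \<omega>'. ennreal ((C a \<omega>' + 1)\<^sup>2) \<partial>M) = ennreal (expectation (\<lambda>\<omega>'. (C a \<omega>' + 1)\<^sup>2))" for a
    proof (rule nn_integral_eq_integral)
      show "integrable M (\<lambda>\<omega>'. (C a \<omega>' + 1)\<^sup>2)"
        unfolding expand using colour_moments by simp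
    qed simp
    also have "expectation (\<lambda>\<omega>'. (C a \<omega>' + 1)\<^sup>2) = colour_variance + 1" for a
      unfolding expand using colour_moments by (simp add: prob_space)
    finally show "(\<integral>\<^sup>+ \<omega>'. ennreal ((C (rep (\<lambda>k. R k \<omega>) i) \<omega>' + 1)\<^sup>2) \<partial>M) = ennreal (colour_variance + 1)" .
  qed
  also have "\<dots> = ennreal (colour_variance + 1)" by (simp add: emeasure_space_1)
  finally have "has_bochner_integral M (\<lambda>\<omega>. (colouring i \<omega> + 1)\<^sup>2) (colour_variance + 1)"
    using colour_variance_nonneg by (intro has_bochner_integral_nn_integral) auto
  hence "expectation (\<lambda>\<omega>. (colouring i \<omega> + 1)\<^sup>2) = colour_variance + 1"
    by (rule has_bochner_integral_integral_eq)
  moreover have "(colouring i \<omega> + 1)\<^sup>2 = (colouring i \<omega>)\<^sup>2 + 2 * colouring i \<omega> + 1" for \<omega>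
    by (simp add: power2_sum)
  ultimately show ?thesis
    using colouring_second_moment[of i] colouring_integrable[of i] by (simp add: prob_space)
qed

text \<open>Polarisation: given the graph, the second moment of the sum of two colours is four times the variance
  on the event of a common component and twice the variance otherwise.\<close>
lemma colouring_covariance:
  "integrable M (\<lambda>\<omega>. colouring i \<omega> * colouring j \<omega>)"
  "expectation (\<lambda>\<omega>. colouring i \<omega> * colouring j \<omega>) = colour_variance * (green \<mu> (nat \<bar>i - j\<bar>) / green \<mu> 0)"
proof -
  define same where "same = {\<omega> \<in> space M. rep (\<lambda>k. R k \<omega>) i = rep (\<lambda>k. R k \<omega>) j}"
  have ev: "same \<in> events" unfolding same_def by measurable
  define P where "P = prob same"
  have "(\<integral>\<^sup>+ \<omega>. ennreal ((colouring i \<omega> + colouring j \<omega>)\<^sup>2) \<partial>M)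
      = (\<integral>\<^sup>+ \<omega>. \<integral>\<^sup>+ \<omega>'. ennreal ((C (rep (\<lambda>k. R k \<omega>) i) \<omega>' + C (rep (\<lambda>k. R k \<omega>) j) \<omega>')\<^sup>2) \<partial>M \<partial>M)"
    unfolding vertex_colour_def
    by (rule graph_colour_fubini[where f = "\<lambda>a b c. ennreal ((c a + c b)\<^sup>2)"]) measurable
  also have "\<dots> = (\<integral>\<^sup>+ \<omega>. ennreal (2 * colour_variance + 2 * colour_variance * indicator same \<omega>) \<partial>M)"
    unfolding colour_sum_second_moment by (intro nn_integral_cong) (auto simp: indicator_def same_def)
  also have "\<dots> = ennreal (expectation (\<lambda>\<omega>. 2 * colour_variance + 2 * colour_variance * indicator same \<omega>))"
  proof (rule nn_integral_eq_integral)
    show "integrable M (\<lambda>\<omega>. 2 * colour_variance + 2 * colour_variance * indicator same \<omega>)"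
      using ev by (intro Bochner_Integration.integrable_add integrable_mult_right integrable_const integrable_real_indicator)
                  (auto simp: emeasure_eq_measure)
  qed simp
  also have "expectation (\<lambda>\<omega>. 2 * colour_variance + 2 * colour_variance * indicator same \<omega>)
      = 2 * colour_variance + 2 * colour_variance * P"
  proof -
    have "integrable M (\<lambda>\<omega>. 2 * colour_variance * indicator same \<omega>)"
      using ev by (intro integrable_mult_right integrable_real_indicator) (auto simp: emeasure_eq_measure)
    from Bochner_Integration.integral_add[OF integrable_const this] show ?thesis
      using ev by (simp add: P_def prob_space)
  qed
  finally have hb: "has_bochner_integral M (\<lambda>\<omega>. (colouring i \<omega> + colouring j \<omega>)\<^sup>2)
      (2 * colour_variance + 2 * colour_variance * P)"
    by (intro has_bochner_integral_nn_integral) (auto simp: P_def)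
  have eq: "colouring i \<omega> * colouring j \<omega>
      = ((colouring i \<omega> + colouring j \<omega>)\<^sup>2 - (colouring i \<omega>)\<^sup>2 - (colouring j \<omega>)\<^sup>2) / 2" for \<omega>
    by (simp add: power2_sum)
  have int: "integrable M (\<lambda>\<omega>. (colouring i \<omega> + colouring j \<omega>)\<^sup>2)" using hb by (rule integrable.intros)
  show "integrable M (\<lambda>\<omega>. colouring i \<omega> * colouring j \<omega>)"
    unfolding eq using int colouring_second_moment(1) by simp
  have "expectation (\<lambda>\<omega>. colouring i \<omega> * colouring j \<omega>) = colour_variance * P"
    unfolding eq using int colouring_second_moment has_bochner_integral_integral_eq[OF hb] by simp
  also have "P = green \<mu> (nat \<bar>i - j\<bar>) / green \<mu> 0"
    unfolding P_def by (rule prob_same_representative[OF jumps_pos tail_gt_0 renewal_l2 ev[unfolded same_def], folded same_def])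
  finally show "expectation (\<lambda>\<omega>. colouring i \<omega> * colouring j \<omega>) = colour_variance * (green \<mu> (nat \<bar>i - j\<bar>) / green \<mu> 0)" .
qed

lemma increment_second_moment:
  fixes k m :: nat
  shows "integrable M (\<lambda>\<omega>. (partial_sum colouring (k + m) \<omega> - partial_sum colouring k \<omega>)\<^sup>2)"
    and "expectation (\<lambda>\<omega>. (partial_sum colouring (k + m) \<omega> - partial_sum colouring k \<omega>)\<^sup>2)
      = colour_variance / green \<mu> 0 * pair_sum (green \<mu>) m"
proof -
  define c where "c i = colouring (int (Suc (k + i)))" for i
  have incr: "partial_sum colouring (k + m) \<omega> - partial_sum colouring k \<omega> = (\<Sum>i<m. c i \<omega>)" for \<omega>
    by (induction m) (simp_all add: partial_sum_def c_def)
  have sq: "(\<Sum>i<m. c i \<omega>)\<^sup>2 = (\<Sum>i<m. \<Sum>j<m. c i \<omega> * c j \<omega>)" for \<omega>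
    by (simp add: power2_eq_square sum_product)
  have int: "integrable M (\<lambda>\<omega>. c i \<omega> * c j \<omega>)" for i j
    unfolding c_def by (rule colouring_covariance(1))
  have cov: "expectation (\<lambda>\<omega>. c i \<omega> * c j \<omega>) = colour_variance * (green \<mu> (nat \<bar>int i - int j\<bar>) / green \<mu> 0)" for i j
    unfolding c_def colouring_covariance(2) by simp
  show "integrable M (\<lambda>\<omega>. (partial_sum colouring (k + m) \<omega> - partial_sum colouring k \<omega>)\<^sup>2)"
    unfolding incr sq using int by simp
  have "expectation (\<lambda>\<omega>. (\<Sum>i<m. \<Sum>j<m. c i \<omega> * c j \<omega>)) = (\<Sum>i<m. \<Sum>j<m. colour_variance * (green \<mu> (nat \<bar>int i - int j\<bar>) / green \<mu> 0))"
    using int cov by (simp add: Bochner_Integration.integral_sum)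
  also have "\<dots> = colour_variance / green \<mu> 0 * pair_sum (green \<mu>) m"
    by (simp add: pair_sum_def sum_distrib_left)
  finally show "expectation (\<lambda>\<omega>. (partial_sum colouring (k + m) \<omega> - partial_sum colouring k \<omega>)\<^sup>2)
      = colour_variance / green \<mu> 0 * pair_sum (green \<mu>) m"
    unfolding incr sq .
qed

lemma std_deviation_partial_sum:
  "(std_deviation M (partial_sum colouring n))\<^sup>2 = colour_variance / green \<mu> 0 * pair_sum (green \<mu>) n"
proof -
  have "expectation (partial_sum colouring n) = 0"
    unfolding partial_sum_def by (simp add: Bochner_Integration.integral_sum colouring_integrable colouring_mean_0)
  moreover have "partial_sum colouring 0 \<omega> = 0" for \<omega> by (simp add: partial_sum_def)
  ultimately have "variance (partial_sum colouring n) = colour_variance / green \<mu> 0 * pair_sum (green \<mu>) n"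
    using increment_second_moment(2)[of 0 n] by simp
  moreover have "0 \<le> variance (partial_sum colouring n)" by (rule variance_positive)
  ultimately show ?thesis unfolding std_deviation_def by simp
qed

lemma partial_sum_measurable [measurable]: "partial_sum colouring n \<in> borel_measurable M"
  unfolding partial_sum_def by measurable

end

section \<open>Chaining and compact sets of paths\<close>

text \<open>The event of Kolmogorov's chaining argument. The scale \<open>\<rho> ^ k\<close> corresponds to a Hoelder condition
  with exponent \<open>- log 2 \<rho>\<close>.\<close>
definition dyadic_increments_bounded :: "real \<Rightarrow> real \<Rightarrow> real \<Rightarrow> (real \<Rightarrow> real) \<Rightarrow> bool" where
  "dyadic_increments_bounded T B \<rho> f \<longleftrightarrow>
     (\<forall>k. \<forall>i<2 ^ k. \<bar>f (T * (real i + 1) / 2 ^ k) - f (T * real i / 2 ^ k)\<bar> \<le> B * \<rho> ^ k)"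

lemma dyadic_point_mem:
  assumes "0 < T" "i < 2 ^ k"
  shows "T * (real i + 1) / 2 ^ k \<in> {0..T}" "T * real i / 2 ^ k \<in> {0..T}"
proof -
  have "real i + 1 \<le> real (2 ^ k)" using assms(2) by (metis Suc_leI of_nat_Suc of_nat_le_iff add.commute)
  hence "real i + 1 \<le> 2 ^ k" by simp
  thus "T * (real i + 1) / 2 ^ k \<in> {0..T}" "T * real i / 2 ^ k \<in> {0..T}"
    using assms by (auto simp: divide_le_eq)
qed

lemma dyadic_increments_bounded_cong:
  assumes "0 < T" "\<And>t. t \<in> {0..T} \<Longrightarrow> f t = g t"
  shows "dyadic_increments_bounded T B \<rho> f = dyadic_increments_bounded T B \<rho> g"
  unfolding dyadic_increments_bounded_def
  using assms(2)[OF dyadic_point_mem(1)[OF assms(1)]] assms(2)[OF dyadic_point_mem(2)[OF assms(1)]] by simp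

text \<open>Join \<open>s\<close> to its dyadic approximation of level \<open>k\<close> from below through the approximations of all higher
  levels. Consecutive ones are equal or the ends of one dyadic interval, so the increments are dominated
  by a geometric series.\<close>
lemma dyadic_chain_bound:
  assumes T: "0 < T" and B: "0 \<le> B" and \<rho>: "0 < \<rho>" "\<rho> < 1"
    and cont: "continuous_on {0..T} f" and f: "dyadic_increments_bounded T B \<rho> f"
    and s: "s \<in> {0..T}"
  shows "\<bar>f s - f (T * real (nat \<lfloor>s * 2 ^ k / T\<rfloor>) / 2 ^ k)\<bar> \<le> B * \<rho> ^ k / (1 - \<rho>)"
proof -
  define a where "a j = nat \<lfloor>s * 2 ^ j / T\<rfloor>" for j
  define p where "p j = T * real (a j) / 2 ^ j" for j
  have nn: "0 \<le> s * 2 ^ j / T" for j using s T by simp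
  have a: "real (a j) \<le> s * 2 ^ j / T" "s * 2 ^ j / T < real (a j) + 1" for j
    using nn[of j] unfolding a_def by (auto simp: of_nat_nat)
  have p: "p j \<le> s" "s < p j + T / 2 ^ j" for j
    using a[of j] T by (auto simp: p_def field_simps)
  have p0: "0 \<le> p j" for j using T by (simp add: p_def)
  have ale: "a j \<le> 2 ^ j" for j
  proof -
    have "s * 2 ^ j / T \<le> 2 ^ j" using s T by (simp add: field_simps)
    hence "real (a j) \<le> 2 ^ j" using a(1)[of j] by linarith
    thus ?thesis by simp
  qed
  have step: "\<bar>f (p (Suc j)) - f (p j)\<bar> \<le> B * \<rho> ^ Suc j" for j
  proof -
    have e: "s * 2 ^ Suc j / T = 2 * (s * 2 ^ j / T)" by simp
    have "real (2 * a j) < real (a (Suc j)) + 1" "real (a (Suc j)) < real (2 * a j) + 2"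
      using a[of j] a[of "Suc j"] unfolding e by auto
    hence "a (Suc j) = 2 * a j \<or> a (Suc j) = 2 * a j + 1" by linarith
    thus ?thesis
    proof
      assume "a (Suc j) = 2 * a j"
      hence "p (Suc j) = p j" by (simp add: p_def)
      thus ?thesis using B \<rho> by simp
    next
      assume eq: "a (Suc j) = 2 * a j + 1"
      have "2 * a j < 2 ^ Suc j" using ale[of "Suc j"] eq by simp
      hence "\<bar>f (T * (real (2 * a j) + 1) / 2 ^ Suc j) - f (T * real (2 * a j) / 2 ^ Suc j)\<bar> \<le> B * \<rho> ^ Suc j"
        using f unfolding dyadic_increments_bounded_def by blast
      moreover have "T * (real (2 * a j) + 1) / 2 ^ Suc j = p (Suc j)" by (simp add: p_def eq)
      moreover have "T * real (2 * a j) / 2 ^ Suc j = p j" by (simp add: p_def)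
      ultimately show ?thesis by simp
    qed
  qed
  have chain: "\<bar>f (p (k + m)) - f (p k)\<bar> \<le> B * (\<rho> ^ k - \<rho> ^ (k + m)) / (1 - \<rho>)" for m
  proof (induction m)
    case (Suc m)
    have "\<rho> ^ Suc (k + m) \<le> \<rho> ^ (k + m)" using \<rho> by (intro power_decreasing) auto
    hence "B * \<rho> ^ Suc (k + m) \<le> B * \<rho> ^ (k + m)" using B by (rule mult_left_mono)
    also have "B * \<rho> ^ (k + m) = B * (\<rho> ^ (k + m) - \<rho> ^ (k + Suc m)) / (1 - \<rho>)"
    proof -
      have "B * (\<rho> ^ (k + m) - \<rho> ^ (k + Suc m)) = B * \<rho> ^ (k + m) * (1 - \<rho>)" by (simp add: algebra_simps)
      thus ?thesis using \<rho> by (simp only: nonzero_eq_divide_eq)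
    qed
    finally have "B * \<rho> ^ Suc (k + m) \<le> B * (\<rho> ^ (k + m) - \<rho> ^ (k + Suc m)) / (1 - \<rho>)" .
    hence "\<bar>f (p (k + Suc m)) - f (p k)\<bar>
        \<le> B * (\<rho> ^ k - \<rho> ^ (k + m)) / (1 - \<rho>) + B * (\<rho> ^ (k + m) - \<rho> ^ (k + Suc m)) / (1 - \<rho>)"
      using Suc step[of "k + m"] by simp
    also have "\<dots> = B * (\<rho> ^ k - \<rho> ^ (k + Suc m)) / (1 - \<rho>)"
      by (simp add: add_divide_distrib[symmetric] algebra_simps)
    finally show ?case .
  qed simp
  have bound: "\<bar>f (p (k + m)) - f (p k)\<bar> \<le> B * \<rho> ^ k / (1 - \<rho>)" for m
  proof -
    have "B * (\<rho> ^ k - \<rho> ^ (k + m)) / (1 - \<rho>) \<le> B * \<rho> ^ k / (1 - \<rho>)"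
      using B \<rho> by (intro divide_right_mono mult_left_mono) auto
    with chain[of m] show ?thesis by linarith
  qed
  have "(\<lambda>j. p (k + j)) \<longlonglongrightarrow> s"
  proof (rule tendsto_sandwich)
    have "(\<lambda>j. (1 / 2 :: real) ^ (k + j)) \<longlonglongrightarrow> 0"
      using LIMSEQ_ignore_initial_segment[OF LIMSEQ_realpow_zero[of "1 / 2"], of k] by (simp add: add.commute)
    hence "(\<lambda>j. s - T * (1 / 2) ^ (k + j)) \<longlonglongrightarrow> s - T * 0" by (intro tendsto_intros)
    thus "(\<lambda>j. s - T * (1 / 2) ^ (k + j)) \<longlonglongrightarrow> s" by simp
    show "\<forall>\<^sub>F j in sequentially. s - T * (1 / 2) ^ (k + j) \<le> p (k + j)"
    proof (intro always_eventually allI)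
      fix j
      show "s - T * (1 / 2) ^ (k + j) \<le> p (k + j)"
        using p(2)[of "k + j"] by (simp add: power_one_over)
    qed
  qed (use p in auto)
  hence "(\<lambda>j. f (p (k + j))) \<longlonglongrightarrow> f s"
    by (rule continuous_on_tendsto_compose[OF cont]) (use s p0 order_trans[OF p(1)] in auto)
  hence "(\<lambda>j. \<bar>f (p (k + j)) - f (p k)\<bar>) \<longlonglongrightarrow> \<bar>f s - f (p k)\<bar>" by (intro tendsto_intros)
  hence "\<bar>f s - f (p k)\<bar> \<le> B * \<rho> ^ k / (1 - \<rho>)"
    by (rule LIMSEQ_le_const2) (use bound in auto)
  thus ?thesis by (simp add: p_def a_def)
qed

text \<open>The level-\<open>k\<close> approximations of two points at distance at most \<open>T / 2 ^ k\<close> coincide or are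
  neighbours.\<close>
lemma dyadic_modulus_of_continuity:
  assumes T: "0 < T" and B: "0 \<le> B" and \<rho>: "0 < \<rho>" "\<rho> < 1"
    and cont: "continuous_on {0..T} f" and f: "dyadic_increments_bounded T B \<rho> f"
    and s: "s \<in> {0..T}" "t \<in> {0..T}" and st: "\<bar>s - t\<bar> \<le> T / 2 ^ k"
  shows "\<bar>f s - f t\<bar> \<le> B * (1 + 2 / (1 - \<rho>)) * \<rho> ^ k"
proof -
  have le: "\<bar>f s - f t\<bar> \<le> B * (1 + 2 / (1 - \<rho>)) * \<rho> ^ k"
    if s: "s \<in> {0..T}" "t \<in> {0..T}" and st: "\<bar>s - t\<bar> \<le> T / 2 ^ k" and "s \<le> t" for s t
  proof -
    define a b where "a = nat \<lfloor>s * 2 ^ k / T\<rfloor>" and "b = nat \<lfloor>t * 2 ^ k / T\<rfloor>"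
    have nn: "0 \<le> s * 2 ^ k / T" "0 \<le> t * 2 ^ k / T" using s T by auto
    have a: "real a \<le> s * 2 ^ k / T" "s * 2 ^ k / T < real a + 1"
      and b: "real b \<le> t * 2 ^ k / T" "t * 2 ^ k / T < real b + 1"
      using nn unfolding a_def b_def by (auto simp: of_nat_nat)
    have st1: "s * 2 ^ k / T \<le> t * 2 ^ k / T" using that T by (intro divide_right_mono mult_right_mono) auto
    have "t - s \<le> T / 2 ^ k" using st \<open>s \<le> t\<close> by simp
    hence st2: "t * 2 ^ k / T \<le> s * 2 ^ k / T + 1" using T by (simp add: field_simps)
    have "b = a \<or> b = a + 1" using a b st1 st2 by linarith
    hence "\<bar>f (T * real b / 2 ^ k) - f (T * real a / 2 ^ k)\<bar> \<le> B * \<rho> ^ k"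
    proof
      assume eq: "b = a + 1"
      have "t * 2 ^ k / T \<le> 2 ^ k" using s T by (simp add: field_simps)
      hence "real b \<le> 2 ^ k" using b by linarith
      hence "b \<le> 2 ^ k" by simp
      hence "a < 2 ^ k" using eq by simp
      thus ?thesis using f eq unfolding dyadic_increments_bounded_def by (simp add: add.commute)
    qed (use B \<rho> in simp)
    moreover have "\<bar>f s - f (T * real a / 2 ^ k)\<bar> \<le> B * \<rho> ^ k / (1 - \<rho>)"
      unfolding a_def by (rule dyadic_chain_bound[OF T B \<rho> cont f s(1)])
    moreover have "\<bar>f t - f (T * real b / 2 ^ k)\<bar> \<le> B * \<rho> ^ k / (1 - \<rho>)"
      unfolding b_def by (rule dyadic_chain_bound[OF T B \<rho> cont f s(2)])
    ultimately have "\<bar>f s - f t\<bar> \<le> B * \<rho> ^ k + 2 * (B * \<rho> ^ k / (1 - \<rho>))" by linarith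
    also have "\<dots> = B * (1 + 2 / (1 - \<rho>)) * \<rho> ^ k" by (simp add: algebra_simps)
    finally show ?thesis .
  qed
  show ?thesis
  proof (cases "s \<le> t")
    case True
    then show ?thesis using le s st by blast
  next
    case False
    then show ?thesis using le[of t s] s st by (simp add: abs_minus_commute)
  qed
qed

abbreviation C_metric :: "real \<Rightarrow> (real \<Rightarrow> real) metric" where
  "C_metric T \<equiv> cfunspace (top_of_set {0..T}) euclidean_metric"

lemma continuous_on_restrict_self:
  "continuous_on A f \<Longrightarrow> continuous_on A (restrict f A)"
  by (rule continuous_on_eq) auto

text \<open>On a compact interval boundedness is automatic.\<close>
lemma mspace_C_metric:
  "f \<in> mspace (C_metric T) \<longleftrightarrow> f \<in> extensional {0..T} \<and> continuous_on {0..T} f"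
  by (subst compactin_mspace_cfunspace) (auto simp: compactin_subtopology)

lemma topspace_C_space: "topspace (C_space T) = mspace (C_metric T)"
  unfolding C_space_def by (rule topspace_mtopology_of)

lemma openin_C_space:
  "openin (C_space T) U \<longleftrightarrow> U \<subseteq> mspace (C_metric T) \<and> (\<forall>f\<in>U. \<exists>r>0. mball_of (C_metric T) f r \<subseteq> U)"
proof -
  interpret Metric_space "mspace (C_metric T)" "mdist (C_metric T)" by (rule Metric_space_mspace_mdist)
  show ?thesis unfolding C_space_def mtopology_of_def mball_of_def openin_mtopology by blast
qed

definition dyadic_compact :: "real \<Rightarrow> real \<Rightarrow> real \<Rightarrow> (real \<Rightarrow> real) set" where
  "dyadic_compact T B \<rho> = {f \<in> mspace (C_metric T). f 0 = 0 \<and> dyadic_increments_bounded T B \<rho> f}"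

text \<open>The common modulus of continuity and the fixed value at \<open>0\<close> make the set relatively compact by the
  Arzela-Ascoli theorem, and the defining conditions are closed under pointwise limits.\<close>
lemma compactin_dyadic_compact:
  assumes T: "0 < T" and B: "0 \<le> B" and \<rho>: "0 < \<rho>" "\<rho> < 1"
  shows "compactin (C_space T) (dyadic_compact T B \<rho>)"
proof -
  interpret Metric_space "mspace (C_metric T)" "mdist (C_metric T)" by (rule Metric_space_mspace_mdist)
  have "\<exists>l r. l \<in> dyadic_compact T B \<rho> \<and> strict_mono r \<and> limitin mtopology (\<sigma> \<circ> r) l sequentially"
    if \<sigma>: "range \<sigma> \<subseteq> dyadic_compact T B \<rho>" for \<sigma> :: "nat \<Rightarrow> real \<Rightarrow> real"
  proof -
    have \<sigma>': "\<sigma> n \<in> mspace (C_metric T)" "continuous_on {0..T} (\<sigma> n)" "\<sigma> n 0 = 0" "dyadic_increments_bounded T B \<rho> (\<sigma> n)" for n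
      using \<sigma> unfolding dyadic_compact_def by (auto simp: mspace_C_metric simp del: mspace_cfunspace)
    define c where "c = B * (1 + 2 / (1 - \<rho>))"
    have c: "0 \<le> c" using B \<rho> by (simp add: c_def)
    have modulus: "\<bar>\<sigma> n s - \<sigma> n t\<bar> \<le> c * \<rho> ^ k"
      if "s \<in> {0..T}" "t \<in> {0..T}" "\<bar>s - t\<bar> \<le> T / 2 ^ k" for n s t k
      unfolding c_def by (rule dyadic_modulus_of_continuity[OF T B \<rho> \<sigma>'(2,4) that])
    obtain g k where gk: "continuous_on {0..T} g" "strict_mono (k :: nat \<Rightarrow> nat)"
      "\<And>e. 0 < e \<Longrightarrow> \<exists>N. \<forall>n x. n \<ge> N \<and> x \<in> {0..T} \<longrightarrow> norm (\<sigma> (k n) x - g x) < e"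
    proof (rule Arzela_Ascoli[of "{0..T}" \<sigma> c])
      show "norm (\<sigma> n x) \<le> c" if "x \<in> {0..T}" for n x
        using modulus[of x 0 0 n] \<sigma>'(3)[of n] that T by simp
      show "\<exists>d. 0 < d \<and> (\<forall>n y. y \<in> {0..T} \<and> norm (x - y) < d \<longrightarrow> norm (\<sigma> n x - \<sigma> n y) < e)"
        if x: "x \<in> {0..T}" "0 < e" for x e
      proof -
        have "(\<lambda>k. c * \<rho> ^ k) \<longlonglongrightarrow> c * 0" using \<rho> by (intro tendsto_intros LIMSEQ_realpow_zero) auto
        hence "eventually (\<lambda>k. c * \<rho> ^ k < e) sequentially" using x by (intro order_tendstoD) auto
        then obtain k where k: "c * \<rho> ^ k < e" by (auto simp: eventually_sequentially)
        have "norm (\<sigma> n x - \<sigma> n y) < e" if "y \<in> {0..T}" "norm (x - y) < T / 2 ^ k" for n y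
          using modulus[of x y k n] that x k by simp
        thus ?thesis using T by (intro exI[of _ "T / 2 ^ k"]) auto
      qed
    qed auto
    define l where "l = restrict g {0..T}"
    have lim: "(\<lambda>n. \<sigma> (k n) x) \<longlonglongrightarrow> l x" if "x \<in> {0..T}" for x
      using gk(3) that unfolding l_def LIMSEQ_iff by simp blast
    have l: "l \<in> mspace (C_metric T)"
      unfolding mspace_C_metric l_def using gk(1) continuous_on_restrict_self by blast
    have "l 0 = 0"
      using lim[of 0] \<sigma>'(3) T LIMSEQ_unique[OF lim[of 0], of 0] by simp
    moreover have "dyadic_increments_bounded T B \<rho> l"
      unfolding dyadic_increments_bounded_def
    proof (intro allI impI)
      fix m i :: nat assume i: "i < 2 ^ m"
      have "(\<lambda>n. \<bar>\<sigma> (k n) (T * (real i + 1) / 2 ^ m) - \<sigma> (k n) (T * real i / 2 ^ m)\<bar>)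
          \<longlonglongrightarrow> \<bar>l (T * (real i + 1) / 2 ^ m) - l (T * real i / 2 ^ m)\<bar>"
        by (intro tendsto_intros lim dyadic_point_mem[OF T i])
      thus "\<bar>l (T * (real i + 1) / 2 ^ m) - l (T * real i / 2 ^ m)\<bar> \<le> B * \<rho> ^ m"
        by (rule LIMSEQ_le_const2) (use \<sigma>'(4) i in \<open>auto simp: dyadic_increments_bounded_def\<close>)
    qed
    ultimately have "l \<in> dyadic_compact T B \<rho>" using l by (simp add: dyadic_compact_def del: mspace_cfunspace)
    moreover have "limitin mtopology (\<sigma> \<circ> k) l sequentially"
      unfolding limit_metric_sequentially
    proof (intro conjI allI impI l)
      fix e :: real assume "0 < e"
      then obtain N where N: "\<And>n x. n \<ge> N \<Longrightarrow> x \<in> {0..T} \<Longrightarrow> norm (\<sigma> (k n) x - g x) < e / 2"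
        using gk(3)[of "e / 2"] by auto
      have "mdist (C_metric T) (\<sigma> (k n)) l \<le> e / 2" if "n \<ge> N" for n
        by (rule mdist_cfunspace_le) (use N[OF that] \<open>0 < e\<close> in \<open>auto simp: l_def dist_real_def intro: less_imp_le\<close>)
      hence "mdist (C_metric T) (\<sigma> (k n)) l < e" if "n \<ge> N" for n
        using \<open>0 < e\<close> that by fastforce
      thus "\<exists>N. \<forall>n\<ge>N. (\<sigma> \<circ> k) n \<in> mspace (C_metric T) \<and> mdist (C_metric T) ((\<sigma> \<circ> k) n) l < e"
        using \<sigma>'(1) by (intro exI[of _ N]) (simp del: mspace_cfunspace)
    qed
    ultimately show ?thesis using gk(2) by blast
  qed
  moreover have "dyadic_compact T B \<rho> \<subseteq> mspace (C_metric T)" by (auto simp: dyadic_compact_def simp del: mspace_cfunspace)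
  ultimately show ?thesis unfolding C_space_def mtopology_of_def compactin_sequentially by blast
qed

section \<open>Linear interpolation\<close>

definition polygon :: "(nat \<Rightarrow> real) \<Rightarrow> real \<Rightarrow> real" where
  "polygon y x = y (nat \<lfloor>x\<rfloor>) + (x - real (nat \<lfloor>x\<rfloor>)) * (y (Suc (nat \<lfloor>x\<rfloor>)) - y (nat \<lfloor>x\<rfloor>))"

lemma rescaled_path_polygon:
  "rescaled_path M S n \<omega> t = polygon (\<lambda>i. S i \<omega>) (real n * t) / std_deviation M (S n)"
  by (simp add: rescaled_path_def polygon_def Let_def)

definition unit_clamp :: "real \<Rightarrow> real" where
  "unit_clamp x = max 0 (min 1 x)"

text \<open>Summation by parts: every segment contributes its increment times the part of it that lies to the
  left of \<open>x\<close>. In this form the interpolation is visibly continuous in \<open>x\<close>, and increments in \<open>x\<close> are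
  combinations of the increments of \<open>y\<close> with nonnegative weights.\<close>
lemma polygon_clamp:
  assumes "0 \<le> x" "x \<le> real N"
  shows "polygon y x = y 0 + (\<Sum>i<N. (y (Suc i) - y i) * unit_clamp (x - real i))"
proof -
  define k where "k = nat \<lfloor>x\<rfloor>"
  have k: "real k \<le> x" "x < real k + 1" using assms(1) unfolding k_def by (auto simp: of_nat_nat)
  have below: "(\<Sum>i<j. (y (Suc i) - y i) * unit_clamp (x - real i)) = y j - y 0" if "j \<le> k" for j
    using that k by (induction j) (auto simp: unit_clamp_def)
  have above: "(\<Sum>i<Suc k + j. (y (Suc i) - y i) * unit_clamp (x - real i))
      = (y k - y 0) + (y (Suc k) - y k) * (x - real k)" for j
    using k below[of k] by (induction j) (auto simp: unit_clamp_def)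
  have poly: "polygon y x = y k + (x - real k) * (y (Suc k) - y k)" by (simp add: polygon_def k_def)
  show ?thesis
  proof (cases "N \<le> k")
    case True
    hence "x = real k" "N = k" using k assms by linarith+
    thus ?thesis using below[of k] poly by simp
  next
    case False
    then obtain j where "N = Suc k + j" using less_imp_Suc_add[of k N] by auto
    thus ?thesis using above[of j] poly by simp
  qed
qed

lemma continuous_on_polygon: "continuous_on {0..real N} (polygon y)"
proof -
  have "continuous_on {0..real N} (\<lambda>x. y 0 + (\<Sum>i<N. (y (Suc i) - y i) * unit_clamp (x - real i)))"
    unfolding unit_clamp_def by (intro continuous_intros)
  thus ?thesis by (rule continuous_on_eq) (auto intro: polygon_clamp[symmetric])
qed

text \<open>The value of a polygon is a convex combination of the values at two neighbouring nodes.\<close>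
lemma polygon_diff_le:
  assumes "0 \<le> x" "x \<le> real N" and close: "\<And>i. i \<le> Suc N \<Longrightarrow> \<bar>y i - z i\<bar> \<le> e"
  shows "\<bar>polygon y x - polygon z x\<bar> \<le> e"
proof -
  define k where "k = nat \<lfloor>x\<rfloor>"
  define \<theta> where "\<theta> = x - real k"
  have k: "real k \<le> x" "x < real k + 1" using assms(1) unfolding k_def by (auto simp: of_nat_nat)
  have "k \<le> N" using k assms(2) by linarith
  have \<theta>: "0 \<le> \<theta>" "\<theta> \<le> 1" using k by (auto simp: \<theta>_def)
  have "polygon y x - polygon z x = (1 - \<theta>) * (y k - z k) + \<theta> * (y (Suc k) - z (Suc k))"
    unfolding polygon_def k_def[symmetric] \<theta>_def[symmetric] by (simp add: algebra_simps)
  also have "\<bar>\<dots>\<bar> \<le> (1 - \<theta>) * \<bar>y k - z k\<bar> + \<theta> * \<bar>y (Suc k) - z (Suc k)\<bar>"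
    using \<theta> by (intro order_trans[OF abs_triangle_ineq]) (simp add: abs_mult)
  also have "\<dots> \<le> (1 - \<theta>) * e + \<theta> * e"
    using \<theta> \<open>k \<le> N\<close> by (intro add_mono mult_left_mono close) auto
  finally show ?thesis by (simp add: algebra_simps)
qed

lemma polygon_path_in_C_metric:
  "restrict (\<lambda>t. polygon y (real n * t) * a) {0..T} \<in> mspace (C_metric T)"
proof -
  have "continuous_on {0..T} (\<lambda>t. polygon y (real n * t) * a)"
  proof (intro continuous_intros continuous_on_compose2[OF continuous_on_polygon])
    have "real n * t \<le> real (nat \<lceil>real n * T\<rceil>)" if "t \<le> T" for t
      using mult_left_mono[OF that, of "real n"] by linarith
    thus "(\<lambda>t. real n * t) ` {0..T} \<subseteq> {0..real (nat \<lceil>real n * T\<rceil>)}" by auto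
  qed
  thus ?thesis unfolding mspace_C_metric
    using continuous_on_restrict_self restrict_extensional by blast
qed

text \<open>The path is the image of the sequence of nodes under a map that is continuous from the product
  topology, because on \<open>{0..T}\<close> it depends on finitely many nodes only. The Borel sets of the sequence space
  are generated by the coordinates.\<close>
lemma polygon_path_measurable:
  assumes S: "\<And>i. S i \<in> borel_measurable M"
  shows "(\<lambda>\<omega>. restrict (\<lambda>t. polygon (\<lambda>i. S i \<omega>) (real n * t) * a) {0..T}) \<in> M \<rightarrow>\<^sub>M borel_of (C_space T)"
proof -
  define F where "F y = restrict (\<lambda>t. polygon y (real n * t) * a) {0..T}" for y
  have Fin: "F y \<in> mspace (C_metric T)" for y unfolding F_def by (rule polygon_path_in_C_metric)
  have S': "(\<lambda>\<omega> i. S i \<omega>) \<in> borel_measurable M"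
    by (rule measurable_coordinatewise_then_product) (rule S)
  have "open (F -` U)" if U: "openin (C_space T) U" for U
  proof (rule Topological_Spaces.openI)
    fix y assume "y \<in> F -` U"
    then obtain r where r: "0 < r" "mball_of (C_metric T) (F y) r \<subseteq> U"
      using U unfolding openin_C_space by (auto simp del: mspace_cfunspace)
    define N where "N = nat \<lceil>real n * T\<rceil>"
    define e where "e = r / (2 * (\<bar>a\<bar> + 1))"
    have e: "0 < e" "e * \<bar>a\<bar> \<le> r / 2" using r(1) by (auto simp: e_def field_simps)
    define V where "V = (\<Inter>i\<in>{..Suc N}. (\<lambda>z. z i) -` ball (y i) e :: (nat \<Rightarrow> real) set)"
    have "open V" unfolding V_def
      by (intro open_INT ballI open_vimage) auto
    moreover have "y \<in> V" using e by (simp add: V_def)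
    moreover have "V \<subseteq> F -` U"
    proof
      fix z assume z: "z \<in> V"
      have "mdist (C_metric T) (F y) (F z) \<le> r / 2"
      proof (rule mdist_cfunspace_le)
        fix t assume "t \<in> topspace (top_of_set {0..T})"
        hence t: "0 \<le> t" "t \<le> T" by auto
        have "real n * t \<le> real n * T" using t by (intro mult_left_mono) auto
        hence "real n * t \<le> real N" unfolding N_def by linarith
        hence "\<bar>polygon y (real n * t) - polygon z (real n * t)\<bar> \<le> e"
          using t z by (intro polygon_diff_le) (auto simp: V_def dist_real_def intro: less_imp_le)
        hence "\<bar>polygon y (real n * t) - polygon z (real n * t)\<bar> * \<bar>a\<bar> \<le> e * \<bar>a\<bar>"
          by (rule mult_right_mono) simp
        with e(2) have "\<bar>polygon y (real n * t) * a - polygon z (real n * t) * a\<bar> \<le> r / 2"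
          by (simp only: left_diff_distrib[symmetric] abs_mult)
        thus "mdist euclidean_metric (F y t) (F z t) \<le> r / 2"
          using t by (simp add: F_def dist_real_def)
      qed (use r in simp)
      hence "F z \<in> mball_of (C_metric T) (F y) r" using Fin r by (simp del: mspace_cfunspace)
      thus "z \<in> F -` U" using r(2) by auto
    qed
    ultimately show "\<exists>V. open V \<and> y \<in> V \<and> V \<subseteq> F -` U" by blast
  qed
  hence pre: "(\<lambda>\<omega>. F (\<lambda>i. S i \<omega>)) -` U \<inter> space M \<in> sets M" if "openin (C_space T) U" for U
    using measurable_sets[OF S' borel_open[of "F -` U"]] that by (simp add: vimage_def)
  have "(\<lambda>\<omega>. F (\<lambda>i. S i \<omega>)) \<in> M \<rightarrow>\<^sub>M borel_of (C_space T)"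
    unfolding borel_of_def
  proof (rule measurable_measure_of)
    show "{U. openin (C_space T) U} \<subseteq> Pow (topspace (C_space T))"
      using openin_subset by blast
    show "(\<lambda>\<omega>. F (\<lambda>i. S i \<omega>)) \<in> space M \<rightarrow> topspace (C_space T)"
      using Fin by (auto simp: topspace_C_space simp del: mspace_cfunspace)
  qed (use pre in auto)
  thus ?thesis by (simp add: F_def)
qed

section \<open>The Kolmogorov criterion\<close>

text \<open>A union bound over the \<open>2 ^ k\<close> intervals of each level \<open>k\<close> with Markov's inequality. The moment
  condition beats their number by \<open>2 powr (- \<delta> * k)\<close>; half of this gain pays for the decay \<open>\<rho> ^ (2 * k)\<close>
  of the admitted increments, with \<open>\<rho> = 2 powr (- \<delta> / 4)\<close>, and the other half makes the sum over \<open>k\<close>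
  converge.\<close>
lemma (in prob_space) dyadic_increment_tail:
  assumes T: "0 < T" and \<delta>: "0 < \<delta>" and B: "0 < B" and D: "0 \<le> D"
    and meas: "\<And>t. t \<in> {0..T} \<Longrightarrow> Z t \<in> borel_measurable M"
    and int: "\<And>s t. s \<in> {0..T} \<Longrightarrow> t \<in> {0..T} \<Longrightarrow> integrable M (\<lambda>\<omega>. (Z t \<omega> - Z s \<omega>)\<^sup>2)"
    and mom: "\<And>s t. 0 \<le> s \<Longrightarrow> s \<le> t \<Longrightarrow> t \<le> T \<Longrightarrow> expectation (\<lambda>\<omega>. (Z t \<omega> - Z s \<omega>)\<^sup>2) \<le> D * (t - s) powr (1 + \<delta>)"
  shows "1 - D * T powr (1 + \<delta>) / (B\<^sup>2 * (1 - 2 powr (- \<delta> / 2)))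
    \<le> prob {\<omega> \<in> space M. dyadic_increments_bounded T B (2 powr (- \<delta> / 4)) (\<lambda>t. Z t \<omega>)}"
proof -
  define \<rho> where "\<rho> = 2 powr (- \<delta> / 4)"
  define q where "q = 2 powr (- \<delta> / 2)"
  have \<rho>: "0 < \<rho>" "\<rho>\<^sup>2 = q" by (auto simp: \<rho>_def q_def power2_eq_square powr_add[symmetric])
  have q: "0 < q" "q < 1" "q * q = 2 powr (- \<delta>)"
  proof -
    have "2 powr (- \<delta> / 2) < 2 powr 0" using \<delta> by (subst powr_less_cancel_iff) auto
    thus "q < 1" by (simp add: q_def)
  qed (auto simp: q_def powr_add[symmetric])
  define E where "E k i = {\<omega> \<in> space M. (B * \<rho> ^ k)\<^sup>2 \<le> (Z (T * (real i + 1) / 2 ^ k) \<omega> - Z (T * real i / 2 ^ k) \<omega>)\<^sup>2}" for k i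
  note pts = dyadic_point_mem[OF T]
  have Ev: "E k i \<in> events" if "i < 2 ^ k" for k i
  proof -
    note [measurable] = meas[OF pts(1)[OF that]] meas[OF pts(2)[OF that]]
    show ?thesis unfolding E_def by measurable
  qed
  have pE: "prob (E k i) \<le> D * T powr (1 + \<delta>) / B\<^sup>2 * (q ^ k / 2 ^ k)" if i: "i < 2 ^ k" for k i
  proof -
    let ?u = "\<lambda>\<omega>. (Z (T * (real i + 1) / 2 ^ k) \<omega> - Z (T * real i / 2 ^ k) \<omega>)\<^sup>2"
    have "prob (E k i) \<le> expectation ?u / (B * \<rho> ^ k)\<^sup>2"
      unfolding E_def
      by (rule integral_Markov_inequality_measure[where A = "space M"]) (use B \<rho> int pts[OF i] in auto)
    also have "\<dots> \<le> D * (T / 2 ^ k) powr (1 + \<delta>) / (B * \<rho> ^ k)\<^sup>2"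
    proof (rule divide_right_mono)
      have "T * (real i + 1) / 2 ^ k - T * real i / 2 ^ k = T / 2 ^ k" by (simp add: field_simps)
      thus "expectation ?u \<le> D * (T / 2 ^ k) powr (1 + \<delta>)"
        using mom[of "T * real i / 2 ^ k" "T * (real i + 1) / 2 ^ k"] pts[OF i] T by (simp add: divide_right_mono)
    qed simp
    also have "(T / 2 ^ k) powr (1 + \<delta>) = T powr (1 + \<delta>) * ((q * q) ^ k / 2 ^ k)"
    proof -
      have "(2 ^ k :: real) powr (1 + \<delta>) = 2 ^ k * (2 powr \<delta>) ^ k"
        by (simp add: powr_add powr_power flip: powr_realpow)
           (simp add: powr_powr mult.commute)
      hence "(T / 2 ^ k) powr (1 + \<delta>) = T powr (1 + \<delta>) / (2 ^ k * (2 powr \<delta>) ^ k)"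
        using T by (simp add: powr_divide)
      also have "(2 powr \<delta>) = 1 / (q * q)" by (simp add: q(3) powr_minus_divide)
      finally show ?thesis by (simp add: power_divide)
    qed
    also have "(B * \<rho> ^ k)\<^sup>2 = B\<^sup>2 * q ^ k"
      by (simp add: power_mult_distrib power_mult[symmetric] mult.commute[of k 2] flip: \<rho>(2)) 
    also have "D * (T powr (1 + \<delta>) * ((q * q) ^ k / 2 ^ k)) / (B\<^sup>2 * q ^ k) = D * T powr (1 + \<delta>) / B\<^sup>2 * (q ^ k / 2 ^ k)"
      using q(1) B by (simp add: power_mult_distrib mult_ac del: q(3))
    finally show ?thesis .
  qed
  define A where "A k = (\<Union>i\<in>{..<2 ^ k}. E k i)" for k
  have Aev: "A k \<in> events" for k unfolding A_def using Ev by auto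
  have pA: "prob (A k) \<le> D * T powr (1 + \<delta>) / B\<^sup>2 * q ^ k" for k
  proof -
    have "prob (A k) \<le> (\<Sum>i<2 ^ k. prob (E k i))"
      unfolding A_def using Ev by (intro finite_measure_subadditive_finite) auto
    also have "\<dots> \<le> (\<Sum>i<(2::nat) ^ k. D * T powr (1 + \<delta>) / B\<^sup>2 * (q ^ k / 2 ^ k))"
      using pE by (intro sum_mono) auto
    also have "\<dots> = D * T powr (1 + \<delta>) / B\<^sup>2 * q ^ k" by simp
    finally show ?thesis .
  qed
  have geo: "(\<lambda>k. D * T powr (1 + \<delta>) / B\<^sup>2 * q ^ k) sums (D * T powr (1 + \<delta>) / B\<^sup>2 * (1 / (1 - q)))"
    using q by (intro sums_mult geometric_sums) auto
  have sumA: "summable (\<lambda>k. prob (A k))"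
    by (rule summable_comparison_test'[OF sums_summable[OF geo]]) (use pA in auto)
  have "prob (\<Union>k. A k) \<le> (\<Sum>k. prob (A k))"
    by (rule finite_measure_subadditive_countably) (use Aev sumA in auto)
  also have "\<dots> \<le> D * T powr (1 + \<delta>) / B\<^sup>2 * (1 / (1 - q))"
    using suminf_le[OF pA sumA sums_summable[OF geo]] geo by (simp add: sums_iff)
  finally have pU: "prob (\<Union>k. A k) \<le> D * T powr (1 + \<delta>) / (B\<^sup>2 * (1 - q))" by simp
  have "1 - prob (\<Union>k. A k) = prob (space M - (\<Union>k. A k))"
    using Aev by (subst prob_compl) auto
  also have "\<dots> \<le> prob {\<omega> \<in> space M. dyadic_increments_bounded T B \<rho> (\<lambda>t. Z t \<omega>)}"
  proof (rule finite_measure_mono)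
    show "space M - (\<Union>k. A k) \<subseteq> {\<omega> \<in> space M. dyadic_increments_bounded T B \<rho> (\<lambda>t. Z t \<omega>)}"
    proof (clarsimp simp: dyadic_increments_bounded_def A_def E_def not_le)
      fix \<omega> and k i :: nat
      assume "\<omega> \<in> space M" and i: "i < 2 ^ k"
        and "\<forall>k. \<forall>i\<in>{..<2 ^ k}. (Z (T * (real i + 1) / 2 ^ k) \<omega> - Z (T * real i / 2 ^ k) \<omega>)\<^sup>2 < (B * \<rho> ^ k)\<^sup>2"
      hence "(Z (T * (real i + 1) / 2 ^ k) \<omega> - Z (T * real i / 2 ^ k) \<omega>)\<^sup>2 \<le> (B * \<rho> ^ k)\<^sup>2"
        by (auto intro: less_imp_le)
      hence "\<bar>Z (T * (real i + 1) / 2 ^ k) \<omega> - Z (T * real i / 2 ^ k) \<omega>\<bar> \<le> \<bar>B * \<rho> ^ k\<bar>"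
        by (simp only: abs_le_square_iff)
      thus "\<bar>Z (T * (real i + 1) / 2 ^ k) \<omega> - Z (T * real i / 2 ^ k) \<omega>\<bar> \<le> B * \<rho> ^ k"
        using B \<rho> by simp
    qed
    have "{\<omega> \<in> space M. dyadic_increments_bounded T B \<rho> (\<lambda>t. Z t \<omega>)}
        = {\<omega> \<in> space M. \<forall>k. \<forall>i\<in>{..<2 ^ k}.
            \<bar>Z (T * (real i + 1) / 2 ^ k) \<omega> - Z (T * real i / 2 ^ k) \<omega>\<bar> \<le> B * \<rho> ^ k}"
      by (auto simp: dyadic_increments_bounded_def)
    also have "\<dots> \<in> events"
    proof (intro sets.sets_Collect_countable_All sets.sets_Collect_finite_All)
      fix k i :: nat assume "i \<in> {..<2 ^ k}"
      hence i: "i < 2 ^ k" by simp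
      note [measurable] = meas[OF pts(1)[OF i]] meas[OF pts(2)[OF i]]
      show "{\<omega> \<in> space M. \<bar>Z (T * (real i + 1) / 2 ^ k) \<omega> - Z (T * real i / 2 ^ k) \<omega>\<bar> \<le> B * \<rho> ^ k} \<in> events"
        by measurable
    qed simp
    finally show "{\<omega> \<in> space M. dyadic_increments_bounded T B \<rho> (\<lambda>t. Z t \<omega>)} \<in> events" .
  qed
  finally show ?thesis using pU unfolding \<rho>_def[symmetric] q_def[symmetric] by linarith
qed

section \<open>Tightness of rescaled interpolations\<close>

lemma weighted_sum_squared_le:
  fixes a d :: "nat \<Rightarrow> real"
  assumes "\<And>i. 0 \<le> a i"
  shows "(\<Sum>i<N. a i * d i)\<^sup>2 \<le> (\<Sum>i<N. a i) * (\<Sum>i<N. a i * (d i)\<^sup>2)"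
proof -
  have "(\<Sum>i<N. sqrt (a i) * (sqrt (a i) * d i))\<^sup>2 \<le> (\<Sum>i<N. (sqrt (a i))\<^sup>2) * (\<Sum>i<N. (sqrt (a i) * d i)\<^sup>2)"
    by (rule Cauchy_Schwarz_ineq_sum)
  thus ?thesis using assms by (simp add: mult.assoc[symmetric] power_mult_distrib)
qed

lemma polygon_identity: "0 \<le> x \<Longrightarrow> polygon real x = x"
  by (simp add: polygon_def)

text \<open>The weights of the node increments sum to \<open>y - x\<close>, as one sees from the polygon through the points
  \<open>(i, i)\<close>; then apply the Cauchy-Schwarz inequality.\<close>
lemma polygon_increment_squared_le:
  assumes xy: "0 \<le> x" "x \<le> y" "y \<le> real N"
  shows "(polygon f y - polygon f x)\<^sup>2
    \<le> (y - x) * (\<Sum>i<N. (unit_clamp (y - real i) - unit_clamp (x - real i)) * (f (Suc i) - f i)\<^sup>2)"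
proof -
  define a where "a i = unit_clamp (y - real i) - unit_clamp (x - real i)" for i
  have a: "0 \<le> a i" for i using xy by (auto simp: a_def unit_clamp_def)
  have diff: "polygon g y - polygon g x = (\<Sum>i<N. a i * (g (Suc i) - g i))" for g
    using polygon_clamp[of y N g] polygon_clamp[of x N g] xy
    by (simp add: a_def sum_subtractf[symmetric] algebra_simps)
  have "(\<Sum>i<N. a i) = y - x"
    using diff[of real] xy by (simp add: polygon_identity)
  thus ?thesis unfolding diff using weighted_sum_squared_le[where a = a and N = N and d = "\<lambda>i. f (Suc i) - f i", OF a]
    by (simp add: a_def)
qed

context prob_space
begin

lemma polygon_increment_moments:
  fixes S :: "nat \<Rightarrow> 'a \<Rightarrow> real"
  assumes meas [measurable]: "\<And>i. S i \<in> borel_measurable M"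
    and int: "\<And>k m. integrable M (\<lambda>\<omega>. (S (k + m) \<omega> - S k \<omega>)\<^sup>2)"
    and mom: "\<And>k m. expectation (\<lambda>\<omega>. (S (k + m) \<omega> - S k \<omega>)\<^sup>2) = w m"
    and xy: "0 \<le> x" "x \<le> y"
  shows "integrable M (\<lambda>\<omega>. (polygon (\<lambda>i. S i \<omega>) y - polygon (\<lambda>i. S i \<omega>) x)\<^sup>2)"
    and "expectation (\<lambda>\<omega>. (polygon (\<lambda>i. S i \<omega>) y - polygon (\<lambda>i. S i \<omega>) x)\<^sup>2) \<le> (y - x)\<^sup>2 * w 1"
proof -
  define N where "N = nat \<lceil>y\<rceil>"
  have N: "y \<le> real N" unfolding N_def by linarith
  define a where "a i = unit_clamp (y - real i) - unit_clamp (x - real i)" for i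
  define G where "G \<omega> = (y - x) * (\<Sum>i<N. a i * (S (Suc i) \<omega> - S i \<omega>)\<^sup>2)" for \<omega>
  have le: "(polygon (\<lambda>i. S i \<omega>) y - polygon (\<lambda>i. S i \<omega>) x)\<^sup>2 \<le> G \<omega>" for \<omega>
    unfolding G_def a_def by (rule polygon_increment_squared_le[OF xy N])
  have int1: "integrable M (\<lambda>\<omega>. (S (Suc i) \<omega> - S i \<omega>)\<^sup>2)"
    and mom1: "expectation (\<lambda>\<omega>. (S (Suc i) \<omega> - S i \<omega>)\<^sup>2) = w 1" for i
    using int[of i 1] mom[of i 1] by auto
  have intG: "integrable M G" unfolding G_def using int1 by simp
  show i: "integrable M (\<lambda>\<omega>. (polygon (\<lambda>i. S i \<omega>) y - polygon (\<lambda>i. S i \<omega>) x)\<^sup>2)"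
    by (rule Bochner_Integration.integrable_bound[OF intG])
       (use le in \<open>auto simp: polygon_def intro!: order_trans[OF _ abs_ge_self]\<close>)
  have "expectation (\<lambda>\<omega>. (polygon (\<lambda>i. S i \<omega>) y - polygon (\<lambda>i. S i \<omega>) x)\<^sup>2) \<le> expectation G"
    by (rule integral_mono[OF i intG le])
  also have "expectation G = (y - x) * ((\<Sum>i<N. a i) * w 1)"
    unfolding G_def using int1 mom1 by (simp add: Bochner_Integration.integral_sum sum_distrib_right)
  also have "(\<Sum>i<N. a i) = y - x"
    using polygon_clamp[of y N real] polygon_clamp[of x N real] xy N
    by (simp add: polygon_identity a_def sum_subtractf)
  finally show "expectation (\<lambda>\<omega>. (polygon (\<lambda>i. S i \<omega>) y - polygon (\<lambda>i. S i \<omega>) x)\<^sup>2) \<le> (y - x)\<^sup>2 * w 1"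
    by (simp add: power2_eq_square mult.assoc)
qed

text \<open>The inequality \<open>(a + b - c)\<^sup>2 \<le> 3 * (a\<^sup>2 + b\<^sup>2 + c\<^sup>2)\<close> splits the increment into the one between the
  last nodes before \<open>x\<close> and \<open>y\<close> and two partial segments.\<close>
lemma polygon_long_increment_moment:
  fixes S :: "nat \<Rightarrow> 'a \<Rightarrow> real"
  assumes meas [measurable]: "\<And>i. S i \<in> borel_measurable M"
    and int: "\<And>k m. integrable M (\<lambda>\<omega>. (S (k + m) \<omega> - S k \<omega>)\<^sup>2)"
    and mom: "\<And>k m. expectation (\<lambda>\<omega>. (S (k + m) \<omega> - S k \<omega>)\<^sup>2) = w m"
    and xy: "0 \<le> x" "x \<le> y"
  shows "expectation (\<lambda>\<omega>. (polygon (\<lambda>i. S i \<omega>) y - polygon (\<lambda>i. S i \<omega>) x)\<^sup>2)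
    \<le> 3 * (2 * w 1 + w (nat \<lfloor>y\<rfloor> - nat \<lfloor>x\<rfloor>))"
proof -
  define k l where "k = nat \<lfloor>x\<rfloor>" and "l = nat \<lfloor>y\<rfloor>"
  have kl: "k \<le> l" using xy unfolding k_def l_def by (intro nat_mono floor_mono)
  have k: "real k \<le> x" "x < real k + 1" and l: "real l \<le> y" "y < real l + 1"
    using xy unfolding k_def l_def by (auto simp: of_nat_nat)
  define G where "G \<omega> = 3 * ((S (Suc l) \<omega> - S l \<omega>)\<^sup>2 + (S l \<omega> - S k \<omega>)\<^sup>2 + (S (Suc k) \<omega> - S k \<omega>)\<^sup>2)" for \<omega>
  have le: "(polygon (\<lambda>i. S i \<omega>) y - polygon (\<lambda>i. S i \<omega>) x)\<^sup>2 \<le> G \<omega>" for \<omega>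
  proof -
    define a b c where "a = (y - real l) * (S (Suc l) \<omega> - S l \<omega>)"
      and "b = S l \<omega> - S k \<omega>" and "c = (x - real k) * (S (Suc k) \<omega> - S k \<omega>)"
    have "polygon (\<lambda>i. S i \<omega>) y - polygon (\<lambda>i. S i \<omega>) x = a + b - c"
      unfolding polygon_def k_def[symmetric] l_def[symmetric] a_def b_def c_def by simp
    moreover have "(a + b - c)\<^sup>2 \<le> 3 * (a\<^sup>2 + b\<^sup>2 + c\<^sup>2)"
    proof -
      have "3 * (a\<^sup>2 + b\<^sup>2 + c\<^sup>2) - (a + b - c)\<^sup>2 = (a - b)\<^sup>2 + (a + c)\<^sup>2 + (b + c)\<^sup>2"
        by (simp add: power2_eq_square algebra_simps)
      moreover have "0 \<le> (a - b)\<^sup>2 + (a + c)\<^sup>2 + (b + c)\<^sup>2" by simp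
      ultimately show ?thesis by linarith
    qed
    moreover have "a\<^sup>2 \<le> (S (Suc l) \<omega> - S l \<omega>)\<^sup>2"
      unfolding a_def power_mult_distrib using l by (intro mult_left_le_one_le power_le_one) auto
    moreover have "c\<^sup>2 \<le> (S (Suc k) \<omega> - S k \<omega>)\<^sup>2"
      unfolding c_def power_mult_distrib using k by (intro mult_left_le_one_le power_le_one) auto
    ultimately show ?thesis unfolding G_def b_def by simp
  qed
  have int': "integrable M (\<lambda>\<omega>. (S (Suc i) \<omega> - S i \<omega>)\<^sup>2)" "expectation (\<lambda>\<omega>. (S (Suc i) \<omega> - S i \<omega>)\<^sup>2) = w 1" for i
    using int[of i 1] mom[of i 1] by auto
  have int'': "integrable M (\<lambda>\<omega>. (S l \<omega> - S k \<omega>)\<^sup>2)" "expectation (\<lambda>\<omega>. (S l \<omega> - S k \<omega>)\<^sup>2) = w (l - k)"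
    using int[of k "l - k"] mom[of k "l - k"] kl by auto
  have "integrable M G" unfolding G_def using int' int'' by simp
  with polygon_increment_moments(1)[OF meas int mom xy]
  have "expectation (\<lambda>\<omega>. (polygon (\<lambda>i. S i \<omega>) y - polygon (\<lambda>i. S i \<omega>) x)\<^sup>2) \<le> expectation G"
    by (rule integral_mono) (rule le)
  also have "expectation G = 3 * (2 * w 1 + w (l - k))"
    unfolding G_def using int' int'' by simp
  finally show ?thesis by (simp add: k_def l_def)
qed

text \<open>At distances below the mesh \<open>1 / n\<close> only single steps of \<open>S\<close> matter, and their quadratic bound beats the
  exponent \<open>1 + \<delta> \<le> 2\<close>. Above it, the increment covers at most \<open>2 * n * (t - s)\<close> nodes, and the growth condition
  on \<open>w\<close> applies.\<close>
lemma rescaled_increment_moment: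
  fixes S :: "nat \<Rightarrow> 'a \<Rightarrow> real"
  assumes meas [measurable]: "\<And>i. S i \<in> borel_measurable M"
    and int: "\<And>k m. integrable M (\<lambda>\<omega>. (S (k + m) \<omega> - S k \<omega>)\<^sup>2)"
    and mom: "\<And>k m. expectation (\<lambda>\<omega>. (S (k + m) \<omega> - S k \<omega>)\<^sup>2) = w m"
    and sd: "\<And>n. (std_deviation M (S n))\<^sup>2 = w n"
    and wpos: "\<And>n. 1 \<le> n \<Longrightarrow> 0 < w n"
    and "0 < A" "0 < \<delta>" "\<delta> \<le> 1"
    and growth: "\<And>m n. 1 \<le> m \<Longrightarrow> 1 \<le> n \<Longrightarrow> real m \<le> max 1 (2 * T) * real n \<Longrightarrow>
       w m \<le> A * (real m / real n) powr (1 + \<delta>) * w n"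
    and n: "1 \<le> n" and st: "0 \<le> s" "s \<le> t" "t \<le> T"
  shows "integrable M (\<lambda>\<omega>. (rescaled_path M S n \<omega> t - rescaled_path M S n \<omega> s)\<^sup>2)"
    and "expectation (\<lambda>\<omega>. (rescaled_path M S n \<omega> t - rescaled_path M S n \<omega> s)\<^sup>2)
      \<le> 18 * A * (t - s) powr (1 + \<delta>)"
proof -
  define h where "h = t - s"
  define x y where "x = real n * s" and "y = real n * t"
  have h: "0 \<le> h" "h \<le> T" using st by (auto simp: h_def)
  have xy: "0 \<le> x" "x \<le> y" "y - x = real n * h"
    using st by (auto simp: x_def y_def h_def intro!: mult_left_mono) (simp add: right_diff_distrib)
  let ?P = "\<lambda>\<omega>. (polygon (\<lambda>i. S i \<omega>) y - polygon (\<lambda>i. S i \<omega>) x)\<^sup>2"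
  have eq: "(rescaled_path M S n \<omega> t - rescaled_path M S n \<omega> s)\<^sup>2 = ?P \<omega> / w n" for \<omega>
    unfolding rescaled_path_polygon x_def y_def diff_divide_distrib[symmetric] power_divide sd ..
  show "integrable M (\<lambda>\<omega>. (rescaled_path M S n \<omega> t - rescaled_path M S n \<omega> s)\<^sup>2)"
    unfolding eq using polygon_increment_moments(1)[OF meas int mom xy(1,2)] by simp
  let ?D = "18 * A"
  have w1: "w 1 \<le> A * (1 / real n) powr (1 + \<delta>) * w n"
  proof -
    have "1 * 1 \<le> max 1 (2 * T) * real n" using n by (intro mult_mono) auto
    thus ?thesis using growth[of 1 n] n by simp
  qed
  have "expectation ?P \<le> ?D * h powr (1 + \<delta>) * w n"
  proof (cases "real n * h \<le> 1")
    case True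
    have "expectation ?P \<le> (real n * h)\<^sup>2 * w 1"
      using polygon_increment_moments(2)[OF meas int mom xy(1,2)] by (simp add: xy(3))
    also have "\<dots> \<le> (real n * h) powr (1 + \<delta>) * (A * (1 / real n) powr (1 + \<delta>) * w n)"
    proof (intro mult_mono w1)
      show "(real n * h)\<^sup>2 \<le> (real n * h) powr (1 + \<delta>)"
      proof (cases "h = 0")
        case False
        hence pos: "0 < real n * h" using n h by simp
        have "(real n * h)\<^sup>2 = (real n * h) powr 2" using pos by simp
        also have "\<dots> \<le> (real n * h) powr (1 + \<delta>)" using True pos \<open>\<delta> \<le> 1\<close> by (intro powr_mono') auto
        finally show ?thesis .
      qed simp
    qed (use wpos[of 1] in auto)
    also have "\<dots> = A * (((real n * h) powr (1 + \<delta>) * (1 / real n) powr (1 + \<delta>)) * w n)" by simp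
    also have "(real n * h) powr (1 + \<delta>) * (1 / real n) powr (1 + \<delta>) = h powr (1 + \<delta>)"
      using n h by (subst powr_mult[symmetric]) auto
    also have "A * (h powr (1 + \<delta>) * w n) \<le> ?D * (h powr (1 + \<delta>) * w n)"
      using \<open>0 < A\<close> wpos[OF n] by (intro mult_right_mono) auto
    finally show ?thesis by (simp add: mult.assoc)
  next
    case False
    hence hn: "1 \<le> real n * h" by simp
    define m where "m = nat \<lfloor>y\<rfloor> - nat \<lfloor>x\<rfloor>"
    have fl: "real (nat \<lfloor>x\<rfloor>) \<le> x" "x < real (nat \<lfloor>x\<rfloor>) + 1" "real (nat \<lfloor>y\<rfloor>) \<le> y" "y < real (nat \<lfloor>y\<rfloor>) + 1"
      using xy by (auto simp: of_nat_nat)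
    have "real (nat \<lfloor>x\<rfloor>) + 1 \<le> y" using fl xy(3) hn by linarith
    hence "nat \<lfloor>x\<rfloor> + 1 \<le> nat \<lfloor>y\<rfloor>" using fl by linarith
    hence m1: "1 \<le> m" and rm: "real m = real (nat \<lfloor>y\<rfloor>) - real (nat \<lfloor>x\<rfloor>)" by (auto simp: m_def of_nat_diff)
    have "real m \<le> 2 * (real n * h)" using rm fl xy(3) hn by linarith
    hence mle: "real m \<le> 2 * h * real n" by (simp add: mult_ac)
    also have "\<dots> \<le> max 1 (2 * T) * real n" using h by (intro mult_right_mono) auto
    finally have wm: "w m \<le> A * (real m / real n) powr (1 + \<delta>) * w n" by (rule growth[OF m1 n])
    have "(real m / real n) powr (1 + \<delta>) \<le> (2 * h) powr (1 + \<delta>)"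
      using mle n \<open>0 < \<delta>\<close> by (intro powr_mono2) (auto simp: divide_le_eq)
    also have "\<dots> = 2 powr (1 + \<delta>) * h powr (1 + \<delta>)" using h by (simp add: powr_mult)
    also have "\<dots> \<le> 4 * h powr (1 + \<delta>)"
    proof (rule mult_right_mono)
      have "(2 :: real) powr (1 + \<delta>) \<le> 2 powr 2" using \<open>\<delta> \<le> 1\<close> by (intro powr_mono) auto
      thus "(2 :: real) powr (1 + \<delta>) \<le> 4" by simp
    qed simp
    finally have "A * (real m / real n) powr (1 + \<delta>) * w n \<le> A * (4 * h powr (1 + \<delta>)) * w n"
      using \<open>0 < A\<close> wpos[OF n] by (intro mult_right_mono mult_left_mono) auto
    with wm have wm': "w m \<le> A * (4 * h powr (1 + \<delta>)) * w n" by linarith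
    have "(1 / real n) powr (1 + \<delta>) \<le> h powr (1 + \<delta>)"
      using hn n \<open>0 < \<delta>\<close> by (intro powr_mono2) (auto simp: field_simps)
    hence "A * (1 / real n) powr (1 + \<delta>) * w n \<le> A * h powr (1 + \<delta>) * w n"
      using \<open>0 < A\<close> wpos[OF n] by (intro mult_right_mono mult_left_mono) auto
    with w1 have w1': "w 1 \<le> A * h powr (1 + \<delta>) * w n" by linarith
    have "expectation ?P \<le> 3 * (2 * w 1 + w m)"
      unfolding m_def by (rule polygon_long_increment_moment[OF meas int mom xy(1,2)])
    also have "\<dots> \<le> 3 * (2 * (A * h powr (1 + \<delta>) * w n) + A * (4 * h powr (1 + \<delta>)) * w n)"
      using w1' wm' by (intro mult_left_mono add_mono) auto
    also have "\<dots> = ?D * h powr (1 + \<delta>) * w n" by (simp add: algebra_simps)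
    finally show ?thesis .
  qed
  hence "expectation ?P / w n \<le> ?D * h powr (1 + \<delta>)" using wpos[OF n] by (simp add: divide_le_eq)
  thus "expectation (\<lambda>\<omega>. (rescaled_path M S n \<omega> t - rescaled_path M S n \<omega> s)\<^sup>2)
      \<le> 18 * A * (t - s) powr (1 + \<delta>)"
    unfolding eq by (simp add: h_def)
qed

text \<open>The moment bound is uniform in \<open>n\<close>, so one dyadic condition captures all paths with the prescribed
  probability; \<open>B\<close> is chosen after \<open>\<epsilon>\<close> from the tail estimate.\<close>
lemma rescaled_paths_tight:
  fixes S :: "nat \<Rightarrow> 'a \<Rightarrow> real"
  assumes meas [measurable]: "\<And>i. S i \<in> borel_measurable M"
    and S0: "\<And>\<omega>. S 0 \<omega> = 0"
    and int: "\<And>k m. integrable M (\<lambda>\<omega>. (S (k + m) \<omega> - S k \<omega>)\<^sup>2)"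
    and mom: "\<And>k m. expectation (\<lambda>\<omega>. (S (k + m) \<omega> - S k \<omega>)\<^sup>2) = w m"
    and sd: "\<And>n. (std_deviation M (S n))\<^sup>2 = w n"
    and wpos: "\<And>n. 1 \<le> n \<Longrightarrow> 0 < w n"
    and "0 < A" "0 < \<delta>" "\<delta> \<le> 1"
    and growth: "\<And>m n. 1 \<le> m \<Longrightarrow> 1 \<le> n \<Longrightarrow> real m \<le> max 1 (2 * T) * real n \<Longrightarrow>
       w m \<le> A * (real m / real n) powr (1 + \<delta>) * w n"
    and T: "0 < T"
  shows "tight_random_variables M (C_space T) {n. n \<ge> 1}
           (\<lambda>n \<omega>. restrict (rescaled_path M S n \<omega>) {0..T})"
  unfolding tight_random_variables_def
proof (intro conjI ballI allI impI)
  have path: "restrict (rescaled_path M S n \<omega>) {0..T}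
      = restrict (\<lambda>t. polygon (\<lambda>i. S i \<omega>) (real n * t) * inverse (std_deviation M (S n))) {0..T}" for n \<omega>
    by (intro restrict_ext) (simp add: rescaled_path_polygon divide_inverse)
  fix n
  show "(\<lambda>\<omega>. restrict (rescaled_path M S n \<omega>) {0..T}) \<in> M \<rightarrow>\<^sub>M borel_of (C_space T)"
    unfolding path by (rule polygon_path_measurable[OF meas])
next
  fix \<epsilon> :: real assume \<epsilon>: "0 < \<epsilon>"
  define D where "D = 18 * A"
  define \<rho> :: real where "\<rho> = 2 powr (- \<delta> / 4)"
  define c where "c = D * T powr (1 + \<delta>) / (1 - 2 powr (- \<delta> / 2))"
  define B where "B = sqrt (c / \<epsilon>) + 1"
  have D: "0 \<le> D" using \<open>0 < A\<close> by (simp add: D_def)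
  have lt1: "2 powr (- \<delta> / 2) < (1 :: real)" "\<rho> < 1"
    using \<open>0 < \<delta>\<close> powr_less_cancel_iff[of 2 "- \<delta> / 2" 0] powr_less_cancel_iff[of 2 "- \<delta> / 4" 0]
    by (auto simp: \<rho>_def)
  have \<rho>: "0 < \<rho>" by (simp add: \<rho>_def)
  have c: "0 \<le> c" using D lt1 by (simp add: c_def)
  have B: "0 < B" using c \<epsilon> by (simp add: B_def add_nonneg_pos)
  have "c / \<epsilon> \<le> B\<^sup>2"
  proof -
    have "c / \<epsilon> = (sqrt (c / \<epsilon>))\<^sup>2" using c \<epsilon> by simp
    also have "\<dots> \<le> B\<^sup>2" unfolding B_def using c \<epsilon> by (intro power_mono) auto
    finally show ?thesis .
  qed
  hence cB: "c / B\<^sup>2 \<le> \<epsilon>" using \<epsilon> B by (simp add: field_simps)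
  let ?K = "dyadic_compact T B \<rho>"
  have "1 - \<epsilon> \<le> prob {\<omega> \<in> space M. restrict (rescaled_path M S n \<omega>) {0..T} \<in> ?K}" if n: "1 \<le> n" for n
  proof -
    let ?Z = "\<lambda>t \<omega>. rescaled_path M S n \<omega> t"
    have im: "integrable M (\<lambda>\<omega>. (?Z t \<omega> - ?Z s \<omega>)\<^sup>2)"
        "expectation (\<lambda>\<omega>. (?Z t \<omega> - ?Z s \<omega>)\<^sup>2) \<le> D * (t - s) powr (1 + \<delta>)"
      if "0 \<le> s" "s \<le> t" "t \<le> T" for s t
      unfolding D_def
      by (rule rescaled_increment_moment[where w = w and T = T];
          use meas int mom sd wpos \<open>0 < A\<close> \<open>0 < \<delta>\<close> \<open>\<delta> \<le> 1\<close> growth n that in blast)+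
    have int': "integrable M (\<lambda>\<omega>. (?Z t \<omega> - ?Z s \<omega>)\<^sup>2)" if "s \<in> {0..T}" "t \<in> {0..T}" for s t
    proof (cases "s \<le> t")
      case True
      then show ?thesis using im(1)[of s t] that by auto
    next
      case False
      then show ?thesis using im(1)[of t s] that by (simp add: power2_commute)
    qed
    have "1 - \<epsilon> \<le> 1 - D * T powr (1 + \<delta>) / (B\<^sup>2 * (1 - 2 powr (- \<delta> / 2)))"
      using cB by (simp add: c_def mult.commute)
    also have "\<dots> \<le> prob {\<omega> \<in> space M. dyadic_increments_bounded T B \<rho> (\<lambda>t. ?Z t \<omega>)}"
      unfolding \<rho>_def
    proof (rule dyadic_increment_tail[OF T \<open>0 < \<delta>\<close> B D])
      show "?Z t \<in> borel_measurable M" for t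
        unfolding rescaled_path_polygon polygon_def by measurable
      show "expectation (\<lambda>\<omega>. (?Z t \<omega> - ?Z s \<omega>)\<^sup>2) \<le> D * (t - s) powr (1 + \<delta>)"
        if "0 \<le> s" "s \<le> t" "t \<le> T" for s t
        by (rule im(2)[OF that])
    qed (rule int')
    also have "{\<omega> \<in> space M. dyadic_increments_bounded T B \<rho> (\<lambda>t. ?Z t \<omega>)}
        = {\<omega> \<in> space M. restrict (rescaled_path M S n \<omega>) {0..T} \<in> ?K}"
    proof -
      have "restrict (rescaled_path M S n \<omega>) {0..T} \<in> mspace (C_metric T)" for \<omega>
        unfolding rescaled_path_polygon divide_inverse by (rule polygon_path_in_C_metric)
      moreover have "restrict (rescaled_path M S n \<omega>) {0..T} 0 = 0" for \<omega>
        using T by (simp add: rescaled_path_polygon polygon_def S0)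
      moreover have "dyadic_increments_bounded T B \<rho> (restrict (rescaled_path M S n \<omega>) {0..T})
          = dyadic_increments_bounded T B \<rho> (rescaled_path M S n \<omega>)" for \<omega>
        by (rule dyadic_increments_bounded_cong[OF T]) simp
      ultimately show ?thesis by (simp add: dyadic_compact_def del: mspace_cfunspace)
    qed
    finally show ?thesis .
  qed
  thus "\<exists>K. compactin (C_space T) K \<and> (\<forall>n\<in>{n. n \<ge> 1}. 1 - \<epsilon> \<le> prob {\<omega> \<in> space M. restrict (rescaled_path M S n \<omega>) {0..T} \<in> K})"
    using compactin_dyadic_compact[OF T _ \<rho> lt1(2), of B] B by auto
qed

end

section \<open>The colour law\<close>

lemma two_point_moments:
  assumes N: "prob_space N" and \<xi> [measurable]: "\<xi> \<in> borel_measurable N" and p: "0 < p" "p < 1"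
    and plus: "measure N {\<omega> \<in> space N. \<xi> \<omega> = 1} = p"
    and minus: "measure N {\<omega> \<in> space N. \<xi> \<omega> = -1} = 1 - p"
    and Y [measurable]: "Y \<in> borel_measurable N" and Y_eq: "\<forall>\<omega>\<in>space N. Y \<omega> = \<xi> \<omega> - (2 * p - 1)"
  shows "integrable N (\<lambda>\<omega>. (Y \<omega>)\<^sup>2)" "(\<integral>\<omega>. Y \<omega> \<partial>N) = 0" "0 < (\<integral>\<omega>. (Y \<omega>)\<^sup>2 \<partial>N)"
proof -
  interpret N: prob_space N by (rule N)
  define P Q where "P = {\<omega> \<in> space N. \<xi> \<omega> = 1}" and "Q = {\<omega> \<in> space N. \<xi> \<omega> = -1}"
  have ev [measurable]: "P \<in> sets N" "Q \<in> sets N" unfolding P_def Q_def by measurable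
  have "P \<inter> Q = {}" by (auto simp: P_def Q_def)
  hence "N.prob (P \<union> Q) = 1"
    using plus minus by (simp add: N.finite_measure_Union P_def[symmetric] Q_def[symmetric])
  hence "AE \<omega> in N. \<omega> \<in> P \<union> Q" by (rule N.AE_prob_1)
  hence ae: "AE \<omega> in N. Y \<omega> = 2 * (1 - p) * indicator P \<omega> + (- 2 * p) * indicator Q \<omega>"
    using AE_space by eventually_elim (auto simp: Y_eq P_def Q_def indicator_def)
  have ae2: "AE \<omega> in N. (Y \<omega>)\<^sup>2 = (2 * (1 - p))\<^sup>2 * indicator P \<omega> + (2 * p)\<^sup>2 * indicator Q \<omega>"
    using ae by eventually_elim (auto simp: indicator_def P_def Q_def)
  have i: "has_bochner_integral N (\<lambda>\<omega>. a * indicator P \<omega> + b * indicator Q \<omega>) (a * p + b * (1 - p))" for a b :: real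
  proof -
    have "has_bochner_integral N (indicator P) p" "has_bochner_integral N (indicator Q) (1 - p)"
      using has_bochner_integral_real_indicator[OF ev(1)] has_bochner_integral_real_indicator[OF ev(2)] plus minus
      by (auto simp: P_def[symmetric] Q_def[symmetric] N.emeasure_eq_measure)
    thus ?thesis
      by (intro has_bochner_integral_add has_bochner_integral_mult_right)
  qed
  have "(\<integral>\<omega>. Y \<omega> \<partial>N) = 2 * (1 - p) * p + (- 2 * p) * (1 - p)"
    using ae has_bochner_integral_integral_eq[OF i, of "2 * (1 - p)" "- 2 * p"]
    by (subst integral_cong_AE[OF _ _ ae]) auto
  thus "(\<integral>\<omega>. Y \<omega> \<partial>N) = 0" by simp
  have "integrable N (\<lambda>\<omega>. (2 * (1 - p))\<^sup>2 * indicator P \<omega> + (2 * p)\<^sup>2 * indicator Q \<omega>)"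
    using i by (rule integrable.intros)
  thus "integrable N (\<lambda>\<omega>. (Y \<omega>)\<^sup>2)"
    using integrable_cong_AE[OF _ _ ae2] by simp
  have "(\<integral>\<omega>. (Y \<omega>)\<^sup>2 \<partial>N) = (2 * (1 - p))\<^sup>2 * p + (2 * p)\<^sup>2 * (1 - p)"
    using ae2 has_bochner_integral_integral_eq[OF i, of "(2 * (1 - p))\<^sup>2" "(2 * p)\<^sup>2"]
    by (subst integral_cong_AE[OF _ _ ae2]) auto
  also have "\<dots> > 0" using p by (intro add_pos_pos mult_pos_pos) auto
  finally show "0 < (\<integral>\<omega>. (Y \<omega>)\<^sup>2 \<partial>N)" .
qed

lemma fourth_moment_second_moment:
  assumes N: "prob_space N" and Y [measurable]: "Y \<in> borel_measurable N"
    and int: "integrable N (\<lambda>\<omega>. Y \<omega> ^ 4)" and pos: "0 < (\<integral>\<omega>. Y \<omega> ^ 4 \<partial>N)"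
  shows "integrable N (\<lambda>\<omega>. (Y \<omega> :: real)\<^sup>2)" "0 < (\<integral>\<omega>. (Y \<omega>)\<^sup>2 \<partial>N)"
proof -
  interpret N: prob_space N by (rule N)
  have four: "Y \<omega> ^ 4 = ((Y \<omega>)\<^sup>2)\<^sup>2" for \<omega> by simp
  show i: "integrable N (\<lambda>\<omega>. (Y \<omega>)\<^sup>2)"
    using int unfolding four by (rule N.square_integrable_imp_integrable[rotated]) measurable
  show "0 < (\<integral>\<omega>. (Y \<omega>)\<^sup>2 \<partial>N)"
  proof (rule ccontr)
    assume "\<not> 0 < (\<integral>\<omega>. (Y \<omega>)\<^sup>2 \<partial>N)"
    moreover have "0 \<le> (\<integral>\<omega>. (Y \<omega>)\<^sup>2 \<partial>N)" by simp
    ultimately have "(\<integral>\<omega>. (Y \<omega>)\<^sup>2 \<partial>N) = 0" by linarith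
    hence "AE \<omega> in N. (Y \<omega>)\<^sup>2 = 0" using integral_nonneg_eq_0_iff_AE[OF i] by simp
    hence "AE \<omega> in N. Y \<omega> ^ 4 = 0" by eventually_elim simp
    hence "(\<integral>\<omega>. Y \<omega> ^ 4 \<partial>N) = 0" by (rule integral_eq_zero_AE)
    with pos show False by simp
  qed
qed

theorem proposition1p3:
  fixes \<alpha> :: real and L :: "real \<Rightarrow> real" and \<mu> :: "nat pmf"
    and N :: "'b measure" and Y :: "'b \<Rightarrow> real"
    and M :: "'a measure" and R :: "int \<Rightarrow> 'a \<Rightarrow> nat"
    and rep :: "(int \<Rightarrow> nat) \<Rightarrow> int \<Rightarrow> int" and C :: "int \<Rightarrow> 'a \<Rightarrow> real"
    and T :: real
  defines "S \<equiv> partial_sum (vertex_colour R rep C)"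
  assumes alpha: "0 < \<alpha>" "\<alpha> < 1 / 2"
    and L: "slowly_varying L"
    and mu_support: "set_pmf \<mu> \<subseteq> {1..}"
    and mu_tail: "(\<lambda>n. measure_pmf.prob \<mu> {n..}) \<sim>[at_top]
                    (\<lambda>n. real n powr (-\<alpha>) * L (real n))"
    and mu_gcd: "Gcd {n. n \<ge> 1 \<and> pmf \<mu> n > 0} = 1"
    and Y: "prob_space N" "Y \<in> borel_measurable N"
    and Y_cases:
      "(\<exists>p \<xi>. 0 < p \<and> p < 1 \<and> \<xi> \<in> borel_measurable N \<and>
              measure N {\<omega> \<in> space N. \<xi> \<omega> = 1} = p \<and>
              measure N {\<omega> \<in> space N. \<xi> \<omega> = -1} = 1 - p \<and>
              (\<forall>\<omega>\<in>space N. Y \<omega> = \<xi> \<omega> - (2 * p - 1)))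
       \<or>
       (renewal_weight \<mu> \<sim>[at_top]
          (\<lambda>n. 1 / (Gamma \<alpha> * Gamma (1 - \<alpha>)) * (real n powr (\<alpha> - 1) / L (real n))) \<and>
        integrable N (\<lambda>\<omega>. Y \<omega> ^ 4) \<and>
        (\<integral>\<omega>. Y \<omega> \<partial>N) = 0 \<and>
        0 < (\<integral>\<omega>. Y \<omega> ^ 4 \<partial>N))"
    and graph: "coloured_graph M \<mu> (distr N borel Y) R rep C"
    and T: "T > 0"
  shows "tight_random_variables M (C_space T) {n. n \<ge> 1}
           (\<lambda>n \<omega>. restrict (rescaled_path M S n \<omega>) {0..T})"
proof -
  note [measurable] = Y(2)
  have Y_int: "integrable N (\<lambda>\<omega>. (Y \<omega>)\<^sup>2)" and Y_mean: "(\<integral>\<omega>. Y \<omega> \<partial>N) = 0"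
    and Y_var: "0 < (\<integral>\<omega>. (Y \<omega>)\<^sup>2 \<partial>N)"
    using Y_cases two_point_moments[OF Y(1) _ _ _ _ _ Y(2)] fourth_moment_second_moment[OF Y] by blast+
  define v where "v = (\<integral>x. x\<^sup>2 \<partial>distr N borel Y)"
  have v: "0 < v" using Y_var unfolding v_def by (subst integral_distr) auto
  note pos = tail_pos[OF L mu_tail]
  note l2 = pair_sum_growth(1)[OF alpha L mu_support mu_tail mu_gcd]
  obtain A where A: "0 < A" and growth: "\<And>m n. 1 \<le> m \<Longrightarrow> 1 \<le> n \<Longrightarrow>
      real m \<le> max 1 (2 * T) * real n \<Longrightarrow>
      pair_sum (green \<mu>) m \<le> A * (real m / real n) powr (1 + \<alpha>) * pair_sum (green \<mu>) n"
    using pair_sum_growth(2)[OF alpha L mu_support mu_tail mu_gcd, of "max 1 (2 * T)"] by auto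
  interpret coloured_graph M \<mu> "distr N borel Y" R rep C by (rule graph)
  interpret square_integrable_colours M \<mu> "distr N borel Y" R rep C
  proof
    show "integrable (distr N borel Y) (\<lambda>x. x\<^sup>2)" using Y_int by (subst integrable_distr_eq) auto
    show "(\<integral>x. x \<partial>distr N borel Y) = 0" using Y_mean by (subst integral_distr) auto
  qed (fact mu_support pos l2)+
  define w where "w n = v / green \<mu> 0 * pair_sum (green \<mu>) n" for n
  have factor: "0 < v / green \<mu> 0" using v green_0_ge_1[OF l2] by simp
  show ?thesis
    unfolding S_def
  proof (rule rescaled_paths_tight[where w = w and A = A and \<delta> = \<alpha>])
    show "partial_sum colouring 0 \<omega> = 0" for \<omega> by (simp add: partial_sum_def)
    show "integrable M (\<lambda>\<omega>. (partial_sum colouring (k + m) \<omega> - partial_sum colouring k \<omega>)\<^sup>2)" for k m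
      by (rule increment_second_moment(1))
    show "expectation (\<lambda>\<omega>. (partial_sum colouring (k + m) \<omega> - partial_sum colouring k \<omega>)\<^sup>2) = w m" for k m
      unfolding w_def v_def by (rule increment_second_moment(2))
    show "(std_deviation M (partial_sum colouring n))\<^sup>2 = w n" for n
      unfolding w_def v_def by (rule std_deviation_partial_sum)
    show "0 < w n" if "1 \<le> n" for n
      unfolding w_def using factor pair_sum_pos[OF l2 that] by (rule mult_pos_pos)
    show "w m \<le> A * (real m / real n) powr (1 + \<alpha>) * w n" if "1 \<le> m" "1 \<le> n" "real m \<le> max 1 (2 * T) * real n" for m n
    proof -
      have "v / green \<mu> 0 * pair_sum (green \<mu>) m
          \<le> v / green \<mu> 0 * (A * (real m / real n) powr (1 + \<alpha>) * pair_sum (green \<mu>) n)"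
        using growth[OF that] factor by (intro mult_left_mono) auto
      thus ?thesis unfolding w_def by (simp only: mult_ac)
    qed
  qed (use alpha A T in auto)
qed

end
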